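(* Let $a,b,c\in\mathbb{Z}^{+}$ with $\gcd(a,b,c)=1$. Then the form $$f(x,y,z):=ax^2+bT_y+cT_z$$ is asymptotically universal if and only if both of the following conditions hold: (1) $-bc\,R\,a'$, $-2ac\,R\,b'$, and $-2ab\,R\,c'$. (2) Either $4\nmid b$ or $4\nmid c$.
   Context: $\mathbb{N}=\{0,1,2,\ldots\}$ and $\mathbb{Z}^{+}=\{1,2,3,\ldots\}$. For $x\in\mathbb{Z}$, $T_x=x(x+1)/2$. For a form $f(x,y,z)$ as in the claim, with variables ranging over $\mathbb{Z}$, put $E(f)=\{n\in\mathbb{N}: f(x,y,z)=n \text{ has no solution } x,y,z\in\mathbb{Z}\}$. The form $f$ is asymptotically universal if $E(f)$ has asymptotic density zero, i.e. $\lim_{N\to\infty}\frac1N|\{1\le n\le N: n=f(x,y,z)\text{ for some }x,y,z\in\mathbb{Z}\}|=1$. For a positive integer $n$, $v_2(n)$ is the 2-adic order of $n$ and $n'=n/2^{v_2(n)}$ is the odd part of $n$. For $u\in\mathbb{Z}$ and $m\in\mathbb{Z}^+$, $u\,R\,m$ means that $\gcd(u,m)=1$ and the congruence $x^2\equiv u\pmod m$ is solvable in $\mathbb{Z}$. *)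

theory Defs
  imports Complex_Main "HOL-Number_Theory.Number_Theory"
begin

definition triangular :: "int \<Rightarrow> int" where
  "triangular x = x * (x + 1) div 2"

definition exceptional_set :: "(int \<Rightarrow> int \<Rightarrow> int \<Rightarrow> int) \<Rightarrow> nat set" where
  "exceptional_set f = {n. \<not> (\<exists>x y z. f x y z = int n)}"

definition has_asymptotic_density :: "nat set \<Rightarrow> real \<Rightarrow> bool" where
  "has_asymptotic_density A d \<longleftrightarrow>
     (\<lambda>N. real (card {n \<in> A. 1 \<le> n \<and> n \<le> N}) / real N) \<longlonglongrightarrow> d"

definition asymptotically_universal :: "(int \<Rightarrow> int \<Rightarrow> int \<Rightarrow> int) \<Rightarrow> bool" where
  "asymptotically_universal f \<longleftrightarrow> has_asymptotic_density (exceptional_set f) 0"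

text \<open>Equivalently, the represented positive integers have asymptotic density one.\<close>

lemma asymptotically_universal_iff:
  "asymptotically_universal f \<longleftrightarrow>
     (\<lambda>N. real (card {n::nat. 1 \<le> n \<and> n \<le> N \<and> (\<exists>x y z. int n = f x y z)}) / real N)
       \<longlonglongrightarrow> 1"
proof -
  define A where "A N = {n \<in> exceptional_set f. 1 \<le> n \<and> n \<le> N}" for N
  define B where "B N = {n::nat. 1 \<le> n \<and> n \<le> N \<and> (\<exists>x y z. int n = f x y z)}" for N
  have fin: "finite (A N)" "finite (B N)" for N
    by (rule finite_subset[of _ "{..N}"]; force simp: A_def B_def)+
  have "A N \<inter> B N = {}" "A N \<union> B N = {1..N}" for N
    by (auto simp: A_def B_def exceptional_set_def eq_commute[of "int _"])
  then have "card (A N) + card (B N) = N" for N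
    using card_Un_disjoint[OF fin, of N N] by simp
  then have sum: "real (card (A N)) + real (card (B N)) = real N" for N
    by (metis of_nat_add)
  have A: "real (card (A N)) / real N = 1 - real (card (B N)) / real N" if "N > 0" for N
    using sum[of N] that by (simp add: field_simps)
  have "(\<lambda>N. real (card (A N)) / real N) \<longlonglongrightarrow> 0 \<longleftrightarrow>
        (\<lambda>N. 1 - real (card (B N)) / real N) \<longlonglongrightarrow> 0"
    by (rule tendsto_cong) (auto intro: eventually_mono[OF eventually_gt_at_top[of 0]] A)
  also have "\<dots> \<longleftrightarrow> (\<lambda>N. real (card (B N)) / real N) \<longlonglongrightarrow> 1"
    using tendsto_diff[OF tendsto_const[of "1::real"],
        of "\<lambda>N. 1 - real (card (B N)) / real N" 0 sequentially]
      tendsto_diff[OF tendsto_const[of "1::real"],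
        of "\<lambda>N. real (card (B N)) / real N" 1 sequentially]
    by auto
  finally show ?thesis
    unfolding asymptotically_universal_def has_asymptotic_density_def A_def B_def .
qed

definition odd_part :: "int \<Rightarrow> int" where
  "odd_part n = n div 2 ^ multiplicity 2 n"

text \<open>The relation \<open>u R m\<close>. Note that \<^const>\<open>QuadRes\<close> takes the modulus first.\<close>

definition quad_residue_coprime :: "int \<Rightarrow> int \<Rightarrow> bool"  (infix "\<R>" 50) where
  "u \<R> m \<longleftrightarrow> coprime u m \<and> QuadRes m u"

end

theory Submission
  imports Defs "HOL-Analysis.Kronecker_Approximation_Theorem"
begin

text \<open>
  Suppose that the local conditions hold, and let \<open>R(n)\<close> be the number of representations of \<open>n\<close>
  in a box of side \<open>P\<close> of order \<open>\<surd>N\<close>, smoothed by tents. The correlation \<open>\<Sum> R(n) R(n + h)\<close> counts pairs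
  \<open>w, w + u\<close> with \<open>f(w + u) - f(w) = h\<close>, which for fixed \<open>u\<close> is a linear equation in \<open>w\<close>. For most \<open>u\<close>
  and for \<open>h\<close> divisible by a suitable fixed \<open>q\<close> with \<open>0 \<le> h \<le> \<eta> P\<^sup>2\<close>, a short translation of \<open>w\<close> turns the
  equation for \<open>0\<close> into the equation for \<open>h\<close>; the other \<open>u\<close> are negligible by lattice point counts.
  Hence \<open>\<Sum> (R(n + h) - R(n))\<^sup>2 = o(P\<^sup>4)\<close>, and if \<open>R\<close> vanishes on a set \<open>E\<close>, then the mean of \<open>R(n + h)\<close> over
  such \<open>h\<close> is small for most \<open>n \<in> E\<close>. But this mean is at least a constant times \<open>P\<close> times the density of
  solutions modulo \<open>q\<close>. The average over \<open>n\<close> of the inverse of this density is bounded uniformly in \<open>q\<close>: it is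
  multiplicative, the prime 2 is harmless because \<open>b\<close> or \<open>c\<close> is not divisible by 4, the primes dividing
  \<open>a b c\<close> contribute a bounded factor by isotropy, and any other prime \<open>p\<close> contributes \<open>1 + O(1/p\<^sup>2)\<close>,
  by the second moment of the number of solutions modulo \<open>p\<close>. So \<open>E\<close> has density 0.

  Conversely, if a condition fails, then a residue class modulo \<open>p\<^sup>2\<close> or modulo \<open>4\<close> is missed.\<close>

section \<open>Lattice points on planes\<close>

text \<open>Since only almost all \<open>n\<close> are asked for, second moments suffice, and
  differencing turns both the correlations and the moments modulo \<open>p\<close> into linear
  equations. The obstacle is that the modulus \<open>q\<close> and the window parameter
  \<open>\<eta>\<close> come out of the tolerance \<open>\<epsilon>\<close> without usable control.
  The final bound must not depend on them, and they do cancel: the number of shifts is of order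
  \<eta> P^2 / q, and the lower bound for the sum of R(n + h) over them is of order \<eta> P^3 / q.
  Nor can the local densities simply be bounded below. Modulo an unramified prime a ternary form may
  have only p^2 - p solutions, and a product of factors 1 - 1/p over the primes dividing
  \<open>q\<close> has no positive lower bound as \<open>q\<close> varies. Hence the inverse density
  is averaged, where the deviations cancel to first order, and Markov's inequality discards the few
  \<open>n\<close> whose density is small.\<close>

lemma card_separated_le:
  fixes S :: "int set" and k P :: int
  assumes "S \<subseteq> {-P..P}" "k > 0" "P \<ge> 0"
    and sep: "\<And>x y. x \<in> S \<Longrightarrow> y \<in> S \<Longrightarrow> k dvd x - y"
  shows "real (card S) \<le> 2 * P / k + 1"
proof (cases "S = {}")
  case True
  then show ?thesis using assms by simp
next
  case False
  have fin: "finite S" using assms(1) finite_subset by blast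
  define m where "m = Min S"
  have m: "m \<in> S" "\<And>x. x \<in> S \<Longrightarrow> m \<le> x" using fin False by (auto simp: m_def)
  have dv: "k dvd x - m" if "x \<in> S" for x using sep m(1) that by blast
  have inj: "inj_on (\<lambda>x. (x - m) div k) S"
    by (rule inj_onI) (metis dv dvd_div_eq_cancel diff_add_cancel)
  have "(\<lambda>x. (x - m) div k) ` S \<subseteq> {0..2 * P div k}"
  proof
    fix t assume "t \<in> (\<lambda>x. (x - m) div k) ` S"
    then obtain x where x: "x \<in> S" "t = (x - m) div k" by blast
    have "m \<le> x" "x \<le> P" "-P \<le> m" using m x assms(1) by force+
    then have "0 \<le> x - m" "x - m \<le> 2 * P" by simp_all
    then show "t \<in> {0..2 * P div k}" using x(2) \<open>k > 0\<close>
      by (auto simp: zdiv_mono1 pos_imp_zdiv_nonneg_iff)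
  qed
  then have "card S \<le> card {0..2 * P div k}"
    using inj card_inj_on_le by blast
  also have "\<dots> = nat (2 * P div k + 1)" by simp
  finally have "real (card S) \<le> real (nat (2 * P div k + 1))" by simp
  also have "\<dots> = real_of_int (2 * P div k) + 1" using assms pos_imp_zdiv_nonneg_iff[of k "2*P"] by simp
  also have "\<dots> \<le> 2 * P / k + 1" using real_of_int_div4[of "2 * P" k] by simp
  finally show ?thesis .
qed

lemma dvd_mult_imp_div_gcd_dvd:
  fixes d A k :: int
  assumes "d dvd A * k" "d \<noteq> 0"
  shows "d div gcd A d dvd k"
proof -
  have "coprime (d div gcd A d) (A div gcd A d)"
    by (metis assms(2) div_gcd_coprime gcd.commute)
  moreover have "d div gcd A d dvd (A div gcd A d) * k"
  proof -
    have "gcd A d * (d div gcd A d) dvd gcd A d * ((A div gcd A d) * k)"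
      using assms(1) by (metis dvd_mult_div_cancel gcd_dvd1 gcd_dvd2 mult.assoc)
    then show ?thesis using assms(2) by (simp only: dvd_times_left_cancel_iff gcd_eq_0_iff simp_thms)
  qed
  ultimately show ?thesis using coprime_dvd_mult_right_iff by blast
qed

text \<open>With d = gcd B M and g = gcd A d, an admissible \<open>x\<close> lies in one class
  modulo d / g, and each such \<open>x\<close> leaves one class modulo \<bar>M\<bar> / d for
  \<open>y\<close>. The product (2 P g / d + 1) (2 P d / \<bar>M\<bar> + 1) gives the main term, and
  g \<le> d \<le> \<bar>M\<bar> bounds the cross terms.\<close>

lemma card_linear_congruence_le:
  fixes A B M m P :: int
  assumes M: "M \<noteq> 0" and P: "P \<ge> 1"
  shows "real (card {(x, y). x \<in> {-P..P} \<and> y \<in> {-P..P} \<and> M dvd A * x + B * y - m})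
    \<le> 4 * P\<^sup>2 * gcd A (gcd B M) / \<bar>M\<bar> + 5 * P"
proof -
  define d where "d = gcd B M"
  define g where "g = gcd A d"
  have d0: "d > 0" using M by (simp add: d_def)
  have g0: "g > 0" using d0 by (simp add: g_def)
  have gd: "g dvd d" "d dvd M" unfolding g_def d_def by (rule gcd_dvd2)+
  have gled: "g \<le> d" using gd(1) d0 zdvd_imp_le by blast
  have dleM: "d \<le> \<bar>M\<bar>" using gd(2) M by (meson abs_ge_self dual_order.trans dvd_imp_le_int)
  define X where "X = {x \<in> {-P..P}. \<exists>y. M dvd A * x + B * y - m}"
  define Y where "Y x = {y \<in> {-P..P}. M dvd A * x + B * y - m}" for x
  have finX: "finite X" by (rule finite_subset[of _ "{-P..P}"]) (auto simp: X_def)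
  have finY: "finite (Y x)" for x by (rule finite_subset[of _ "{-P..P}"]) (auto simp: Y_def)
  have "{(x, y). x \<in> {-P..P} \<and> y \<in> {-P..P} \<and> M dvd A * x + B * y - m} \<subseteq> Sigma X Y"
    by (auto simp: X_def Y_def)
  then have "card {(x, y). x \<in> {-P..P} \<and> y \<in> {-P..P} \<and> M dvd A * x + B * y - m} \<le> card (Sigma X Y)"
    by (intro card_mono finite_SigmaI finX finY)
  also have "\<dots> = (\<Sum>x\<in>X. card (Y x))" using finX finY by simp
  finally have c1: "real (card {(x, y). x \<in> {-P..P} \<and> y \<in> {-P..P} \<and> M dvd A * x + B * y - m})
     \<le> (\<Sum>x\<in>X. real (card (Y x)))" by (simp only: of_nat_sum[symmetric] of_nat_le_iff)
  have cY: "real (card (Y x)) \<le> 2 * P * d / \<bar>M\<bar> + 1" for x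
  proof -
    have "\<bar>M\<bar> div d dvd y - y'" if "y \<in> Y x" "y' \<in> Y x" for y y'
    proof -
      have "M dvd (A * x + B * y - m) - (A * x + B * y' - m)"
        using that unfolding Y_def mem_Collect_eq by (blast intro: dvd_diff)
      also have "(A * x + B * y - m) - (A * x + B * y' - m) = B * (y - y')" by (simp add: algebra_simps)
      finally have "M div d dvd y - y'" using dvd_mult_imp_div_gcd_dvd[of M B "y-y'"] M by (simp add: d_def)
      moreover have "\<bar>M\<bar> div d = \<bar>M div d\<bar>"
      proof -
        obtain k where "M = d * k" using gd(2) by blast
        then show ?thesis using d0 by (simp add: abs_mult)
      qed
      ultimately show ?thesis by simp
    qed
    then have "real (card (Y x)) \<le> 2 * P / (\<bar>M\<bar> div d) + 1"
      using d0 dleM P by (intro card_separated_le) (auto simp: Y_def pos_imp_zdiv_pos_iff)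
    also have "2 * P / (\<bar>M\<bar> div d) = 2 * P * d / \<bar>M\<bar>"
    proof -
      have "real_of_int (\<bar>M\<bar> div d) = \<bar>M\<bar> / d" using gd(2) by (simp add: real_of_int_div)
      then show ?thesis by simp
    qed
    finally show ?thesis by simp
  qed
  have cX: "real (card X) \<le> 2 * P * g / d + 1"
  proof -
    have "d div g dvd x - x'" if xx: "x \<in> X" "x' \<in> X" for x x'
    proof -
      obtain y y' where "M dvd A * x + B * y - m" "M dvd A * x' + B * y' - m"
        using xx unfolding X_def by blast
      then have "d dvd (A * x + B * y - m) - (A * x' + B * y' - m)"
        using gd(2) by (meson dvd_diff dvd_trans)
      moreover have "d dvd B * (y - y')" by (simp add: d_def)
      ultimately have "d dvd ((A * x + B * y - m) - (A * x' + B * y' - m)) - B * (y - y')" by (rule dvd_diff)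
      also have "\<dots> = A * (x - x')" by (simp add: algebra_simps)
      finally have "d dvd A * (x - x')" by (simp add: algebra_simps)
      then show ?thesis using dvd_mult_imp_div_gcd_dvd[of d A] d0 by (simp add: g_def)
    qed
    then have "real (card X) \<le> 2 * P / (d div g) + 1"
      using d0 g0 gled P by (intro card_separated_le) (auto simp: X_def pos_imp_zdiv_pos_iff)
    also have "2 * P / (d div g) = 2 * P * g / d"
      using gd(1) by (simp add: real_of_int_div)
    finally show ?thesis by simp
  qed
  have "(\<Sum>x\<in>X. real (card (Y x))) \<le> real (card X) * (2 * P * d / \<bar>M\<bar> + 1)"
    using sum_bounded_above[of X "\<lambda>x. real (card (Y x))", OF cY] by simp
  also have "\<dots> \<le> (2 * P * g / d + 1) * (2 * P * d / \<bar>M\<bar> + 1)"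
    using cX P d0 by (intro mult_right_mono) auto
  also have "\<dots> = 4 * P\<^sup>2 * g / \<bar>M\<bar> + 2 * P * (g / d) + 2 * P * (d / \<bar>M\<bar>) + 1"
    using d0 M by (simp add: field_simps power2_eq_square)
  also have "\<dots> \<le> 4 * P\<^sup>2 * g / \<bar>M\<bar> + 2 * P * (1::real) + 2 * P * (1::real) + P"
    using gled dleM d0 M P by (intro add_mono mult_left_mono order_refl) auto
  finally show ?thesis using c1 by (simp add: g_def d_def)
qed

definition vbox :: "int \<Rightarrow> (int \<times> int \<times> int) set" where
  "vbox R = {-R..R} \<times> {-R..R} \<times> {-R..R}"

lemma finite_vbox [simp]: "finite (vbox R)"
  by (simp add: vbox_def)

lemma mem_vbox [simp]: "(x, y, z) \<in> vbox R \<longleftrightarrow> \<bar>x\<bar> \<le> R \<and> \<bar>y\<bar> \<le> R \<and> \<bar>z\<bar> \<le> R"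
  by (auto simp: vbox_def)

lemma card_plane_pivot:
  fixes A B M m P :: int
  assumes M: "M \<noteq> 0" and P: "P \<ge> 1"
  shows "real (card {(x, y, z) \<in> vbox P. A * x + B * y + M * z = m})
    \<le> 4 * P\<^sup>2 * gcd A (gcd B M) / \<bar>M\<bar> + 5 * P"
proof -
  let ?S = "{(x, y, z) \<in> vbox P. A * x + B * y + M * z = m}"
  let ?T = "{(x, y). x \<in> {-P..P} \<and> y \<in> {-P..P} \<and> M dvd A * x + B * y - m}"
  have "inj_on (\<lambda>(x, y, z). (x, y)) ?S"
    using M by (auto simp: inj_on_def)
  moreover have "(\<lambda>(x, y, z). (x, y)) ` ?S \<subseteq> ?T"
  proof clarify
    fix x y z assume "(x, y, z) \<in> vbox P"
    then show "x \<in> {-P..P} \<and> y \<in> {-P..P} \<and> M dvd A * x + B * y - (A * x + B * y + M * z)"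
      by auto
  qed
  moreover have "finite ?T" by (rule finite_subset[of _ "{-P..P} \<times> {-P..P}"]) auto
  ultimately have "card ?S \<le> card ?T" by (rule card_inj_on_le)
  then show ?thesis using card_linear_congruence_le[OF M P, of A B m] by linarith
qed

lemma card_plane_le_any_pivot:
  fixes A B M D m P :: int
  assumes P: "P \<ge> 1" and D: "D \<in> {A, B, M}" "D \<noteq> 0"
  shows "real (card {(x, y, z) \<in> vbox P. A * x + B * y + M * z = m})
    \<le> 4 * P\<^sup>2 * gcd A (gcd B M) / \<bar>D\<bar> + 5 * P"
proof -
  consider "D = A" | "D = B" | "D = M" using D by auto
  then show ?thesis
  proof cases
    case 1
    have "card {(x, y, z) \<in> vbox P. A * x + B * y + M * z = m}
      = card {(x, y, z) \<in> vbox P. M * x + B * y + A * z = m}"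
      by (rule bij_betw_same_card[of "\<lambda>(x, y, z). (z, y, x)"],
          rule bij_betw_byWitness[where f' = "\<lambda>(x, y, z). (z, y, x)"]) (auto simp: algebra_simps)
    moreover have "gcd M (gcd B A) = gcd A (gcd B M)" by (simp add: ac_simps)
    ultimately show ?thesis using card_plane_pivot[of A P M B m] 1 D P by metis
  next
    case 2
    have "card {(x, y, z) \<in> vbox P. A * x + B * y + M * z = m}
      = card {(x, y, z) \<in> vbox P. A * x + M * y + B * z = m}"
      by (rule bij_betw_same_card[of "\<lambda>(x, y, z). (x, z, y)"],
          rule bij_betw_byWitness[where f' = "\<lambda>(x, y, z). (x, z, y)"]) (auto simp: algebra_simps)
    moreover have "gcd A (gcd M B) = gcd A (gcd B M)" by (simp add: ac_simps)
    ultimately show ?thesis using card_plane_pivot[of B P A M m] 2 D P by metis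
  next
    case 3
    then show ?thesis using card_plane_pivot[OF _ P, of M A B m] D by blast
  qed
qed

section \<open>Points on planes, measured by the gcd and the size of the vector
  \<open>u\<close>\<close>

definition vgcd :: "int \<times> int \<times> int \<Rightarrow> int" where
  "vgcd = (\<lambda>(x, y, z). gcd x (gcd y z))"

definition vmax :: "int \<times> int \<times> int \<Rightarrow> int" where
  "vmax = (\<lambda>(x, y, z). max \<bar>x\<bar> (max \<bar>y\<bar> \<bar>z\<bar>))"

text \<open>The weight of the zero vector is \<open>0\<close>, by division by zero.\<close>

definition wt :: "int \<times> int \<times> int \<Rightarrow> real" where
  "wt u = vgcd u / vmax u"

lemma vmax_pos: "u \<noteq> (0, 0, 0) \<Longrightarrow> vmax u > 0"
  by (cases u) (auto simp: vmax_def less_max_iff_disj)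

lemma vgcd_pos: "u \<noteq> (0, 0, 0) \<Longrightarrow> vgcd u > 0"
  by (cases u) (auto simp: vgcd_def)

lemma wt_nonneg: "wt u \<ge> 0"
  by (cases u) (auto simp: wt_def vgcd_def vmax_def)

lemma mem_vbox_iff_vmax: "u \<in> vbox R \<longleftrightarrow> vmax u \<le> R"
  by (cases u) (auto simp: vmax_def)

lemma vgcd_le_vmax:
  assumes "u \<noteq> (0, 0, 0)" shows "vgcd u \<le> vmax u"
proof -
  obtain x y z where u: "u = (x, y, z)" by (cases u)
  have "\<exists>t\<in>{x, y, z}. t \<noteq> 0" using assms u by auto
  then obtain t where t: "t \<in> {x, y, z}" "t \<noteq> 0" by blast
  have dv: "vgcd u dvd t"
    using t(1) unfolding u vgcd_def by (auto intro: dvd_trans[OF gcd_dvd2])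
  have "vgcd u \<le> \<bar>t\<bar>" using dv t(2) by (meson dvd_imp_le_int abs_ge_self order_trans)
  then show ?thesis using t by (auto simp: u vmax_def)
qed

text \<open>A plane with normal vector (A, B, M) has about P^2 gcd / max points in the box. Scaling
  by \<alpha>, \<beta>, \<gamma> multiplies the gcd by at most \<alpha> \<beta> \<gamma> and does
  not decrease the maximum, so \<open>wt u\<close> governs the count, uniformly in the constant term
  \<open>m\<close>.\<close>

lemma card_plane_le:
  fixes \<alpha> \<beta> \<gamma> m P :: int
  assumes pos: "\<alpha> > 0" "\<beta> > 0" "\<gamma> > 0" and P: "P \<ge> 1"
    and u: "(u1, u2, u3) \<noteq> (0, 0, 0)" "(u1, u2, u3) \<in> vbox (2 * P)"
  shows "real (card {(x, y, z) \<in> vbox P. \<alpha> * u1 * x + \<beta> * u2 * y + \<gamma> * u3 * z = m})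
    \<le> (4 * \<alpha> * \<beta> * \<gamma> + 10) * P\<^sup>2 * wt (u1, u2, u3)"
proof -
  let ?u = "(u1, u2, u3)"
  let ?S = "{(x, y, z) \<in> vbox P. \<alpha> * u1 * x + \<beta> * u2 * y + \<gamma> * u3 * z = m}"
  define g where "g = gcd (\<alpha> * u1) (gcd (\<beta> * u2) (\<gamma> * u3))"
  have G0: "vgcd ?u > 0" and M0: "vmax ?u > 0" using u vgcd_pos vmax_pos by blast+
  have M2: "vmax ?u \<le> 2 * P" using u(2) mem_vbox_iff_vmax by blast
  have "g dvd (\<alpha> * \<beta> * \<gamma>) * u1" "g dvd (\<alpha> * \<beta> * \<gamma>) * u2" "g dvd (\<alpha> * \<beta> * \<gamma>) * u3"
  proof -
    have "g dvd \<alpha> * u1" "g dvd \<beta> * u2" "g dvd \<gamma> * u3"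
      unfolding g_def by (blast intro: gcd_dvd1 gcd_dvd2 dvd_trans[OF gcd_dvd2])+
    then have "g dvd (\<alpha> * u1) * (\<beta> * \<gamma>)" "g dvd (\<beta> * u2) * (\<alpha> * \<gamma>)" "g dvd (\<gamma> * u3) * (\<alpha> * \<beta>)"
      by (blast intro: dvd_mult2)+
    then show "g dvd (\<alpha> * \<beta> * \<gamma>) * u1" "g dvd (\<alpha> * \<beta> * \<gamma>) * u2" "g dvd (\<alpha> * \<beta> * \<gamma>) * u3"
      by (simp_all add: mult_ac)
  qed
  then have "g dvd gcd ((\<alpha> * \<beta> * \<gamma>) * u1) (gcd ((\<alpha> * \<beta> * \<gamma>) * u2) ((\<alpha> * \<beta> * \<gamma>) * u3))" by simp
  also have "\<dots> = (\<alpha> * \<beta> * \<gamma>) * vgcd ?u"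
    using pos by (simp add: vgcd_def gcd_mult_left abs_mult)
  finally have gle: "g \<le> (\<alpha> * \<beta> * \<gamma>) * vgcd ?u"
    using pos G0 by (intro zdvd_imp_le) auto
  obtain D where D: "D \<in> {\<alpha> * u1, \<beta> * u2, \<gamma> * u3}" "\<bar>D\<bar> \<ge> vmax ?u"
  proof -
    have "\<bar>\<alpha> * u1\<bar> \<ge> \<bar>u1\<bar>" "\<bar>\<beta> * u2\<bar> \<ge> \<bar>u2\<bar>" "\<bar>\<gamma> * u3\<bar> \<ge> \<bar>u3\<bar>"
      using pos by (auto simp: abs_mult mult_le_cancel_right1)
    moreover have "vmax ?u = \<bar>u1\<bar> \<or> vmax ?u = \<bar>u2\<bar> \<or> vmax ?u = \<bar>u3\<bar>"
      by (auto simp: vmax_def max_def)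
    ultimately have "vmax ?u \<le> \<bar>\<alpha> * u1\<bar> \<or> vmax ?u \<le> \<bar>\<beta> * u2\<bar> \<or> vmax ?u \<le> \<bar>\<gamma> * u3\<bar>"
      by presburger
    then show ?thesis using that by blast
  qed
  have D0: "D \<noteq> 0" using D(2) M0 by auto
  have "real (card ?S) \<le> 4 * P\<^sup>2 * g / \<bar>D\<bar> + 5 * P"
    using card_plane_le_any_pivot[OF P D(1) D0, of m] unfolding g_def .
  also have "4 * P\<^sup>2 * g / \<bar>D\<bar> \<le> 4 * P\<^sup>2 * ((\<alpha> * \<beta> * \<gamma>) * vgcd ?u) / vmax ?u"
  proof (rule frac_le)
    show "real_of_int (4 * P\<^sup>2 * g) \<le> real_of_int (4 * P\<^sup>2 * ((\<alpha> * \<beta> * \<gamma>) * vgcd ?u))"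
      unfolding of_int_le_iff by (rule mult_left_mono[OF gle]) simp
    show "0 \<le> real_of_int (4 * P\<^sup>2 * ((\<alpha> * \<beta> * \<gamma>) * vgcd ?u))"
      unfolding of_int_0_le_iff using pos G0 by (intro mult_nonneg_nonneg) auto
  qed (use M0 D in auto)
  \<comment> \<open>The boundary term is absorbed: \<open>u\<close> lies in
    \<open>vbox (2 * P)\<close> and has gcd at least 1, so \<open>wt u\<close> is at least 1 / (2
    P).\<close>
  also have "5 * P \<le> 10 * P\<^sup>2 * wt ?u"
  proof -
    have "real_of_int (vmax ?u) \<le> 2 * P * vgcd ?u"
    proof -
      have "vmax ?u \<le> 2 * P * 1" using M2 by simp
      also have "\<dots> \<le> 2 * P * vgcd ?u" using P G0 by (intro mult_left_mono) auto
      finally show ?thesis by (metis of_int_le_iff of_int_mult of_int_numeral)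
    qed
    then have "1 \<le> 2 * P * vgcd ?u / vmax ?u" using M0 by simp
    then have "5 * real_of_int P * 1 \<le> 5 * real_of_int P * (2 * P * vgcd ?u / vmax ?u)"
      using P by (intro mult_left_mono) auto
    then show ?thesis by (simp add: wt_def power2_eq_square)
  qed
  finally show ?thesis by (simp add: wt_def algebra_simps add_divide_distrib)
qed

section \<open>Sums of the weight over boxes\<close>

lemma le_div_if_mult_le:
  fixes h t m :: int
  assumes "h > 0" "h * t \<le> m"
  shows "t \<le> m div h"
  using zdiv_mono1[OF assms(2,1)] assms(1) by simp

text \<open>Peel off square shells: the shell of radius n + 1 has 8 (n + 1) points, each of weight 1
  / (n + 1), so it adds exactly 8. The maximum with 1 gives the origin weight 1.\<close>

lemma sum_inverse_max_le:
  "(\<Sum>(x, y)\<in>{-int n..int n} \<times> {-int n..int n}. 1 / real_of_int (max 1 (max \<bar>x\<bar> \<bar>y\<bar>))) \<le> 8 * real n + 1"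
proof (induction n)
  case (Suc n)
  define Q where "Q k = {-int k..int k} \<times> {-int k..int k}" for k
  define D where "D = Q (Suc n) - Q n"
  have fin: "finite (Q k)" for k by (simp add: Q_def)
  have sub: "Q n \<subseteq> Q (Suc n)" by (auto simp: Q_def)
  have "card D = card (Q (Suc n)) - card (Q n)"
    unfolding D_def using sub fin by (simp add: card_Diff_subset)
  also have "\<dots> = (2 * n + 3)\<^sup>2 - (2 * n + 1)\<^sup>2"
    by (simp add: Q_def power2_eq_square nat_add_distrib nat_mult_distrib numeral_eq_Suc)
  also have "\<dots> = 8 * (n + 1)" by (simp add: power2_eq_square algebra_simps)
  finally have cD: "real (card D) = 8 * (real n + 1)" by simp
  have val: "1 / real_of_int (max 1 (max \<bar>x\<bar> \<bar>y\<bar>)) = 1 / (real n + 1)" if "(x, y) \<in> D" for x y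
  proof -
    have "max 1 (max \<bar>x\<bar> \<bar>y\<bar>) = int n + 1" using that by (auto simp: D_def Q_def max_def)
    then show ?thesis by simp
  qed
  have "(\<Sum>(x, y)\<in>D. 1 / real_of_int (max 1 (max \<bar>x\<bar> \<bar>y\<bar>))) = (\<Sum>(x, y)\<in>D. 1 / (real n + 1))"
    by (rule sum.cong) (use val in auto)
  also have "\<dots> = 8" using cD by (simp add: case_prod_unfold field_simps)
  finally have D8: "(\<Sum>(x, y)\<in>D. 1 / real_of_int (max 1 (max \<bar>x\<bar> \<bar>y\<bar>))) = 8" .
  have "(\<Sum>(x, y)\<in>Q (Suc n). 1 / real_of_int (max 1 (max \<bar>x\<bar> \<bar>y\<bar>)))
     = (\<Sum>(x, y)\<in>D. 1 / real_of_int (max 1 (max \<bar>x\<bar> \<bar>y\<bar>))) + (\<Sum>(x, y)\<in>Q n. 1 / real_of_int (max 1 (max \<bar>x\<bar> \<bar>y\<bar>)))"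
    unfolding D_def by (rule sum.subset_diff[OF sub fin])
  then show ?case using D8 Suc.IH unfolding Q_def by simp
qed simp

text \<open>Telescoping at half-integers: 1 / g^2 is at most 1 / (g - 1/2) - 1 / (g + 1/2).\<close>

lemma sum_inverse_squares_tail_le:
  fixes K n :: int
  assumes "K \<ge> 0"
  shows "(\<Sum>g\<in>{K+1..n}. 1 / (real_of_int g)\<^sup>2) \<le> 2 / (K + 1)"
proof (cases "n \<ge> K")
  case True
  then have "(\<Sum>g\<in>{K+1..n}. 1 / (real_of_int g)\<^sup>2) \<le> 1 / (K + 1/2) - 1 / (n + 1/2)"
  proof (induction n rule: int_ge_induct)
    case (step n)
    have eq: "{K+1..n+1} = insert (n+1) {K+1..n}" using step by auto
    define x where "x = real_of_int n"
    have x: "x \<ge> 0" using step assms by (simp add: x_def)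
    have "1 / (x + 1)\<^sup>2 \<le> 1 / (x + 1/2) - 1 / (x + 1 + 1/2)"
    proof -
      have "1 / (x + 1)\<^sup>2 \<le> 1 / ((x + 1/2) * (x + 1 + 1/2))"
        using x by (intro divide_left_mono mult_pos_pos zero_less_power) (auto simp: power2_eq_square field_simps)
      also have "\<dots> = 1 / (x + 1/2) - 1 / (x + 1 + 1/2)"
        using x by (simp add: divide_simps)
      finally show ?thesis .
    qed
    then show ?case using step by (simp add: eq x_def)
  qed simp
  also have "\<dots> \<le> 1 / (K + 1/2)" using True assms by simp
  also have "\<dots> \<le> 2 / (K + 1)" using assms by (simp add: field_simps)
  finally show ?thesis .
qed (use assms in simp)

text \<open>The true order is logarithmic. A square root suffices, because the harmonic sum enters
  only the second term of \<open>sum_wt_le\<close>, of order P^(3/2) against P^2.\<close>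

lemma sum_inverse_le_sqrt:
  fixes n :: int
  assumes "n \<ge> 0"
  shows "(\<Sum>g\<in>{1..n}. 1 / real_of_int g) \<le> 2 * sqrt n"
  using assms
proof (induction n rule: int_ge_induct)
  case (step n)
  have eq: "{1..n+1} = insert (n+1) {1..n}" using step by auto
  define x where "x = real_of_int n"
  have x: "x \<ge> 0" using step by (simp add: x_def)
  have s: "sqrt x \<le> sqrt (x + 1)" "0 \<le> sqrt x" "0 < sqrt (x+1)" "sqrt (x+1) * sqrt (x+1) = x + 1" "sqrt x * sqrt x = x"
    using x by auto
  have "1 = (sqrt (x+1) - sqrt x) * (sqrt (x+1) + sqrt x)" using s by (simp add: algebra_simps)
  also have "\<dots> \<le> (sqrt (x+1) - sqrt x) * (2 * sqrt (x+1))" using s by (intro mult_left_mono) auto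
  also have "\<dots> \<le> (sqrt (x+1) - sqrt x) * (2 * (x+1))"
    using s x by (intro mult_left_mono) (auto intro!: real_le_lsqrt simp: power2_eq_square algebra_simps)
  finally have "1 / (x + 1) \<le> 2 * sqrt (x + 1) - 2 * sqrt x" using x by (simp add: field_simps)
  then show ?case using step by (simp add: eq x_def)
qed simp

definition vdiv :: "int \<times> int \<times> int \<Rightarrow> int \<Rightarrow> int \<times> int \<times> int" where
  "vdiv = (\<lambda>(x, y, z) g. (x div g, y div g, z div g))"

text \<open>Sort \<open>u\<close> by g = \<open>vgcd u\<close> and write u = g v, so that
  \<open>wt u\<close> is 1 / \<open>vmax v\<close> for a \<open>v\<close> in the box of radius 2 P /
  g. There are at most 2 \<kappa> P / g + 1 third coordinates, and the sum over the first two is O(P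
  / g); this leaves \<kappa> P^2 / g^2 + P / g, up to constants, to be summed over g > K. One
  statement thus serves both for \<open>u\<close> with small third coordinate and for
  \<open>u\<close> with large gcd.\<close>

lemma sum_wt_le:
  fixes P K :: int and \<kappa> :: real
  assumes P: "P \<ge> 1" and K: "K \<ge> 0" and k: "\<kappa> \<ge> 0" and U: "U \<subseteq> vbox (2 * P)"
    and g: "\<And>u1 u2 u3. (u1, u2, u3) \<in> U \<Longrightarrow> (u1, u2, u3) \<noteq> (0, 0, 0) \<Longrightarrow> vgcd (u1, u2, u3) > K \<and> \<bar>u3\<bar> \<le> \<kappa> * P"
  shows "(\<Sum>u\<in>U. wt u) \<le> 72 * \<kappa> * P\<^sup>2 / (K + 1) + 36 * P * sqrt (2 * P)"
proof -
  define V where "V g = {v \<in> vbox (2 * P div g). v \<noteq> (0, 0, 0) \<and> g * \<bar>snd (snd v)\<bar> \<le> \<kappa> * P}" for g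
  define J where "J = {K+1..2*P}"
  define \<phi> where "\<phi> u = (vgcd u, vdiv u (vgcd u))" for u
  have finU: "finite U" by (rule finite_subset[OF U]) simp
  have finV: "finite (V g)" for g unfolding V_def by (rule finite_subset[OF _ finite_vbox]) auto
  have dv: "vgcd (x, y, z) dvd x \<and> vgcd (x, y, z) dvd y \<and> vgcd (x, y, z) dvd z" for x y z
    unfolding vgcd_def by (simp; blast intro: gcd_dvd1 gcd_dvd2 dvd_trans[OF gcd_dvd2])
  have inj: "inj_on \<phi> (U - {(0,0,0)})"
  proof (rule inj_onI)
    fix v w assume e: "\<phi> v = \<phi> w"
    obtain x y z x' y' z' where vw: "v = (x, y, z)" "w = (x', y', z')" by (cases v, cases w)
    define g where "g = vgcd (x, y, z)"
    have E: "vgcd (x', y', z') = g" "x div g = x' div g" "y div g = y' div g" "z div g = z' div g"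
      using e unfolding vw \<phi>_def vdiv_def prod.case prod.inject g_def by (elim conjE; metis)+
    have "g dvd x" "g dvd y" "g dvd z" using dv[of x y z] by (simp_all add: g_def)
    moreover have "g dvd x'" "g dvd y'" "g dvd z'" using dv[of x' y' z'] by (simp_all add: E(1))
    ultimately have "x = x'" "y = y'" "z = z'" using E(2-4) by (simp_all only: dvd_div_eq_cancel)
    then show "v = w" unfolding vw by simp
  qed
  have img: "\<phi> u \<in> Sigma J V \<and> wt u = 1 / vmax (snd (\<phi> u))" if u: "u \<in> U - {(0,0,0)}" for u
  proof -
    obtain x y z where uu: "u = (x, y, z)" by (cases u)
    define h where "h = vgcd u"
    obtain x' y' z' where x': "x = h * x'" "y = h * y'" "z = h * z'"
      using dv[of x y z] unfolding h_def uu by (meson dvdE)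
    have h0: "h > 0" using u vgcd_pos by (auto simp: h_def)
    have hM: "h \<le> vmax u" using u vgcd_le_vmax by (auto simp: h_def)
    have M2: "vmax u \<le> 2 * P" using u U mem_vbox_iff_vmax by blast
    have "vdiv (x, y, z) h = (x', y', z')" using h0 by (simp add: vdiv_def x')
    then have ph: "\<phi> u = (h, (x', y', z'))" by (simp add: \<phi>_def h_def uu)
    have vm: "vmax u = h * vmax (x', y', z')"
      using h0 by (simp add: uu vmax_def x' abs_mult max_mult_distrib_left)
    have nz: "(x', y', z') \<noteq> (0,0,0)" using u uu x' by auto
    have "vmax (x', y', z') \<le> 2 * P div h"
      using M2 vm h0 by (intro le_div_if_mult_le) auto
    then have "(x', y', z') \<in> vbox (2 * P div h)" using mem_vbox_iff_vmax by blast
    moreover have "h > K" "\<bar>z\<bar> \<le> \<kappa> * P" using g u uu by (auto simp: h_def)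
    ultimately have "\<phi> u \<in> Sigma J V"
      using nz hM M2 h0 by (auto simp: ph J_def V_def x' abs_mult)
    moreover have "wt u = 1 / vmax (snd (\<phi> u))"
      using h0 by (simp add: ph wt_def vm h_def[symmetric])
    ultimately show ?thesis by blast
  qed
  have "(\<Sum>u\<in>U. wt u) = (\<Sum>u\<in>U - {(0,0,0)}. wt u)"
    by (rule sum.mono_neutral_right[OF finU]) (auto simp: wt_def vgcd_def)
  also have "\<dots> = (\<Sum>u\<in>U - {(0,0,0)}. 1 / vmax (snd (\<phi> u)))"
    by (rule sum.cong) (use img in auto)
  also have "\<dots> = (\<Sum>w\<in>\<phi> ` (U - {(0,0,0)}). 1 / vmax (snd w))"
    by (simp add: sum.reindex[OF inj])
  also have "\<dots> \<le> (\<Sum>w\<in>Sigma J V. 1 / vmax (snd w))"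
  proof (rule sum_mono2)
    show "finite (Sigma J V)" using finV by (auto simp: J_def)
    show "\<phi> ` (U - {(0,0,0)}) \<subseteq> Sigma J V" using img by blast
    show "0 \<le> 1 / real_of_int (vmax (snd w))" for w by (auto simp: vmax_def split: prod.split)
  qed
  also have "\<dots> = (\<Sum>g\<in>J. \<Sum>v\<in>V g. 1 / vmax v)"
    using finV by (subst sum.Sigma) (auto simp: J_def case_prod_unfold)
  also have "\<dots> \<le> (\<Sum>g\<in>J. 36 * \<kappa> * P\<^sup>2 * (1 / (real_of_int g)\<^sup>2) + 18 * P * (1 / real_of_int g))"
  proof (rule sum_mono)
    fix g assume "g \<in> J"
    then have g0: "g > 0" and g2: "g \<le> 2 * P" using K by (auto simp: J_def)
    define R where "R = 2 * P div g"
    have R1: "R \<ge> 1" using g0 g2 unfolding R_def by (intro le_div_if_mult_le) auto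
    define Z where "Z = {z :: int. g * \<bar>z\<bar> \<le> \<kappa> * P}"
    define m where "m = \<lfloor>\<kappa> * P / g\<rfloor>"
    have m0: "m \<ge> 0" using k P g0 by (simp add: m_def)
    have Zm: "Z = {-m..m}"
    proof -
      have "real_of_int (g * \<bar>z\<bar>) \<le> \<kappa> * P \<longleftrightarrow> \<bar>z\<bar> \<le> m" for z
        using g0 by (simp add: m_def le_floor_iff field_simps)
      then have "Z = {z. \<bar>z\<bar> \<le> m}" unfolding Z_def by (simp only:)
      also have "\<dots> = {-m..m}" by auto
      finally show ?thesis .
    qed
    have cZ: "real (card Z) \<le> 2 * (\<kappa> * P / g) + 1"
    proof -
      have "real (card Z) = 2 * real_of_int m + 1" using m0 by (simp add: Zm)
      moreover have "real_of_int m \<le> \<kappa> * P / g" unfolding m_def by (rule of_int_floor_le)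
      ultimately show ?thesis by linarith
    qed
    let ?Q = "{-R..R} \<times> {-R..R}"
    \<comment> \<open>Dropping the third coordinate from the maximum separates the variables; the 1
      covers a \<open>v\<close> whose first two coordinates vanish.\<close>
    have "(\<Sum>v\<in>V g. 1 / real_of_int (vmax v)) \<le> (\<Sum>v\<in>V g. 1 / real_of_int (max 1 (max \<bar>fst v\<bar> \<bar>fst (snd v)\<bar>)))"
    proof (rule sum_mono)
      fix v assume v: "v \<in> V g"
      then have "vmax v > 0" using vmax_pos by (auto simp: V_def)
      then have "max 1 (max \<bar>fst v\<bar> \<bar>fst (snd v)\<bar>) \<le> vmax v"
        by (cases v) (simp add: vmax_def; linarith)
      then show "1 / real_of_int (vmax v) \<le> 1 / real_of_int (max 1 (max \<bar>fst v\<bar> \<bar>fst (snd v)\<bar>))"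
        by (intro divide_left_mono) auto
    qed
    also have "\<dots> = (\<Sum>w\<in>(\<lambda>(x, y, z). (z, (x, y))) ` V g. 1 / real_of_int (max 1 (max \<bar>fst (snd w)\<bar> \<bar>snd (snd w)\<bar>)))"
      by (subst sum.reindex) (auto simp: inj_on_def case_prod_unfold)
    also have "\<dots> \<le> (\<Sum>w\<in>Z \<times> ?Q. 1 / real_of_int (max 1 (max \<bar>fst (snd w)\<bar> \<bar>snd (snd w)\<bar>)))"
    proof (rule sum_mono2)
      show "finite (Z \<times> ?Q)" by (simp add: Zm)
      show "(\<lambda>(x, y, z). (z, (x, y))) ` V g \<subseteq> Z \<times> ?Q"
        by (auto simp: V_def Z_def R_def)
    qed simp
    also have "\<dots> = (\<Sum>z\<in>Z. \<Sum>(x, y)\<in>?Q. 1 / real_of_int (max 1 (max \<bar>x\<bar> \<bar>y\<bar>)))"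
      by (subst sum.cartesian_product) (simp add: case_prod_unfold)
    also have "\<dots> \<le> real (card Z) * (8 * R + 1)"
      using sum_inverse_max_le[of "nat R"] R1 by (simp add: mult_left_mono)
    also have "\<dots> \<le> (2 * (\<kappa> * P / g) + 1) * (18 * P / g)"
    proof (intro mult_mono cZ)
      have "real_of_int R \<le> 2 * P / g" using real_of_int_div4[of "2*P" g] by (simp add: R_def)
      then have "9 * real_of_int R \<le> 9 * (2 * P / g)" by (intro mult_left_mono) auto
      moreover have "8 * real_of_int R + 1 \<le> 9 * R" using R1 by simp
      ultimately show "real_of_int (8 * R + 1) \<le> 18 * P / g" by simp
    qed (use R1 k P g0 in auto)
    also have "\<dots> = 36 * \<kappa> * P\<^sup>2 * (1 / (real_of_int g)\<^sup>2) + 18 * P * (1 / real_of_int g)"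
      by (simp add: algebra_simps power2_eq_square)
    finally show "(\<Sum>v\<in>V g. 1 / real_of_int (vmax v)) \<le> 36 * \<kappa> * P\<^sup>2 * (1 / (real_of_int g)\<^sup>2) + 18 * P * (1 / real_of_int g)" .
  qed
  also have "\<dots> = 36 * \<kappa> * P\<^sup>2 * (\<Sum>g\<in>J. 1 / (real_of_int g)\<^sup>2) + 18 * P * (\<Sum>g\<in>J. 1 / real_of_int g)"
    by (simp only: sum.distrib sum_distrib_left)
  also have "\<dots> \<le> 36 * \<kappa> * P\<^sup>2 * (2 / (K + 1)) + 18 * P * (2 * sqrt (2 * P))"
  proof (intro add_mono mult_left_mono)
    show "(\<Sum>g\<in>J. 1 / (real_of_int g)\<^sup>2) \<le> 2 / real_of_int (K + 1)"
      unfolding J_def using sum_inverse_squares_tail_le[OF K, of "2*P"] by simp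
    have "(\<Sum>g\<in>J. 1 / real_of_int g) \<le> (\<Sum>g\<in>{1..2*P}. 1 / real_of_int g)"
      by (rule sum_mono2) (use K in \<open>auto simp: J_def\<close>)
    also have "\<dots> \<le> 2 * sqrt (2 * P)" using sum_inverse_le_sqrt[of "2*P"] P by simp
    finally show "(\<Sum>g\<in>J. 1 / real_of_int g) \<le> 2 * sqrt (2 * P)" by simp
  qed (use P k in auto)
  finally show ?thesis by simp
qed

text \<open>A pair of gcd g is g times a pair in the box of radius R = 2 P div g, and 2 R + 1 \<le>
  6 P / g, so there are at most 36 P^2 / g^2 of them. Summing over g > D gives 72 P^2 / (D + 1), and
  the free coordinate takes at most 5 P values.\<close>

lemma card_large_gcd_le:
  fixes P D :: int
  assumes P: "P \<ge> 1" and D: "D \<ge> 0"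
  shows "real (card {(x, y, z) \<in> vbox (2 * P). (y, z) \<noteq> (0, 0) \<and> gcd y z > D}) \<le> 360 * P ^ 3 / (D + 1)"
proof -
  let ?T = "{(y, z). y \<in> {-2*P..2*P} \<and> z \<in> {-2*P..2*P} \<and> (y, z) \<noteq> (0, 0) \<and> gcd y z > D}"
  let ?Q = "\<lambda>g. {-(2*P div g)..2*P div g} \<times> {-(2*P div g)..2*P div g}"
  have finT: "finite ?T" by (rule finite_subset[of _ "{-2*P..2*P} \<times> {-2*P..2*P}"]) auto
  have "card {(x, y, z) \<in> vbox (2 * P). (y, z) \<noteq> (0, 0) \<and> gcd y z > D} \<le> card ({-2*P..2*P} \<times> ?T)"
    by (rule card_mono) (use finT in auto)
  also have "\<dots> = nat (4 * P + 1) * card ?T" by (simp add: card_cartesian_product)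
  finally have "real (card {(x, y, z) \<in> vbox (2 * P). (y, z) \<noteq> (0, 0) \<and> gcd y z > D})
      \<le> real (nat (4 * P + 1) * card ?T)"
    by (simp only: of_nat_le_iff)
  moreover have "real (nat (4 * P + 1)) = 4 * P + 1" using P by simp
  ultimately have 1: "real (card {(x, y, z) \<in> vbox (2 * P). (y, z) \<noteq> (0, 0) \<and> gcd y z > D}) \<le> (4 * P + 1) * real (card ?T)"
    by (simp only: of_nat_mult)
  have "inj_on (\<lambda>(y, z). (gcd y z, y div gcd y z, z div gcd y z)) ?T"
  proof (rule inj_onI)
    fix v w :: "int \<times> int" assume e: "(\<lambda>(y, z). (gcd y z, y div gcd y z, z div gcd y z)) v = (\<lambda>(y, z). (gcd y z, y div gcd y z, z div gcd y z)) w"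
    obtain y z y' z' where vw: "v = (y, z)" "w = (y', z')" by (cases v, cases w)
    define g where "g = gcd y z"
    have E: "gcd y' z' = g" "y div g = y' div g" "z div g = z' div g"
      using e unfolding vw prod.case prod.inject g_def by (elim conjE; metis)+
    have "g dvd y" "g dvd z" by (simp_all add: g_def)
    moreover have "g dvd y'" "g dvd z'" unfolding E(1)[symmetric] by simp_all
    ultimately have "y = y'" "z = z'" using E(2,3) by (simp_all only: dvd_div_eq_cancel)
    then show "v = w" unfolding vw by simp
  qed
  moreover have "(\<lambda>(y, z). (gcd y z, y div gcd y z, z div gcd y z)) ` ?T \<subseteq> Sigma {D+1..2*P} ?Q"
  proof (rule image_subsetI)
    fix v assume "v \<in> ?T"
    then obtain y z where v: "v = (y, z)" and
      yz: "y \<in> {-2*P..2*P}" "z \<in> {-2*P..2*P}" "(y, z) \<noteq> (0, 0)" "D < gcd y z" by blast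
    define g where "g = gcd y z"
    have g0: "g > 0" using yz(3) by (auto simp: g_def)
    have "g \<le> 2 * P"
    proof (cases "y = 0")
      case False
      then have "g \<le> \<bar>y\<bar>" using gcd_le1_int[of "\<bar>y\<bar>" "\<bar>z\<bar>"] by (auto simp: g_def)
      then show ?thesis using yz by auto
    next
      case True
      then show ?thesis using yz by (auto simp: g_def)
    qed
    moreover have "t div g \<in> {-(2*P div g)..2*P div g}" if "g dvd t" "t \<in> {-2*P..2*P}" for t
    proof -
      obtain s where s: "t = g * s" using \<open>g dvd t\<close> by blast
      have "g * \<bar>s\<bar> \<le> 2 * P" using that(2) g0 by (auto simp: s abs_if)
      then have "\<bar>s\<bar> \<le> 2 * P div g" using g0 by (intro le_div_if_mult_le) auto
      then show ?thesis using g0 by (auto simp: s)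
    qed
    ultimately show "(\<lambda>(y, z). (gcd y z, y div gcd y z, z div gcd y z)) v \<in> Sigma {D+1..2*P} ?Q"
      using yz by (auto simp: g_def v)
  qed
  moreover have "finite (Sigma {D+1..2*P} ?Q)" by auto
  ultimately have "card ?T \<le> card (Sigma {D+1..2*P} ?Q)" by (rule card_inj_on_le)
  also have "\<dots> = (\<Sum>g\<in>{D+1..2*P}. card (?Q g))" by simp
  finally have "real (card ?T) \<le> (\<Sum>g\<in>{D+1..2*P}. real (card (?Q g)))" by (simp only: of_nat_sum[symmetric] of_nat_le_iff)
  also have "\<dots> \<le> (\<Sum>g\<in>{D+1..2*P}. 36 * P\<^sup>2 * (1 / (real_of_int g)\<^sup>2))"
  proof (rule sum_mono)
    fix g assume "g \<in> {D+1..2*P}"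
    then have g0: "g > 0" "g \<le> 2 * P" using D by auto
    define R where "R = 2 * P div g"
    have R1: "R \<ge> 1" using g0 unfolding R_def by (intro le_div_if_mult_le) auto
    have "real_of_int R \<le> 2 * P / g" using real_of_int_div4[of "2*P" g] by (simp add: R_def)
    then have "2 * R + 1 \<le> 6 * P / g" using R1 by simp
    moreover have "real (card (?Q g)) = (2 * R + 1)\<^sup>2"
      using R1 by (simp add: R_def[symmetric] card_cartesian_product power2_eq_square)
    ultimately have "real (card (?Q g)) \<le> (6 * P / g)\<^sup>2" using R1 by (simp add: power_mono)
    then show "real (card (?Q g)) \<le> 36 * P\<^sup>2 * (1 / (real_of_int g)\<^sup>2)" by (simp add: power_divide power_mult_distrib)
  qed
  also have "\<dots> = 36 * P\<^sup>2 * (\<Sum>g\<in>{D+1..2*P}. 1 / (real_of_int g)\<^sup>2)" by (simp only: sum_distrib_left)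
  also have "\<dots> \<le> 36 * P\<^sup>2 * (2 / (D + 1))"
    using sum_inverse_squares_tail_le[OF D, of "2*P"] by (intro mult_left_mono) auto
  finally have 2: "real (card ?T) \<le> 72 * P\<^sup>2 / (D + 1)" by simp
  have "(4 * P + 1) * real (card ?T) \<le> (5 * P) * (72 * P\<^sup>2 / (D + 1))"
    using 2 P D by (intro mult_mono) auto
  then show ?thesis using 1 by (simp add: power3_eq_cube power2_eq_square mult_ac)
qed

text \<open>A relation with s1 nonzero determines u1 from u2 and u3, so each element of
  \<open>S\<close> accounts for at most (4 P + 1)^2 vectors.\<close>

lemma card_relation_le:
  fixes \<alpha> \<beta> \<gamma> P :: int
  assumes a: "\<alpha> > 0" and P: "P \<ge> 1" and S: "finite S" "\<And>s1 s2 s3. (s1, s2, s3) \<in> S \<Longrightarrow> s1 \<noteq> 0"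
  shows "real (card {(u1, u2, u3) \<in> vbox (2 * P). \<exists>(s1, s2, s3) \<in> S. \<alpha> * u1 * s1 + \<beta> * u2 * s2 + \<gamma> * u3 * s3 = 0})
    \<le> 25 * card S * P\<^sup>2"
proof -
  let ?T = "{(u1, u2, u3) \<in> vbox (2 * P). \<exists>(s1, s2, s3) \<in> S. \<alpha> * u1 * s1 + \<beta> * u2 * s2 + \<gamma> * u3 * s3 = 0}"
  let ?V = "\<lambda>(s1, s2, s3). {(u1, u2, u3) \<in> vbox (2 * P). \<alpha> * u1 * s1 + \<beta> * u2 * s2 + \<gamma> * u3 * s3 = 0}"
  have cV: "card (?V s) \<le> nat (4 * P + 1) * nat (4 * P + 1)" if "s \<in> S" for s
  proof -
    obtain s1 s2 s3 where s: "s = (s1, s2, s3)" by (cases s)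
    have s1: "s1 \<noteq> 0" using S(2) that s by blast
    have "card (?V s) \<le> card ({-2*P..2*P} \<times> {-2*P..2*P})"
    proof (rule card_inj_on_le[of "\<lambda>(x, y, z). (y, z)"])
      show "inj_on (\<lambda>(x, y, z). (y, z)) (?V s)"
        using a s1 by (auto simp: inj_on_def s) (metis add_right_cancel mult_cancel_left mult_cancel_right less_irrefl)
      show "(\<lambda>(x, y, z). (y, z)) ` ?V s \<subseteq> {-2*P..2*P} \<times> {-2*P..2*P}" by (auto simp: s)
    qed simp
    then show ?thesis by (simp add: card_cartesian_product)
  qed
  have "?T = (\<Union>s\<in>S. ?V s)" by auto
  then have "card ?T \<le> (\<Sum>s\<in>S. card (?V s))" using card_UN_le[OF S(1), of ?V] by presburger
  also have "\<dots> \<le> (\<Sum>s\<in>S. nat (4 * P + 1) * nat (4 * P + 1))" by (rule sum_mono) (rule cV)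
  finally have "card ?T \<le> card S * (nat (4 * P + 1) * nat (4 * P + 1))" by simp
  then have "real (card ?T) \<le> real (card S * (nat (4 * P + 1) * nat (4 * P + 1)))" by (simp only: of_nat_le_iff)
  also have "\<dots> = real (card S) * ((4 * real_of_int P + 1) * (4 * real_of_int P + 1))" using P by simp
  also have "\<dots> \<le> real (card S) * ((5 * real_of_int P) * (5 * real_of_int P))"
    using P by (intro mult_left_mono mult_mono) auto
  finally show ?thesis by (simp add: power2_eq_square mult_ac)
qed

section \<open>Short solutions of linear equations\<close>

text \<open>Steps of length \<bar>\<delta>\<bar> cannot jump over a target on a circle of length m:
  within one turn, at most m / \<bar>\<delta>\<bar> steps, the walk from r0 comes within one step of
  0. The sign of \<delta> decides which way round it goes, hence the two cases.\<close>

lemma walk_mod: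
  fixes m \<delta> r0 :: int
  assumes m: "m > 0" and d: "\<delta> \<noteq> 0"
  obtains i t where "0 \<le> i" "i * \<bar>\<delta>\<bar> \<le> m" "\<bar>t\<bar> \<le> \<bar>\<delta>\<bar>" "m dvd r0 + \<delta> * i - t"
proof (cases "\<delta> > 0")
  case True
  define \<rho> where "\<rho> = (- r0) mod m"
  have r: "0 \<le> \<rho>" "\<rho> < m" using m by (simp_all add: \<rho>_def)
  have "m dvd - r0 - \<rho>" by (simp add: \<rho>_def minus_mod_eq_mult_div)
  then have "m dvd r0 + \<rho>" by (metis dvd_minus_iff minus_diff_eq diff_minus_eq_add add.commute)
  moreover have "r0 + \<rho> = r0 + \<delta> * (\<rho> div \<delta>) - (- (\<rho> mod \<delta>))" by simp
  ultimately have dv: "m dvd r0 + \<delta> * (\<rho> div \<delta>) - (- (\<rho> mod \<delta>))" by simp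
  have 1: "0 \<le> \<rho> div \<delta>" using r True by (simp add: pos_imp_zdiv_nonneg_iff)
  have "\<rho> div \<delta> * \<delta> \<le> \<rho>" using True by (metis pos_mod_sign minus_div_mult_eq_mod diff_ge_0_iff_ge)
  then have 2: "\<rho> div \<delta> * \<bar>\<delta>\<bar> \<le> m" using r True by simp
  have 3: "\<bar>- (\<rho> mod \<delta>)\<bar> \<le> \<bar>\<delta>\<bar>" using pos_mod_bound[OF True, of \<rho>] pos_mod_sign[OF True, of \<rho>] True by linarith
  show ?thesis by (rule that[OF 1 2 3 dv])
next
  case False
  define e where "e = - \<delta>"
  have e: "e > 0" "\<delta> = - e" using False d by (auto simp: e_def)
  define \<rho> where "\<rho> = r0 mod m"
  have r: "0 \<le> \<rho>" "\<rho> < m" using m by (simp_all add: \<rho>_def)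
  have "m dvd r0 - \<rho>" by (simp add: \<rho>_def minus_mod_eq_mult_div)
  moreover have "r0 + \<delta> * (\<rho> div e) - \<rho> mod e = r0 - \<rho>"
  proof -
    have "\<rho> = e * (\<rho> div e) + \<rho> mod e" by simp
    moreover have "\<delta> * (\<rho> div e) = - (e * (\<rho> div e))" by (simp add: e)
    ultimately show ?thesis by linarith
  qed
  ultimately have dv: "m dvd r0 + \<delta> * (\<rho> div e) - \<rho> mod e" by (simp only:)
  have 1: "0 \<le> \<rho> div e" using r e by (simp add: pos_imp_zdiv_nonneg_iff)
  have "\<rho> div e * e \<le> \<rho>" using e by (metis pos_mod_sign minus_div_mult_eq_mod diff_ge_0_iff_ge)
  then have 2: "\<rho> div e * \<bar>\<delta>\<bar> \<le> m" using r e by simp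
  have 3: "\<bar>\<rho> mod e\<bar> \<le> \<bar>\<delta>\<bar>" using e(2) pos_mod_bound[OF e(1), of \<rho>] pos_mod_sign[OF e(1), of \<rho>] e(1) by linarith
  show ?thesis by (rule that[OF 1 2 3 dv])
qed

text \<open>Dirichlet's theorem gives a step \<open>r \<le> R\<close> that moves the residue of the second coordinate by a
  small \<open>\<delta>\<close>. If \<open>\<bar>\<delta>\<bar> \<ge> c\<close>, then walking in multiples of \<open>r\<close> reaches every residue class up to a
  short vector; otherwise \<open>r\<close> and \<open>\<delta>\<close> are the entries of a short relation.\<close>

lemma short_solution_or_relation:
  fixes A1 A2 A3 h c R :: int
  assumes A3: "A3 \<noteq> 0" and d: "d = gcd A2 A3" and dh: "d dvd h" and R: "R \<ge> 1" and c: "c \<ge> 1"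
  shows "(\<exists>t1 t2 t3. A1 * t1 + A2 * t2 + A3 * t3 = h \<and> c * \<bar>t1\<bar> \<le> d * R * \<bar>A3\<bar> \<and> R * \<bar>t2\<bar> \<le> \<bar>A3\<bar>)
    \<or> (\<exists>s1 s2 s3. A1 * s1 + A2 * s2 + A3 * s3 = 0 \<and> 0 < s1 \<and> s1 \<le> d * R \<and> \<bar>s2\<bar> \<le> c)"
proof -
  have d0: "d > 0" using A3 d by simp
  obtain b m' where b: "A2 = d * b" and m': "A3 = d * m'" using d by (meson dvdE gcd_dvd1 gcd_dvd2)
  have "coprime b m'"
  proof -
    have "d * gcd b m' = d * 1" using d d0 b m' by (metis gcd_mult_distrib_int abs_of_pos mult.right_neutral)
    then show ?thesis using d0 by (simp add: coprime_iff_gcd_eq_1)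
  qed
  then obtain B J where BJ: "B * b + J * m' = 1" by (metis bezout_int coprime_imp_gcd_eq_1)
  obtain h' where h': "h = d * h'" using dh by blast
  define m where "m = \<bar>m'\<bar>"
  have m0: "m > 0" using A3 m' by (auto simp: m_def)
  have mA: "m \<le> \<bar>A3\<bar>" using d0 by (simp add: m_def m' abs_mult mult_le_cancel_right1)
  \<comment> \<open>With t1 = d s the equation becomes A1 s + b t2 + m' t3 = h'. As \<open>B\<close>
    inverts \<open>b\<close> modulo m', this forces t2 to be B h' + \<gamma> s modulo m'; so
    \<gamma> is the move of the second coordinate per unit of s.\<close>
  define \<gamma> where "\<gamma> = - B * A1"
  have "nat R > 0" using R by simp
  then obtain j r where r: "0 < r" "r \<le> int (nat R)" "\<bar>of_int r * (\<gamma> / m) - of_int j\<bar> < 1 / real (nat R)"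
    by (rule Dirichlet_approx)
  define \<delta> where "\<delta> = r * \<gamma> - j * m"
  have "real_of_int \<bar>\<delta>\<bar> = m * \<bar>of_int r * (\<gamma> / m) - of_int j\<bar>"
  proof -
    have "real_of_int \<delta> = m * (of_int r * (\<gamma> / m) - of_int j)" using m0 by (simp add: \<delta>_def field_simps)
    then show ?thesis using m0 by (simp add: abs_mult)
  qed
  also have "\<dots> \<le> m * (1 / real (nat R))" using r m0 by (intro mult_left_mono) auto
  finally have "R * real_of_int \<bar>\<delta>\<bar> \<le> m" using R by (simp add: field_simps)
  then have Rd: "R * \<bar>\<delta>\<bar> \<le> m" by (metis of_int_le_iff of_int_mult)
  have rR: "r \<le> R" using r R by simp
  show ?thesis
  proof (cases "\<bar>\<delta>\<bar> \<ge> c")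
    case True
    then have "\<delta> \<noteq> 0" using c by auto
    \<comment> \<open>Walk with s = r i, each step moving the residue by \<delta>. At most m /
      \<bar>\<delta>\<bar> \<le> m / c steps are taken, which keeps t1 = d r i small, and t2 is no
      larger than one step.\<close>
    then obtain i t where it: "0 \<le> i" "i * \<bar>\<delta>\<bar> \<le> m" "\<bar>t\<bar> \<le> \<bar>\<delta>\<bar>" "m dvd B * h' + \<delta> * i - t"
      using walk_mod[OF m0] by blast
    have "m' dvd B * h' + \<delta> * i - t" using it(4) by (simp add: m_def)
    moreover have "m' dvd j * m * i" by (simp add: m_def)
    ultimately have "m' dvd b * (B * h' + \<delta> * i - t + j * m * i) + J * m' * (h' - A1 * r * i)"
      by (intro dvd_add dvd_mult[of _ _ b] dvd_mult2[of _ "J * m'"]) auto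
    also have "b * (B * h' + \<delta> * i - t + j * m * i) + J * m' * (h' - A1 * r * i)
      = (B * b + J * m') * (h' - A1 * r * i) - b * t"
      by (simp add: \<delta>_def \<gamma>_def algebra_simps)
    finally have "m' dvd h' - A1 * r * i - b * t" by (simp add: BJ)
    then obtain t3 where t3: "h' - A1 * r * i - b * t = m' * t3" by blast
    have "A1 * (d * r * i) + A2 * t + A3 * t3 = d * (A1 * r * i + b * t + m' * t3)"
      by (simp add: b m' algebra_simps)
    also have "\<dots> = h" by (simp add: t3[symmetric] h')
    finally have eq: "A1 * (d * r * i) + A2 * t + A3 * t3 = h" .
    have "c * i \<le> \<bar>\<delta>\<bar> * i" using True it by (intro mult_right_mono) auto
    also have "\<dots> \<le> \<bar>A3\<bar>" using it mA by (simp add: mult.commute)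
    finally have ci: "c * i \<le> \<bar>A3\<bar>" .
    have "c * \<bar>d * r * i\<bar> = (d * r) * (c * i)" using d0 r it by (simp add: abs_mult)
    also have "\<dots> \<le> (d * R) * \<bar>A3\<bar>" using ci d0 r rR it c by (intro mult_mono mult_left_mono) auto
    finally have 1: "c * \<bar>d * r * i\<bar> \<le> d * R * \<bar>A3\<bar>" .
    have "R * \<bar>t\<bar> \<le> R * \<bar>\<delta>\<bar>" using it R by (intro mult_left_mono) auto
    then have 2: "R * \<bar>t\<bar> \<le> \<bar>A3\<bar>" using Rd mA by linarith
    show ?thesis using eq 1 2 by blast
  next
    case False
    \<comment> \<open>Since \<delta> is congruent to - B A1 r modulo m', the pair (r, \<delta>)
      solves A1 s + b t2 = 0 modulo m'; multiplying the resulting equation by d gives the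
      relation.\<close>
    have "r * A1 + b * \<delta> = (B * b + J * m') * (r * A1) + b * (- B * r * A1 - j * m)"
      by (simp add: BJ \<delta>_def \<gamma>_def)
    also have "\<dots> = m' * (J * r * A1) - b * j * m" by (simp add: algebra_simps)
    finally have "m' dvd r * A1 + b * \<delta>" by (simp add: m_def)
    then obtain s3 where s3: "r * A1 + b * \<delta> = m' * s3" by blast
    have "A1 * (d * r) + A2 * \<delta> + A3 * (- s3) = d * (r * A1 + b * \<delta> - m' * s3)"
      by (simp add: b m' algebra_simps)
    then have "A1 * (d * r) + A2 * \<delta> + A3 * (- s3) = 0" by (simp add: s3)
    moreover have "0 < d * r" "d * r \<le> d * R" "\<bar>\<delta>\<bar> \<le> c" using d0 r rR False by auto
    ultimately show ?thesis by blast
  qed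
qed

text \<open>\<open>S\<close> and \<open>\<eta>\<close> depend on the coefficients and on \<kappa>,
  \<tau>, \<open>D\<close>, but not on P, u or h. So among the \<open>u\<close> with large third
  coordinate and small gcd of the last two coordinates, those without a short solution satisfy one
  of finitely many fixed linear relations, and they are O(P^2) in number. The factorial makes h
  divisible by every gcd(\<beta> u2, \<gamma> u3) that can occur.\<close>

lemma short_solution:
  fixes \<alpha> \<beta> \<gamma> D :: int and \<kappa> \<tau> :: real
  assumes pos: "\<alpha> > 0" "\<beta> > 0" "\<gamma> > 0" and \<kappa>: "\<kappa> > 0" and \<tau>: "\<tau> > 0" and D: "D \<ge> 1"
  obtains S \<eta> where "finite S" "\<And>s1 s2 s3. (s1, s2, s3) \<in> S \<Longrightarrow> s1 \<noteq> 0" "\<eta> > 0"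
    "\<And>(P::int) (u1::int) (u2::int) (u3::int) (h::int). P \<ge> 1 \<Longrightarrow> (u1, u2, u3) \<in> vbox (2 * P) \<Longrightarrow> \<bar>u3\<bar> \<ge> \<kappa> * P \<Longrightarrow> gcd u2 u3 \<le> D \<Longrightarrow>
      \<not> (\<exists>(s1, s2, s3) \<in> S. \<alpha> * u1 * s1 + \<beta> * u2 * s2 + \<gamma> * u3 * s3 = 0) \<Longrightarrow>
      fact (nat (\<beta> * \<gamma> * D)) dvd h \<Longrightarrow> 0 \<le> h \<Longrightarrow> h \<le> \<eta> * (real_of_int P)\<^sup>2 \<Longrightarrow>
      \<exists>t1 t2 t3 :: int. \<alpha> * u1 * t1 + \<beta> * u2 * t2 + \<gamma> * u3 * t3 = h \<and>
        \<bar>t1\<bar> \<le> \<tau> * P \<and> \<bar>t2\<bar> \<le> \<tau> * P \<and> \<bar>t3\<bar> \<le> \<tau> * P"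
proof -
  \<comment> \<open>t3 is recovered from the equation by dividing by \<gamma> u3, at least \<kappa>
    P in absolute value. With t1 and t2 at most \<tau>' P, their terms take up half of \<tau>
    \<kappa> P^2, and \<eta> below grants h the other half.\<close>
  define \<tau>' where "\<tau>' = min \<tau> (\<tau> * \<kappa> / (4 * (\<alpha> + \<beta>)))"
  have \<tau>': "\<tau>' > 0" "\<tau>' \<le> \<tau>" "4 * (\<alpha> + \<beta>) * \<tau>' \<le> \<tau> * \<kappa>"
  proof -
    show "\<tau>' > 0" using \<tau> \<kappa> pos by (auto simp: \<tau>'_def)
    show "\<tau>' \<le> \<tau>" by (simp add: \<tau>'_def)
    have "\<tau>' \<le> \<tau> * \<kappa> / (4 * (\<alpha> + \<beta>))" unfolding \<tau>'_def by (rule min.cobounded2)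
    then show "4 * (\<alpha> + \<beta>) * \<tau>' \<le> \<tau> * \<kappa>" using pos by (simp add: field_simps)
  qed
  \<comment> \<open>\<open>E\<close> bounds d = gcd(\<beta> u2, \<gamma> u3). \<open>R\<close> makes
    \<bar>\<gamma> u3\<bar> / R, the bound for t2, at most \<tau>' P, and \<open>c\<close> does so
    for d R \<bar>\<gamma> u3\<bar> / c, the bound for t1; hence \<open>c\<close> comes after
    \<open>R\<close>.\<close>
  define E where "E = \<beta> * \<gamma> * D"
  have E: "E \<ge> 1" using pos D unfolding E_def by (simp add: int_one_le_iff_zero_less)
  define R where "R = max 1 \<lceil>2 * \<gamma> / \<tau>'\<rceil>"
  define c where "c = max 1 \<lceil>2 * \<gamma> * E * R / \<tau>'\<rceil>"
  have R: "R \<ge> 1" "2 * \<gamma> \<le> R * \<tau>'"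
  proof -
    have "2 * \<gamma> / \<tau>' \<le> R" unfolding R_def by linarith
    then show "2 * \<gamma> \<le> R * \<tau>'" using \<tau>' by (simp add: field_simps)
  qed (simp add: R_def)
  have c: "c \<ge> 1" "2 * \<gamma> * E * R \<le> c * \<tau>'"
  proof -
    have "2 * \<gamma> * E * R / \<tau>' \<le> c" unfolding c_def by linarith
    then show "2 * \<gamma> * E * R \<le> c * \<tau>'" using \<tau>' by (simp add: field_simps)
  qed (simp add: c_def)
  \<comment> \<open>A relation bounds its own third entry, again because \<bar>\<gamma> u3\<bar>
    \<ge> \<kappa> P; hence \<open>S\<close> can be a fixed finite box.\<close>
  define s where "s = \<lceil>(2 * \<alpha> * E * R + 2 * \<beta> * c) / \<kappa>\<rceil>"
  define S where "S = {0<..E * R} \<times> {-c..c} \<times> {-s..s}"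
  define \<eta> where "\<eta> = \<tau> * \<kappa> / 2"
  show ?thesis
  proof (rule that)
    show "finite S" by (simp add: S_def)
    show "s1 \<noteq> 0" if "(s1, s2, s3) \<in> S" for s1 s2 s3 using that by (simp add: S_def)
    show "\<eta> > 0" using \<tau> \<kappa> by (simp add: \<eta>_def)
    fix P u1 u2 u3 h :: int
    assume P: "P \<ge> 1" and u: "(u1, u2, u3) \<in> vbox (2 * P)" and u3: "\<bar>u3\<bar> \<ge> \<kappa> * P"
      and g: "gcd u2 u3 \<le> D" and nrel: "\<not> (\<exists>(s1, s2, s3) \<in> S. \<alpha> * u1 * s1 + \<beta> * u2 * s2 + \<gamma> * u3 * s3 = 0)"
      and qh: "fact (nat (\<beta> * \<gamma> * D)) dvd h" and h: "0 \<le> h" "h \<le> \<eta> * (real_of_int P)\<^sup>2"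
    have kP: "\<kappa> * P > 0" using \<kappa> P by simp
    have u30: "u3 \<noteq> 0" using u3 kP by auto
    have uabs: "\<bar>u1\<bar> \<le> 2 * P" "\<bar>u2\<bar> \<le> 2 * P" "\<bar>u3\<bar> \<le> 2 * P" using u by auto
    define d where "d = gcd (\<beta> * u2) (\<gamma> * u3)"
    have d0: "d > 0" using u30 pos by (simp add: d_def)
    have g0: "gcd u2 u3 > 0" using u30 by simp
    have dE: "d \<le> E"
    proof -
      have "d dvd (\<beta> * u2) * \<gamma>" "d dvd (\<gamma> * u3) * \<beta>" unfolding d_def by (intro dvd_mult2 gcd_dvd1 gcd_dvd2)+
      then have "d dvd gcd ((\<beta> * \<gamma>) * u2) ((\<beta> * \<gamma>) * u3)" by (simp add: mult_ac)
      then have "d dvd (\<beta> * \<gamma>) * gcd u2 u3" using pos by (simp add: gcd_mult_left abs_mult)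
      then have "d \<le> (\<beta> * \<gamma>) * gcd u2 u3" using pos g0 by (intro zdvd_imp_le) auto
      also have "\<dots> \<le> (\<beta> * \<gamma>) * D" using g pos by (intro mult_left_mono) auto
      finally show ?thesis by (simp add: E_def)
    qed
    have "int (nat d) dvd int (fact (nat E))"
      using d0 dE by (subst of_nat_dvd_iff) (auto intro!: dvd_fact)
    then have dh: "d dvd h" using qh d0 by (simp add: E_def) (meson dvd_trans)
    have A3: "\<gamma> * u3 \<noteq> 0" using u30 pos by simp
    have A3le: "real_of_int \<bar>\<gamma> * u3\<bar> \<le> 2 * \<gamma> * P"
    proof -
      have "\<bar>\<gamma> * u3\<bar> \<le> \<gamma> * (2 * P)" using uabs pos by (simp add: abs_mult)
      then show ?thesis by (metis of_int_le_iff mult.assoc mult.commute)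
    qed
    have A3ge: "real_of_int \<bar>\<gamma> * u3\<bar> \<ge> \<kappa> * P"
    proof -
      have "\<bar>u3\<bar> \<le> \<bar>\<gamma> * u3\<bar>" using pos by (simp add: abs_mult mult_le_cancel_right1)
      then show ?thesis using u3 by linarith
    qed
    have A1le: "real_of_int \<bar>\<alpha> * u1\<bar> \<le> 2 * \<alpha> * P"
    proof -
      have "\<bar>\<alpha> * u1\<bar> \<le> \<alpha> * (2 * P)" using uabs pos by (simp add: abs_mult)
      then show ?thesis by (metis of_int_le_iff mult.assoc mult.commute)
    qed
    have A2le: "real_of_int \<bar>\<beta> * u2\<bar> \<le> 2 * \<beta> * P"
    proof -
      have "\<bar>\<beta> * u2\<bar> \<le> \<beta> * (2 * P)" using uabs pos by (simp add: abs_mult)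
      then show ?thesis by (metis of_int_le_iff mult.assoc mult.commute)
    qed
    from short_solution_or_relation[OF A3 d_def dh R(1) c(1), of "\<alpha> * u1"]
    show "\<exists>t1 t2 t3 :: int. \<alpha> * u1 * t1 + \<beta> * u2 * t2 + \<gamma> * u3 * t3 = h \<and>
        \<bar>t1\<bar> \<le> \<tau> * P \<and> \<bar>t2\<bar> \<le> \<tau> * P \<and> \<bar>t3\<bar> \<le> \<tau> * P"
    proof (elim disjE exE conjE)
      fix t1 t2 t3
      assume eq: "\<alpha> * u1 * t1 + \<beta> * u2 * t2 + \<gamma> * u3 * t3 = h"
        and t1: "c * \<bar>t1\<bar> \<le> d * R * \<bar>\<gamma> * u3\<bar>" and t2: "R * \<bar>t2\<bar> \<le> \<bar>\<gamma> * u3\<bar>"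
      have "real_of_int c * \<bar>t1\<bar> \<le> real_of_int (d * R) * \<bar>\<gamma> * u3\<bar>" using t1 by (metis of_int_le_iff of_int_mult)
      also have "\<dots> \<le> real_of_int (E * R) * (2 * \<gamma> * P)"
        using A3le dE d0 R by (intro mult_mono) auto
      also have "\<dots> = (2 * \<gamma> * E * R) * real_of_int P" by simp
      also have "\<dots> \<le> (c * \<tau>') * P" using c(2) P by (intro mult_right_mono) auto
      finally have t1': "\<bar>t1\<bar> \<le> \<tau>' * P" using c(1) by (simp add: mult.assoc)
      have "real_of_int R * \<bar>t2\<bar> \<le> 2 * \<gamma> * P" using t2 A3le by (metis of_int_le_iff of_int_mult order_trans)
      also have "\<dots> = (2 * \<gamma>) * real_of_int P" by simp
      also have "\<dots> \<le> (R * \<tau>') * P" using R(2) P by (intro mult_right_mono) auto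
      finally have t2': "\<bar>t2\<bar> \<le> \<tau>' * P" using R(1) by (simp add: mult.assoc)
      have "\<bar>\<gamma> * u3\<bar> * \<bar>t3\<bar> = \<bar>h - \<alpha> * u1 * t1 - \<beta> * u2 * t2\<bar>" using eq by (simp add: abs_mult[symmetric])
      also have "\<dots> \<le> h + \<bar>\<alpha> * u1\<bar> * \<bar>t1\<bar> + \<bar>\<beta> * u2\<bar> * \<bar>t2\<bar>"
        using h(1) by (simp only: abs_mult[symmetric])
      finally have "real_of_int \<bar>\<gamma> * u3\<bar> * \<bar>t3\<bar> \<le> h + real_of_int \<bar>\<alpha> * u1\<bar> * \<bar>t1\<bar> + real_of_int \<bar>\<beta> * u2\<bar> * \<bar>t2\<bar>"
        by (metis of_int_le_iff of_int_mult of_int_add)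
      also have "\<dots> \<le> \<eta> * (real_of_int P)\<^sup>2 + (2 * \<alpha> * P) * (\<tau>' * P) + (2 * \<beta> * P) * (\<tau>' * P)"
        using h(2) A1le A2le t1' t2' P pos by (intro add_mono mult_mono) auto
      also have "\<dots> = (\<eta> + (4 * (\<alpha> + \<beta>) * \<tau>') / 2) * (real_of_int P)\<^sup>2"
        by (simp add: power2_eq_square algebra_simps)
      also have "\<dots> \<le> (\<tau> * \<kappa> / 2 + \<tau> * \<kappa> / 2) * (real_of_int P)\<^sup>2"
      proof (rule mult_right_mono)
        show "\<eta> + (4 * (\<alpha> + \<beta>) * \<tau>') / 2 \<le> \<tau> * \<kappa> / 2 + \<tau> * \<kappa> / 2"
          using \<tau>'(3) unfolding \<eta>_def by linarith
      qed simp
      finally have "real_of_int \<bar>\<gamma> * u3\<bar> * \<bar>t3\<bar> \<le> (\<kappa> * P) * (\<tau> * P)" by (simp add: power2_eq_square mult_ac)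
      moreover have "(\<kappa> * P) * \<bar>t3\<bar> \<le> real_of_int \<bar>\<gamma> * u3\<bar> * \<bar>t3\<bar>"
        using A3ge by (intro mult_right_mono) auto
      ultimately have "(\<kappa> * P) * \<bar>t3\<bar> \<le> (\<kappa> * P) * (\<tau> * P)" by linarith
      then have t3': "\<bar>t3\<bar> \<le> \<tau> * P" using kP by (simp only: mult_le_cancel_left_pos)
      have "\<tau>' * P \<le> \<tau> * P" using \<tau>'(2) P by (intro mult_right_mono) auto
      then show ?thesis using eq t1' t2' t3' by (intro exI[of _ t1] exI[of _ t2] exI[of _ t3]) linarith
    next
      fix s1 s2 s3
      assume eq: "\<alpha> * u1 * s1 + \<beta> * u2 * s2 + \<gamma> * u3 * s3 = 0" and s1: "0 < s1" "s1 \<le> d * R" and s2: "\<bar>s2\<bar> \<le> c"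
      have s1E: "s1 \<le> E * R" using s1 dE R by (meson mult_right_mono order_trans zero_le_one)
      have "\<bar>\<gamma> * u3\<bar> * \<bar>s3\<bar> = \<bar>\<alpha> * u1 * s1 + \<beta> * u2 * s2\<bar>" using eq by (simp add: abs_mult[symmetric])
      also have "\<dots> \<le> \<bar>\<alpha> * u1\<bar> * \<bar>s1\<bar> + \<bar>\<beta> * u2\<bar> * \<bar>s2\<bar>" by (simp only: abs_mult[symmetric] abs_triangle_ineq)
      finally have "real_of_int \<bar>\<gamma> * u3\<bar> * \<bar>s3\<bar> \<le> real_of_int \<bar>\<alpha> * u1\<bar> * \<bar>s1\<bar> + real_of_int \<bar>\<beta> * u2\<bar> * \<bar>s2\<bar>"
        by (metis of_int_le_iff of_int_mult of_int_add)
      also have "\<dots> \<le> (2 * \<alpha> * P) * real_of_int (E * R) + (2 * \<beta> * P) * real_of_int c"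
      proof -
        have "real_of_int \<bar>s1\<bar> \<le> real_of_int (E * R)" using s1(1) s1E by (simp only: of_int_le_iff abs_of_pos)
        moreover have "real_of_int \<bar>s2\<bar> \<le> real_of_int c" using s2 by (simp only: of_int_le_iff)
        ultimately show ?thesis using A1le A2le P pos by (intro add_mono mult_mono) auto
      qed
      also have "\<dots> = real_of_int (2 * \<alpha> * E * R + 2 * \<beta> * c) * P" by (simp add: algebra_simps)
      finally have "(\<kappa> * P) * \<bar>s3\<bar> \<le> real_of_int (2 * \<alpha> * E * R + 2 * \<beta> * c) * P"
        using A3ge by (meson mult_right_mono order_trans abs_ge_zero of_int_0_le_iff)
      then have "\<kappa> * \<bar>s3\<bar> \<le> real_of_int (2 * \<alpha> * E * R + 2 * \<beta> * c)" using P by (simp add: mult_ac)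
      then have "\<bar>s3\<bar> \<le> (2 * \<alpha> * E * R + 2 * \<beta> * c) / \<kappa>" using \<kappa> by (simp add: field_simps)
      then have "\<bar>s3\<bar> \<le> s" unfolding s_def by linarith
      then have "(s1, s2, s3) \<in> S" using s1 s1E s2 by (auto simp: S_def)
      then show ?thesis using nrel eq by blast
    qed
  qed
qed

section \<open>Correlations of the representation function\<close>

text \<open>A cut-off of slope 1 / P that vanishes at \<bar>x\<bar> = P: a translation by \<tau> P
  changes it by at most \<tau>, so points pushed across the boundary of the box cost nothing
  extra.\<close>

definition tent :: "int \<Rightarrow> int \<Rightarrow> real" where
  "tent P x = max 0 (1 - \<bar>x\<bar> / P)"

definition tent3 :: "int \<Rightarrow> int \<times> int \<times> int \<Rightarrow> real" where
  "tent3 P = (\<lambda>(x, y, z). tent P x * tent P y * tent P z)"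

lemma tent_bounds: "P \<ge> 1 \<Longrightarrow> 0 \<le> tent P x" "P \<ge> 1 \<Longrightarrow> tent P x \<le> 1"
  by (simp_all add: tent_def)

lemma tent_eq_0: "P \<ge> 1 \<Longrightarrow> \<bar>x\<bar> \<ge> P \<Longrightarrow> tent P x = 0"
  by (simp add: tent_def field_simps)

lemma tent_diff_le:
  fixes P x t :: int
  assumes "P \<ge> 1" shows "tent P x - tent P (x + t) \<le> \<bar>t\<bar> / P"
proof -
  have "real_of_int \<bar>x + t\<bar> / P \<le> (\<bar>x\<bar> + \<bar>t\<bar>) / P" using assms by (intro divide_right_mono) auto
  also have "\<dots> = \<bar>x\<bar> / P + \<bar>t\<bar> / P" by (simp add: add_divide_distrib)
  finally have "1 - \<bar>x\<bar> / P - (1 - \<bar>x + t\<bar> / P) \<le> \<bar>t\<bar> / P" by linarith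
  moreover have "0 \<le> real_of_int \<bar>t\<bar> / P" using assms by simp
  ultimately show ?thesis unfolding tent_def max_def by (simp split: if_splits)
qed

lemma tent3_bounds:
  assumes "P \<ge> 1" shows "0 \<le> tent3 P v" "tent3 P v \<le> 1"
proof -
  obtain x y z where v: "v = (x, y, z)" by (cases v)
  show "0 \<le> tent3 P v" using assms by (simp add: v tent3_def tent_bounds)
  have "tent P x * tent P y * tent P z \<le> 1 * 1 * 1"
    using assms by (intro mult_mono mult_nonneg_nonneg tent_bounds) auto
  then show "tent3 P v \<le> 1" by (simp add: v tent3_def)
qed

lemma tent3_eq_0:
  assumes "P \<ge> 1" "v \<notin> vbox P" shows "tent3 P v = 0"
proof -
  obtain x y z where v: "v = (x, y, z)" by (cases v)
  have "\<bar>x\<bar> \<ge> P \<or> \<bar>y\<bar> \<ge> P \<or> \<bar>z\<bar> \<ge> P" using assms(2) by (auto simp: v)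
  then show ?thesis using tent_eq_0[OF assms(1)] by (auto simp: v tent3_def)
qed

lemma mult_diff_le_diffs:
  fixes a a' b b' :: real
  assumes "0 \<le> a" "a \<le> 1" "0 \<le> b'" "b' \<le> 1" "a - a' \<le> s" "b - b' \<le> t" "s \<ge> 0" "t \<ge> 0"
  shows "a * b - a' * b' \<le> s + t"
proof -
  have "a * b - a' * b' = a * (b - b') + (a - a') * b'" by (simp add: algebra_simps)
  also have "a * (b - b') \<le> a * t" using assms by (intro mult_left_mono) auto
  also have "a * t \<le> 1 * t" using assms by (intro mult_right_mono) auto
  also have "(a - a') * b' \<le> s * b'" using assms by (intro mult_right_mono) auto
  also have "s * b' \<le> s * 1" using assms by (intro mult_left_mono) auto
  finally show ?thesis by simp
qed

lemma tent3_diff_le: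
  fixes P t1 t2 t3 :: int and \<tau> :: real
  assumes P: "P \<ge> 1" and t: "\<bar>t1\<bar> \<le> \<tau> * P" "\<bar>t2\<bar> \<le> \<tau> * P" "\<bar>t3\<bar> \<le> \<tau> * P" and \<tau>: "\<tau> \<ge> 0"
  shows "tent3 P w - tent3 P (w + (t1, t2, t3)) \<le> 3 * \<tau>"
proof -
  obtain x y z where w: "w = (x, y, z)" by (cases w)
  have d: "tent P x - tent P (x + t) \<le> \<tau>" if "\<bar>t\<bar> \<le> \<tau> * P" for x t :: int
  proof -
    have "\<bar>t\<bar> / P \<le> \<tau>" using that P by (simp add: field_simps)
    then show ?thesis using tent_diff_le[OF P, of x t] by linarith
  qed
  have "tent P x * tent P y - tent P (x + t1) * tent P (y + t2) \<le> \<tau> + \<tau>"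
    using d t P \<tau> by (intro mult_diff_le_diffs tent_bounds) auto
  then have "(tent P x * tent P y) * tent P z - (tent P (x + t1) * tent P (y + t2)) * tent P (z + t3) \<le> (\<tau> + \<tau>) + \<tau>"
    using d t P \<tau> tent_bounds[OF P] by (intro mult_diff_le_diffs mult_nonneg_nonneg mult_le_one) auto
  then show ?thesis by (simp add: w tent3_def)
qed

text \<open>The correlation at lag h of the weighted number of representations, written over pairs
  of lattice points so that no range for \<open>n\<close> has to be fixed.\<close>

definition cor :: "(int \<times> int \<times> int \<Rightarrow> int) \<Rightarrow> int \<Rightarrow> int \<Rightarrow> real" where
  "cor F P h = (\<Sum>v\<in>vbox P. \<Sum>w\<in>vbox P. if F v - F w = h then tent3 P v * tent3 P w else 0)"

definition corslice :: "(int \<times> int \<times> int \<Rightarrow> int) \<Rightarrow> int \<Rightarrow> int \<Rightarrow> int \<times> int \<times> int \<Rightarrow> real" where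
  "corslice F P h u = (\<Sum>w\<in>vbox P. if F (w + u) - F w = h then tent3 P (w + u) * tent3 P w else 0)"

lemma cor_eq_sum_slices:
  assumes P: "P \<ge> 1"
  shows "cor F P h = (\<Sum>u\<in>vbox (2 * P). corslice F P h u)"
proof -
  have slice: "(\<Sum>v\<in>vbox P. if F v - F w = h then tent3 P v * tent3 P w else 0)
      = (\<Sum>u\<in>vbox (2 * P). if F (w + u) - F w = h then tent3 P (w + u) * tent3 P w else 0)"
    (is "?l = ?r") if w: "w \<in> vbox P" for w
  proof -
    let ?g = "\<lambda>v. if F v - F w = h then tent3 P v * tent3 P w else 0"
    have "?r = (\<Sum>v\<in>(\<lambda>u. w + u) ` vbox (2 * P). ?g v)"
      by (subst sum.reindex) (auto simp: inj_on_def)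
    \<comment> \<open>The translated larger box overshoots \<open>vbox P\<close>, but there the tent
      vanishes.\<close>
    also have "\<dots> = ?l"
    proof (rule sum.mono_neutral_right)
      show "vbox P \<subseteq> (\<lambda>u. w + u) ` vbox (2 * P)"
      proof
        fix v assume v: "v \<in> vbox P"
        have "v - w \<in> vbox (2 * P)" using v w by (cases v, cases w) auto
        then show "v \<in> (\<lambda>u. w + u) ` vbox (2 * P)" by (intro image_eqI[of _ _ "v - w"]) auto
      qed
    qed (use tent3_eq_0[OF P] in auto)
    finally show ?thesis by simp
  qed
  have "cor F P h = (\<Sum>w\<in>vbox P. \<Sum>v\<in>vbox P. if F v - F w = h then tent3 P v * tent3 P w else 0)"
    unfolding cor_def by (rule sum.swap)
  also have "\<dots> = (\<Sum>w\<in>vbox P. \<Sum>u\<in>vbox (2 * P). if F (w + u) - F w = h then tent3 P (w + u) * tent3 P w else 0)"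
    by (intro sum.cong refl slice)
  also have "\<dots> = (\<Sum>u\<in>vbox (2 * P). corslice F P h u)"
    unfolding corslice_def by (rule sum.swap)
  finally show ?thesis .
qed

lemma corslice_nonneg: "P \<ge> 1 \<Longrightarrow> corslice F P h u \<ge> 0"
  unfolding corslice_def by (intro sum_nonneg) (auto simp: tent3_bounds)

text \<open>For correlations only the polarisation identity matters: F(w + u) - F(w) is linear in
  \<open>w\<close>, with diagonal bilinear part. A linear part of \<open>F\<close>, such as that of
  a triangular number, stays inside F(u).\<close>

locale quad_form =
  fixes F :: "int \<times> int \<times> int \<Rightarrow> int" and \<alpha> \<beta> \<gamma> :: int
  assumes pos: "\<alpha> > 0" "\<beta> > 0" "\<gamma> > 0"
    and F_add: "\<And>w1 w2 w3 u1 u2 u3. F (w1 + u1, w2 + u2, w3 + u3)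
      = F (w1, w2, w3) + F (u1, u2, u3) + \<alpha> * u1 * w1 + \<beta> * u2 * w2 + \<gamma> * u3 * w3"
begin

definition lin :: "int \<times> int \<times> int \<Rightarrow> int \<times> int \<times> int \<Rightarrow> int" where
  "lin = (\<lambda>(u1, u2, u3) (w1, w2, w3). \<alpha> * u1 * w1 + \<beta> * u2 * w2 + \<gamma> * u3 * w3)"

definition K0 :: real where "K0 = 4 * \<alpha> * \<beta> * \<gamma> + 10"

lemma K0_pos: "K0 \<ge> 10"
  using pos by (simp add: K0_def)

lemma F_diff: "F (w + u) - F w = h \<longleftrightarrow> lin u w = h - F u"
  by (cases w; cases u) (auto simp: F_add lin_def)

lemma lin_add: "lin u (w + t) = lin u w + lin u t"
  by (cases u; cases w; cases t) (simp add: lin_def algebra_simps)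

lemma card_lin_le:
  assumes P: "P \<ge> 1" and u: "u \<in> vbox (2 * P)" "u \<noteq> (0, 0, 0)"
  shows "real (card {w \<in> vbox P. lin u w = m}) \<le> K0 * (real_of_int P)\<^sup>2 * wt u"
proof -
  obtain u1 u2 u3 where uu: "u = (u1, u2, u3)" by (cases u)
  have "{w \<in> vbox P. lin u w = m} = {(x, y, z) \<in> vbox P. \<alpha> * u1 * x + \<beta> * u2 * y + \<gamma> * u3 * z = m}"
    by (auto simp: uu lin_def)
  then show ?thesis
    using card_plane_le[OF pos P, of u1 u2 u3 m] u by (simp add: uu K0_def)
qed

lemma corslice_le_card:
  assumes P: "P \<ge> 1"
  shows "corslice F P h u \<le> real (card {w \<in> vbox P. lin u w = h - F u})"
proof -
  have "corslice F P h u \<le> (\<Sum>w\<in>vbox P. if lin u w = h - F u then 1 else 0)"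
    unfolding corslice_def F_diff
    by (intro sum_mono) (auto simp: tent3_bounds[OF P] intro!: mult_le_one)
  also have "\<dots> = real (card {w \<in> vbox P. lin u w = h - F u})"
    by (simp add: sum.If_cases Int_def)
  finally show ?thesis .
qed

text \<open>Translation by t carries the plane for 0 into the plane for h and changes each of the
  two tent factors by at most 3 \<tau>. The bound is one-sided: translated points outside the box
  have weight 0, and further points on the target plane only increase the slice for h.\<close>

lemma corslice_diff_le:
  fixes P t1 t2 t3 :: int and \<tau> :: real
  assumes P: "P \<ge> 1" and \<tau>: "\<tau> \<ge> 0"
    and t: "lin u (t1, t2, t3) = h" "\<bar>t1\<bar> \<le> \<tau> * P" "\<bar>t2\<bar> \<le> \<tau> * P" "\<bar>t3\<bar> \<le> \<tau> * P"
  shows "corslice F P 0 u - corslice F P h u \<le> 6 * \<tau> * real (card {w \<in> vbox P. lin u w = - F u})"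
proof -
  let ?t = "(t1, t2, t3)"
  let ?S = "{w \<in> vbox P. lin u w = - F u}"
  let ?g = "\<lambda>w. tent3 P (w + u) * tent3 P w"
  have S0: "corslice F P 0 u = (\<Sum>w\<in>?S. ?g w)"
    unfolding corslice_def F_diff by (simp add: sum.If_cases Int_def)
  have Sh: "corslice F P h u = (\<Sum>w\<in>{w \<in> vbox P. lin u w = h - F u}. ?g w)"
    unfolding corslice_def F_diff by (simp add: sum.If_cases Int_def)
  have "(\<Sum>w\<in>?S. ?g (w + ?t)) = (\<Sum>w\<in>(\<lambda>w. w + ?t) ` ?S. ?g w)"
    by (subst sum.reindex) (auto simp: inj_on_def)
  also have "\<dots> = (\<Sum>w\<in>(\<lambda>w. w + ?t) ` ?S \<inter> vbox P. ?g w)"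
    by (rule sum.mono_neutral_right) (use tent3_eq_0[OF P] in auto)
  also have "\<dots> \<le> corslice F P h u"
    unfolding Sh
  proof (rule sum_mono2)
    show "(\<lambda>w. w + ?t) ` ?S \<inter> vbox P \<subseteq> {w \<in> vbox P. lin u w = h - F u}"
    proof
      fix w' assume "w' \<in> (\<lambda>w. w + ?t) ` ?S \<inter> vbox P"
      then obtain w where "w' = w + ?t" "lin u w = - F u" "w' \<in> vbox P" by blast
      then show "w' \<in> {w \<in> vbox P. lin u w = h - F u}" using t(1) lin_add[of u w ?t] by simp
    qed
    show "finite {w \<in> vbox P. lin u w = h - F u}" by simp
    show "0 \<le> ?g w" for w using tent3_bounds[OF P] by simp
  qed
  finally have "corslice F P 0 u - corslice F P h u \<le> (\<Sum>w\<in>?S. ?g w - ?g (w + ?t))"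
    unfolding S0 sum_subtractf by simp
  also have "\<dots> \<le> (\<Sum>w\<in>?S. 6 * \<tau>)"
  proof (rule sum_mono)
    fix w
    have "tent3 P (w + u) - tent3 P (w + u + ?t) \<le> 3 * \<tau>" "tent3 P w - tent3 P (w + ?t) \<le> 3 * \<tau>"
      using tent3_diff_le[OF P t(2-4) \<tau>] by blast+
    then have "tent3 P (w + u) * tent3 P w - tent3 P (w + u + ?t) * tent3 P (w + ?t) \<le> 3 * \<tau> + 3 * \<tau>"
      using tent3_bounds[OF P] \<tau> by (intro mult_diff_le_diffs) auto
    moreover have eq: "w + ?t + u = w + u + ?t" by (simp add: ac_simps)
    ultimately show "?g w - ?g (w + ?t) \<le> 6 * \<tau>" unfolding eq by linarith
  qed
  also have "\<dots> = 6 * \<tau> * real (card ?S)" by simp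
  finally show ?thesis .
qed

text \<open>The difference vectors \<open>u\<close> are split into zero, those with small third
  coordinate (\<open>B1\<close>), with large gcd (\<open>B2\<close>), with large gcd of the last two
  coordinates (\<open>B3\<close>), on a short relation (\<open>B4\<close>), and the rest, where a
  short translation exists. On the rest a slice loses at most 6 \<tau> times its trivial bound;
  elsewhere the slice for 0 is bounded trivially and the slice for h is dropped as nonnegative.
  \<open>B1\<close> and \<open>B2\<close> are estimated through sums of weights, \<open>B3\<close>
  and \<open>B4\<close> by their size times a uniform bound.\<close>

theorem correlation_continuity:
  assumes \<epsilon>: "\<epsilon> > 0"
  obtains q P0 :: int and \<eta> :: real where "q \<ge> 1" "\<eta> > 0" "P0 \<ge> 1"
    "\<And>P h. P \<ge> P0 \<Longrightarrow> q dvd h \<Longrightarrow> 0 \<le> h \<Longrightarrow> h \<le> \<eta> * (real_of_int P)\<^sup>2 \<Longrightarrow>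
      cor F P 0 - cor F P h \<le> \<epsilon> * (real_of_int P) ^ 4"
proof -
  define C where "C = K0"
  have C: "C \<ge> 10" using K0_pos by (simp add: C_def)
  \<comment> \<open>\<epsilon> is split into five parts: one each for the terms of order p^4 from
    \<open>B1\<close>, \<open>B2\<close>, \<open>B3\<close> and the translation, governed by
    \<kappa>, \<open>K\<close>, \<open>D\<close> and \<tau>, and one for everything of lower order.
    \<open>D\<close> comes after \<kappa> and \<open>K\<close>, because the uniform weight bound
    used on \<open>B3\<close> is K / (\<kappa> p).\<close>
  define \<kappa> where "\<kappa> = \<epsilon> / (360 * C)"
  have \<kappa>: "\<kappa> > 0" using \<epsilon> C by (simp add: \<kappa>_def)
  define K where "K = max 1 \<lceil>720 * C / \<epsilon>\<rceil>"
  have K1: "K \<ge> 1" by (simp add: K_def)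
  have K2: "144 * C / (K + 1) \<le> \<epsilon> / 5"
  proof -
    have "720 * C / \<epsilon> \<le> K" unfolding K_def by linarith
    then have "720 * C \<le> \<epsilon> * (K + 1)" using \<epsilon> by (simp add: field_simps)
    then show ?thesis using K1 by (simp add: field_simps)
  qed
  define D where "D = max 1 \<lceil>1800 * C * K / (\<kappa> * \<epsilon>)\<rceil>"
  have D1: "D \<ge> 1" by (simp add: D_def)
  have D2: "360 * C * K / (\<kappa> * (D + 1)) \<le> \<epsilon> / 5"
  proof -
    have "1800 * C * K / (\<kappa> * \<epsilon>) \<le> D" unfolding D_def by linarith
    then have "1800 * C * K \<le> \<kappa> * \<epsilon> * D" using \<epsilon> \<kappa> by (simp add: field_simps)
    also have "\<dots> \<le> \<kappa> * \<epsilon> * (D + 1)" using \<epsilon> \<kappa> by (intro mult_left_mono) auto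
    finally have "1800 * C * K \<le> \<kappa> * \<epsilon> * (D + 1)" .
    then have "360 * C * K \<le> \<epsilon> / 5 * (\<kappa> * (D + 1))" by (simp add: algebra_simps)
    moreover have "\<kappa> * (D + 1) > 0" using D1 \<kappa> by simp
    ultimately show ?thesis by (simp only: pos_divide_le_eq)
  qed
  define \<tau> where "\<tau> = \<epsilon> / (6000 * C)"
  have \<tau>: "\<tau> > 0" using \<epsilon> C by (simp add: \<tau>_def)
  obtain S \<eta> where S: "finite S" "\<And>s1 s2 s3. (s1, s2, s3) \<in> S \<Longrightarrow> s1 \<noteq> 0" and \<eta>: "\<eta> > 0"
    and sol: "\<And>(P::int) (u1::int) (u2::int) (u3::int) (h::int). P \<ge> 1 \<Longrightarrow> (u1, u2, u3) \<in> vbox (2 * P) \<Longrightarrow> \<bar>u3\<bar> \<ge> \<kappa> * P \<Longrightarrow> gcd u2 u3 \<le> D \<Longrightarrow>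
      \<not> (\<exists>(s1, s2, s3) \<in> S. \<alpha> * u1 * s1 + \<beta> * u2 * s2 + \<gamma> * u3 * s3 = 0) \<Longrightarrow>
      fact (nat (\<beta> * \<gamma> * D)) dvd h \<Longrightarrow> 0 \<le> h \<Longrightarrow> h \<le> \<eta> * (real_of_int P)\<^sup>2 \<Longrightarrow>
      \<exists>t1 t2 t3 :: int. \<alpha> * u1 * t1 + \<beta> * u2 * t2 + \<gamma> * u3 * t3 = h \<and>
        \<bar>t1\<bar> \<le> \<tau> * P \<and> \<bar>t2\<bar> \<le> \<tau> * P \<and> \<bar>t3\<bar> \<le> \<tau> * P"
    by (rule short_solution[OF pos \<kappa> \<tau> D1]) blast
  \<comment> \<open>\<open>M\<close> collects what is of order p^(7/2) or less: u = 0, the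
    square-root terms of the weight sums, and \<open>B4\<close>, which has only O(p^2) elements.
    \<open>P0\<close> makes this at most \<epsilon> p^4 / 5.\<close>
  define M where "M = 27 + 2 * (C * 36 * sqrt 2) + 25 * C * card S * K / \<kappa>"
  have M0: "M > 0"
    unfolding M_def using C K1 \<kappa> by (intro add_pos_nonneg) auto
  define P0 where "P0 = max 1 \<lceil>(5 * M / \<epsilon>)\<^sup>2\<rceil>"
  show ?thesis
  proof (rule that)
    show "(fact (nat (\<beta> * \<gamma> * D)) :: int) \<ge> 1" by (rule fact_ge_1)
    show "\<eta> > 0" by (rule \<eta>)
    show "P0 \<ge> 1" by (simp add: P0_def)
    fix P h :: int
    assume PP: "P \<ge> P0" and qh: "fact (nat (\<beta> * \<gamma> * D)) dvd h" and h: "0 \<le> h" "h \<le> \<eta> * (real_of_int P)\<^sup>2"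
    have P: "P \<ge> 1" using PP by (simp add: P0_def)
    define p where "p = real_of_int P"
    have p: "p \<ge> 1" using P by (simp add: p_def)
    define X where "X = vbox (2 * P)"
    define B1 where "B1 = {(x, y, z) \<in> X. \<bar>z\<bar> \<le> \<kappa> * P}"
    define B2 where "B2 = {u \<in> X. vgcd u > K}"
    define B3 where "B3 = {(x, y, z) \<in> X. (y, z) \<noteq> (0, 0) \<and> gcd y z > D}"
    define B4 where "B4 = {(u1, u2, u3) \<in> X. \<exists>(s1, s2, s3) \<in> S. \<alpha> * u1 * s1 + \<beta> * u2 * s2 + \<gamma> * u3 * s3 = 0}"
    have finX: "finite X" by (simp add: X_def)
    have sub: "B1 \<subseteq> X" "B2 \<subseteq> X" "B3 \<subseteq> X" "B4 \<subseteq> X" by (auto simp: B1_def B2_def B3_def B4_def)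
    define W where "W = (\<lambda>u. C * p\<^sup>2 * wt u)"
    \<comment> \<open>Outside \<open>B1\<close> and \<open>B2\<close> one has \<open>vgcd u\<close>
      \<le> K and \<open>vmax u\<close> > \<kappa> p for nonzero \<open>u\<close>, so
      \<open>W u\<close> is at most this \<open>c\<close>.\<close>
    define c where "c = C * p\<^sup>2 * (K / (\<kappa> * p))"
    have c0: "c \<ge> 0" using C K1 \<kappa> p by (simp add: c_def)
    have W0: "W u \<ge> 0" for u using C wt_nonneg by (simp add: W_def)
    define b where "b u = (if u = (0, 0, 0) then 27 * p ^ 3 else 0) + (if u \<in> B1 then W u else 0)
      + (if u \<in> B2 then W u else 0) + (if u \<in> B3 then c else 0) + (if u \<in> B4 then c else 0) + 6 * \<tau> * W u" for u
    have main: "corslice F P 0 u - corslice F P h u \<le> b u" if u: "u \<in> X" for u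
    proof -
      have diff: "corslice F P 0 u - corslice F P h u \<le> corslice F P 0 u" using corslice_nonneg[OF P] by simp
      have card0: "corslice F P 0 u \<le> real (card {w \<in> vbox P. lin u w = - F u})"
        using corslice_le_card[OF P, of 0 u] by simp
      have bge: "b u \<ge> (if u = (0, 0, 0) then 27 * p ^ 3 else 0)" "b u \<ge> (if u \<in> B1 then W u else 0)"
        "b u \<ge> (if u \<in> B2 then W u else 0)" "b u \<ge> (if u \<in> B3 then c else 0)"
        "b u \<ge> (if u \<in> B4 then c else 0)" "b u \<ge> 6 * \<tau> * W u"
        using W0[of u] c0 p \<tau> by (auto simp: b_def)
      show ?thesis
      proof (cases "u = (0, 0, 0)")
        case True
        have "real (card {w \<in> vbox P. lin u w = - F u}) \<le> real (card (vbox P))"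
          by (simp add: card_mono)
        also have "\<dots> = (2 * p + 1) ^ 3"
          using P by (simp add: vbox_def card_cartesian_product p_def power3_eq_cube)
        also have "\<dots> \<le> (3 * p) ^ 3" using p by (intro power_mono) auto
        finally have "real (card {w \<in> vbox P. lin u w = - F u}) \<le> 27 * p ^ 3" by (simp add: power_mult_distrib)
        then show ?thesis using diff card0 bge(1) True by simp
      next
        case False
        have cW: "real (card {w \<in> vbox P. lin u w = - F u}) \<le> W u"
          using card_lin_le[OF P, of u "- F u"] u False by (simp add: X_def W_def C_def p_def)
        obtain u1 u2 u3 where uu: "u = (u1, u2, u3)" by (cases u)
        \<comment> \<open>\<open>B3\<close> and \<open>B4\<close> are treated only outside
          \<open>B1\<close> and \<open>B2\<close>, where the uniform bound \<open>c\<close> is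
          available.\<close>
        consider "u \<in> B1" | "u \<in> B2" | "u \<notin> B1" "u \<notin> B2" "u \<in> B3 \<union> B4" | "u \<notin> B1" "u \<notin> B3" "u \<notin> B4" by blast
        then show ?thesis
        proof cases
          case 1
          then show ?thesis using diff card0 cW bge(2) by simp
        next
          case 2
          then show ?thesis using diff card0 cW bge(3) by simp
        next
          case 3
          have u3: "\<bar>u3\<bar> > \<kappa> * P" using 3(1) u by (auto simp: uu B1_def)
          have "vgcd u \<le> K" using 3(2) u by (auto simp: B2_def)
          moreover have "real_of_int (vmax u) \<ge> \<bar>u3\<bar>" by (simp add: uu vmax_def)
          moreover have "\<kappa> * p > 0" using \<kappa> p by simp
          moreover have "0 \<le> vgcd u" using vgcd_pos[OF False] by simp
          ultimately have "wt u \<le> K / (\<kappa> * p)"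
            unfolding wt_def using u3 K1 by (intro frac_le) (auto simp: p_def)
          then have "W u \<le> c" unfolding W_def c_def using C by (intro mult_left_mono) auto
          then show ?thesis using diff card0 cW bge(4,5) 3(3) by (auto split: if_splits)
        next
          case 4
          have u3: "\<bar>u3\<bar> > \<kappa> * P" using 4(1) u by (auto simp: uu B1_def)
          have kp: "\<kappa> * P > 0" using \<kappa> P by simp
          have "u3 \<noteq> 0" using u3 kp by auto
          then have g: "gcd u2 u3 \<le> D" using 4(2) u by (auto simp: uu B3_def)
          have nr: "\<not> (\<exists>(s1, s2, s3) \<in> S. \<alpha> * u1 * s1 + \<beta> * u2 * s2 + \<gamma> * u3 * s3 = 0)"
            using 4(3) u unfolding B4_def uu by blast
          obtain t1 t2 t3 :: int where t: "\<alpha> * u1 * t1 + \<beta> * u2 * t2 + \<gamma> * u3 * t3 = h"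
            "\<bar>t1\<bar> \<le> \<tau> * P" "\<bar>t2\<bar> \<le> \<tau> * P" "\<bar>t3\<bar> \<le> \<tau> * P"
          proof -
            have "(u1, u2, u3) \<in> vbox (2 * P)" using u by (simp only: uu X_def)
            from sol[OF P this less_imp_le[OF u3] g nr qh h] show ?thesis
              by (elim exE conjE) (rule that; simp)
          qed
          have "lin u (t1, t2, t3) = h" using t(1) by (simp add: uu lin_def)
          then have "corslice F P 0 u - corslice F P h u \<le> 6 * \<tau> * real (card {w \<in> vbox P. lin u w = - F u})"
            by (rule corslice_diff_le[OF P less_imp_le[OF \<tau>] _ t(2-4)])
          also have "\<dots> \<le> 6 * \<tau> * W u" using cW \<tau> by (intro mult_left_mono) auto
          finally show ?thesis using bge(6) by linarith
        qed
      qed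
    qed
    have s2: "sqrt (2 * p) = sqrt 2 * sqrt p" by (rule real_sqrt_mult)
    have z2P: "\<bar>real_of_int z\<bar> \<le> 2 * real_of_int P" if "\<bar>z\<bar> \<le> 2 * P" for z
    proof -
      have "real_of_int \<bar>z\<bar> \<le> real_of_int (2 * P)" using that by (simp only: of_int_le_iff)
      then show ?thesis by simp
    qed
    \<comment> \<open>For K = 0 and \<kappa> = 2 the side conditions of \<open>sum_wt_le\<close>
      hold for every nonzero \<open>u\<close> of the box.\<close>
    have sumwt: "(\<Sum>u\<in>X. wt u) \<le> 200 * p\<^sup>2"
    proof -
      have "(\<Sum>u\<in>X. wt u) \<le> 72 * 2 * P\<^sup>2 / (0 + 1) + 36 * P * sqrt (2 * P)"
        using sum_wt_le[OF P, of 0 2 X] vgcd_pos z2P by (simp add: X_def)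
      also have "\<dots> = 144 * p\<^sup>2 + 36 * p * sqrt (2 * p)" by (simp add: p_def)
      also have "sqrt (2 * p) \<le> (3/2) * p"
      proof (rule real_le_lsqrt)
        have "2 * p \<le> 2 * p * p" using p by simp
        also have "\<dots> \<le> (3 / 2 * p)\<^sup>2" by (simp add: power2_eq_square)
        finally show "2 * p \<le> (3 / 2 * p)\<^sup>2" .
      qed (use p in auto)
      finally have "(\<Sum>u\<in>X. wt u) \<le> 144 * p\<^sup>2 + 36 * p * (3 / 2 * p)" using p by (simp add: mult_left_mono)
      also have "\<dots> = 198 * p\<^sup>2" by (simp add: power2_eq_square)
      also have "\<dots> \<le> 200 * p\<^sup>2" by (intro mult_right_mono) auto
      finally show ?thesis .
    qed
    have sum1: "(\<Sum>u\<in>B1. wt u) \<le> 72 * \<kappa> * p\<^sup>2 + 36 * p * (sqrt 2 * sqrt p)"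
    proof -
      have "(\<Sum>u\<in>B1. wt u) \<le> 72 * \<kappa> * P\<^sup>2 / real_of_int ((0::int) + 1) + 36 * P * sqrt (2 * P)"
      proof (rule sum_wt_le[OF P])
        show "B1 \<subseteq> vbox (2 * P)" using sub(1) by (simp add: X_def)
        show "vgcd (u1, u2, u3) > 0 \<and> \<bar>u3\<bar> \<le> \<kappa> * P"
          if "(u1, u2, u3) \<in> B1" "(u1, u2, u3) \<noteq> (0, 0, 0)" for u1 u2 u3
          using that vgcd_pos[of "(u1, u2, u3)"] by (simp add: B1_def)
      qed (use \<kappa> in auto)
      then show ?thesis using s2 by (simp add: p_def)
    qed
    have sum2: "(\<Sum>u\<in>B2. wt u) \<le> 144 * p\<^sup>2 / (K + 1) + 36 * p * (sqrt 2 * sqrt p)"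
      using sum_wt_le[OF P, of K 2 B2] sub(2) K1 s2 z2P
      by (auto simp: X_def B2_def p_def)
    have card3: "real (card B3) \<le> 360 * p ^ 3 / (D + 1)"
      using card_large_gcd_le[OF P, of D] D1 by (simp add: B3_def X_def p_def)
    have card4: "real (card B4) \<le> 25 * real (card S) * p\<^sup>2"
      using card_relation_le[where \<beta> = \<beta> and \<gamma> = \<gamma>, OF pos(1) P S] by (simp add: B4_def X_def p_def)
    have r1: "p ^ 3 \<le> p ^ 3 * sqrt p" using p by (simp add: mult_le_cancel_left1)
    have "cor F P 0 - cor F P h = (\<Sum>u\<in>X. corslice F P 0 u - corslice F P h u)"
      by (simp add: cor_eq_sum_slices[OF P] sum_subtractf X_def)
    also have "\<dots> \<le> (\<Sum>u\<in>X. b u)" by (intro sum_mono main)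
    also have "\<dots> = 27 * p ^ 3 + (\<Sum>u\<in>B1. W u) + (\<Sum>u\<in>B2. W u) + real (card B3) * c + real (card B4) * c
      + 6 * \<tau> * (\<Sum>u\<in>X. W u)"
    proof -
      have "X \<inter> B1 = B1" "X \<inter> B2 = B2" "X \<inter> B3 = B3" "X \<inter> B4 = B4" using sub by auto
      moreover have "(0, 0, 0) \<in> X" using P by (simp add: X_def)
      ultimately show ?thesis using finX
        by (simp add: b_def sum.distrib sum.If_cases sum_distrib_left Int_def[symmetric] sum.delta)
    qed
    also have "(\<Sum>u\<in>B1. W u) = C * p\<^sup>2 * (\<Sum>u\<in>B1. wt u)" by (simp add: W_def sum_distrib_left)
    also have "(\<Sum>u\<in>B2. W u) = C * p\<^sup>2 * (\<Sum>u\<in>B2. wt u)" by (simp add: W_def sum_distrib_left)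
    also have "(\<Sum>u\<in>X. W u) = C * p\<^sup>2 * (\<Sum>u\<in>X. wt u)" by (simp add: W_def sum_distrib_left)
    also have "27 * p ^ 3 + C * p\<^sup>2 * (\<Sum>u\<in>B1. wt u) + C * p\<^sup>2 * (\<Sum>u\<in>B2. wt u) + real (card B3) * c + real (card B4) * c
        + 6 * \<tau> * (C * p\<^sup>2 * (\<Sum>u\<in>X. wt u))
      \<le> 27 * (p ^ 3 * sqrt p) + C * p\<^sup>2 * (72 * \<kappa> * p\<^sup>2 + 36 * p * (sqrt 2 * sqrt p))
        + C * p\<^sup>2 * (144 * p\<^sup>2 / (K + 1) + 36 * p * (sqrt 2 * sqrt p))
        + (360 * p ^ 3 / (D + 1)) * c + (25 * real (card S) * p\<^sup>2) * c + 6 * \<tau> * (C * p\<^sup>2 * (200 * p\<^sup>2))"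
      using sum1 sum2 card3 card4 sumwt r1 c0 C \<tau>
      by (intro add_mono mult_left_mono mult_right_mono) auto
    also have "\<dots> \<le> 27 * (p ^ 3 * sqrt p) + C * p\<^sup>2 * (72 * \<kappa> * p\<^sup>2 + 36 * p * (sqrt 2 * sqrt p))
        + C * p\<^sup>2 * (144 * p\<^sup>2 / (K + 1) + 36 * p * (sqrt 2 * sqrt p))
        + (360 * p ^ 3 / (D + 1)) * c + (25 * C * card S * K / \<kappa>) * (p ^ 3 * sqrt p) + 6 * \<tau> * (C * p\<^sup>2 * (200 * p\<^sup>2))"
    proof -
      have "(25 * real (card S) * p\<^sup>2) * c = (25 * C * card S * K / \<kappa>) * p ^ 3"
        using p \<kappa> by (simp add: c_def power2_eq_square power3_eq_cube field_simps)
      also have "\<dots> \<le> (25 * C * card S * K / \<kappa>) * (p ^ 3 * sqrt p)"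
        using C K1 \<kappa> by (intro mult_left_mono r1) auto
      finally show ?thesis by simp
    qed
    also have "\<dots> = M * (p ^ 3 * sqrt p) + (72 * C * \<kappa> + 144 * C / (K + 1) + 360 * C * K / (\<kappa> * (D + 1)) + 1200 * C * \<tau>) * p ^ 4"
    proof -
      have c': "c = C * K * p / \<kappa>" using p \<kappa> by (simp add: c_def power2_eq_square field_simps)
      have pow: "p\<^sup>2 = p * p" "p ^ 3 = p * p * p" "p ^ 4 = p * p * p * p"
        by (simp_all add: power2_eq_square power3_eq_cube power4_eq_xxxx)
      define r where "r = p ^ 3 * sqrt p"
      have e: "C * p\<^sup>2 * (x * p\<^sup>2 + 36 * p * (sqrt 2 * sqrt p)) = (C * x) * p ^ 4 + (C * 36 * sqrt 2) * r" for x
        by (simp add: pow r_def algebra_simps)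
      have e2: "(360 * p ^ 3 / (D + 1)) * c = 360 * C * K / (\<kappa> * (D + 1)) * p ^ 4"
        by (simp add: c' pow mult_ac)
      have e3: "6 * \<tau> * (C * p\<^sup>2 * (200 * p\<^sup>2)) = (1200 * C * \<tau>) * p ^ 4"
        by (simp add: pow)
      have e4: "144 * p\<^sup>2 / (K + 1) = (144 / (K + 1)) * p\<^sup>2" by simp
      have e5: "C * (72 * \<kappa>) = 72 * C * \<kappa>" "C * (144 / (K + 1)) = 144 * C / (K + 1)" by simp_all
      have e6: "M * r = 27 * r + 2 * (C * 36 * sqrt 2 * r) + (25 * C * card S * K / \<kappa>) * r"
        by (simp add: M_def algebra_simps)
      show ?thesis unfolding e2 e3 e4 unfolding e e5 unfolding r_def[symmetric] e6 by (simp only: distrib_right)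
    qed
    also have "\<dots> \<le> (\<epsilon> / 5) * p ^ 4 + (\<epsilon> / 5 + \<epsilon> / 5 + \<epsilon> / 5 + \<epsilon> / 5) * p ^ 4"
    proof (intro add_mono mult_right_mono)
      have "(5 * M / \<epsilon>)\<^sup>2 \<le> p" using PP unfolding P0_def p_def by linarith
      then have "5 * M / \<epsilon> \<le> sqrt p" using M0 \<epsilon> by (intro real_le_rsqrt)
      then have "M \<le> (\<epsilon> / 5) * sqrt p" using \<epsilon> by (simp add: field_simps)
      then have "M * (p ^ 3 * sqrt p) \<le> (\<epsilon> / 5) * sqrt p * (p ^ 3 * sqrt p)"
        using p by (intro mult_right_mono) auto
      also have "\<dots> = (\<epsilon> / 5) * p ^ 3 * (sqrt p * sqrt p)" by (simp only: mult_ac)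
      also have "\<dots> = (\<epsilon> / 5) * p ^ 4" using p by (simp add: power3_eq_cube power4_eq_xxxx)
      finally show "M * (p ^ 3 * sqrt p) \<le> (\<epsilon> / 5) * p ^ 4" .
      show "72 * C * \<kappa> \<le> \<epsilon> / 5" using C by (simp add: \<kappa>_def)
      show "144 * C / (K + 1) \<le> \<epsilon> / 5" by (rule K2)
      show "360 * C * K / (\<kappa> * (D + 1)) \<le> \<epsilon> / 5" by (rule D2)
      show "1200 * C * \<tau> \<le> \<epsilon> / 5" using C by (simp add: \<tau>_def)
    qed (use p in auto)
    finally show "cor F P 0 - cor F P h \<le> \<epsilon> * (real_of_int P) ^ 4" by (simp add: p_def algebra_simps)
  qed
qed

end

section \<open>Representations in a window\<close>

definition repr :: "(int \<times> int \<times> int \<Rightarrow> int) \<Rightarrow> int \<Rightarrow> int \<Rightarrow> real" where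
  "repr F P n = (\<Sum>v\<in>vbox P. if F v = n then tent3 P v else 0)"

lemma repr_eq_0: "n \<notin> F ` vbox P \<Longrightarrow> repr F P n = 0"
  unfolding repr_def by (rule sum.neutral) auto

lemma sum_repr_eq_cor:
  assumes "finite N" "F ` vbox P \<subseteq> N"
  shows "(\<Sum>n\<in>N. repr F P n * repr F P (n + k)) = cor F P k"
proof -
  have "repr F P n * repr F P (n + k)
    = (\<Sum>w\<in>vbox P. \<Sum>v\<in>vbox P. if F w = n then (if F v - F w = k then tent3 P v * tent3 P w else 0) else 0)" for n
    unfolding repr_def sum_product by (intro sum.cong refl) auto
  then have "(\<Sum>n\<in>N. repr F P n * repr F P (n + k)) = (\<Sum>n\<in>N. \<Sum>w\<in>vbox P. \<Sum>v\<in>vbox P.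
      if F w = n then (if F v - F w = k then tent3 P v * tent3 P w else 0) else 0)"
    by simp
  also have "\<dots> = (\<Sum>w\<in>vbox P. \<Sum>n\<in>N. \<Sum>v\<in>vbox P.
      if F w = n then (if F v - F w = k then tent3 P v * tent3 P w else 0) else 0)"
    by (rule sum.swap)
  also have "\<dots> = (\<Sum>w\<in>vbox P. \<Sum>v\<in>vbox P. \<Sum>n\<in>N.
      if F w = n then (if F v - F w = k then tent3 P v * tent3 P w else 0) else 0)"
    by (intro sum.cong refl sum.swap)
  also have "\<dots> = (\<Sum>w\<in>vbox P. \<Sum>v\<in>vbox P. if F v - F w = k then tent3 P v * tent3 P w else 0)"
    using assms by (intro sum.cong refl) (auto simp: sum.delta')
  also have "\<dots> = cor F P k" unfolding cor_def by (rule sum.swap)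
  finally show ?thesis .
qed

lemma sum_repr_shift_le:
  assumes E: "finite E" "\<And>n. n \<in> E \<Longrightarrow> repr F P n = 0"
  shows "(\<Sum>n\<in>E. (repr F P (n + h))\<^sup>2) \<le> 2 * (cor F P 0 - cor F P h)"
proof -
  \<comment> \<open>\<open>N\<close> contains all values and their shifts by - h, so that both sums
    of squares over \<open>N\<close>, of R(n) and of R(n + h), are complete and equal the
    correlation at 0.\<close>
  define N where "N = F ` vbox P \<union> (\<lambda>x. x - h) ` F ` vbox P \<union> E"
  have fin: "finite N" using E by (simp add: N_def)
  have sub: "F ` vbox P \<subseteq> N" unfolding N_def by blast
  have s1: "(\<Sum>n\<in>N. (repr F P n)\<^sup>2) = cor F P 0"
    using sum_repr_eq_cor[OF fin sub, of 0] by (simp add: power2_eq_square)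
  have "(\<Sum>n\<in>N. (repr F P (n + h))\<^sup>2) = (\<Sum>m\<in>(\<lambda>n. n + h) ` N. (repr F P m)\<^sup>2)"
    by (subst sum.reindex) (auto simp: inj_on_def)
  also have "\<dots> = cor F P 0"
  proof -
    have "F ` vbox P \<subseteq> (\<lambda>n. n + h) ` N"
    proof
      fix t assume "t \<in> F ` vbox P"
      then have "t - h \<in> N" unfolding N_def by blast
      then show "t \<in> (\<lambda>n. n + h) ` N" by (intro image_eqI[of _ _ "t - h"]) auto
    qed
    then show ?thesis using sum_repr_eq_cor[of "(\<lambda>n. n + h) ` N" F P 0] fin by (simp add: power2_eq_square)
  qed
  finally have s2: "(\<Sum>n\<in>N. (repr F P (n + h))\<^sup>2) = cor F P 0" .
  have s3: "(\<Sum>n\<in>N. repr F P n * repr F P (n + h)) = cor F P h"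
    by (rule sum_repr_eq_cor[OF fin sub])
  have "(\<Sum>n\<in>E. (repr F P (n + h))\<^sup>2) = (\<Sum>n\<in>E. (repr F P (n + h) - repr F P n)\<^sup>2)"
    using E by (intro sum.cong) auto
  also have "\<dots> \<le> (\<Sum>n\<in>N. (repr F P (n + h) - repr F P n)\<^sup>2)"
    by (rule sum_mono2[OF fin]) (auto simp: N_def)
  also have "\<dots> = (\<Sum>n\<in>N. (repr F P (n + h))\<^sup>2 + (repr F P n)\<^sup>2 - 2 * (repr F P n * repr F P (n + h)))"
    by (intro sum.cong) (auto simp: power2_eq_square algebra_simps)
  also have "\<dots> = 2 * (cor F P 0 - cor F P h)"
    by (simp add: sum.distrib sum_subtractf sum_distrib_left[symmetric] s1 s2 s3)
  finally show ?thesis .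
qed

section \<open>Triangular numbers and the form modulo q\<close>

lemma two_triangular: "2 * triangular y = y * (y + 1)"
  unfolding triangular_def by simp

lemma triangular_add: "triangular (x + y) = triangular x + triangular y + x * y"
proof -
  have "2 * triangular (x + y) = 2 * (triangular x + triangular y + x * y)"
    unfolding distrib_left two_triangular by (simp add: algebra_simps)
  then show ?thesis by simp
qed

lemma triangular_nonneg: "triangular y \<ge> 0"
proof -
  have "y * (y + 1) \<ge> 0" by (cases "y \<ge> 0") (auto simp: zero_le_mult_iff)
  then show ?thesis using two_triangular[of y] by linarith
qed

lemma triangular_le_square: "y \<ge> 0 \<Longrightarrow> triangular y \<le> y\<^sup>2"
proof -
  assume "y \<ge> 0"
  then have "y = 0 \<or> y \<ge> 1" by auto
  then have "y * (y + 1) \<le> 2 * y\<^sup>2" by (auto simp: power2_eq_square algebra_simps)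
  then show ?thesis using two_triangular[of y] by linarith
qed

definition form :: "int \<Rightarrow> int \<Rightarrow> int \<Rightarrow> int \<times> int \<times> int \<Rightarrow> int" where
  "form a b c = (\<lambda>(x, y, z). a * x\<^sup>2 + b * triangular y + c * triangular z)"

lemma quad_form_triangular:
  assumes "a > 0" "b > 0" "c > 0"
  shows "quad_form (form a b c) (2 * a) b c"
  using assms by unfold_locales (auto simp: form_def triangular_add power2_eq_square algebra_simps)

text \<open>The coordinates run over residues modulo 2 q, since for even q triangular numbers modulo
  q have period 2 q and not q; the same range is taken for all three coordinates and all q.\<close>

definition sols :: "int \<Rightarrow> int \<Rightarrow> int \<Rightarrow> int \<Rightarrow> int \<Rightarrow> (int \<times> int \<times> int) set" where
  "sols a b c q n = {v \<in> {0..<2 * q} \<times> {0..<2 * q} \<times> {0..<2 * q}. q dvd form a b c v - n}"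

lemma finite_sols [simp]: "finite (sols a b c q n)"
  unfolding sols_def by simp

lemma triangular_mod: "q dvd triangular (y + 2 * q * k) - triangular y"
proof -
  have "2 * (triangular (y + 2 * q * k) - triangular y) = 2 * (q * (k * (2 * q * k + 1) + 2 * y * k))"
    unfolding right_diff_distrib two_triangular by (simp add: algebra_simps)
  then have "triangular (y + 2 * q * k) - triangular y = q * (k * (2 * q * k + 1) + 2 * y * k)" by simp
  then show ?thesis by simp
qed

lemma form_mod: "q dvd form a b c (x + 2 * q * i, y + 2 * q * j, z + 2 * q * k) - form a b c (x, y, z)"
proof -
  have "q dvd (x + 2 * q * i)\<^sup>2 - x\<^sup>2" by (simp add: power2_eq_square algebra_simps)
  then have "q dvd a * ((x + 2 * q * i)\<^sup>2 - x\<^sup>2) + b * (triangular (y + 2 * q * j) - triangular y)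
      + c * (triangular (z + 2 * q * k) - triangular z)"
    by (intro dvd_add dvd_mult triangular_mod)
  then show ?thesis by (simp add: form_def algebra_simps)
qed

text \<open>z is the least natural number with m \<le> c T_z; one exists because m \<le> c
  T_m.\<close>

lemma triangular_crossing:
  fixes c m :: int
  assumes c: "c > 0" and m: "m \<ge> 0"
  obtains z where "z \<ge> 0" "c * triangular (z - 1) \<le> m" "m \<le> c * triangular z" "(z - 1)\<^sup>2 \<le> 2 * m + 1"
proof -
  have "m \<le> c * triangular (int (nat m))"
  proof -
    have "m = 0 \<or> m \<ge> 1" using m by auto
    then have "2 * m \<le> m * (m + 1)" by (auto simp: algebra_simps)
    then have "m \<le> triangular m" using two_triangular[of m] by linarith
    also have "\<dots> \<le> c * triangular m" using c triangular_nonneg[of m] mult_right_mono[of 1 c "triangular m"] by simp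
    finally show ?thesis using m by simp
  qed
  define k where "k = (LEAST k. m \<le> c * triangular (int k))"
  have k1: "m \<le> c * triangular (int k)"
    unfolding k_def by (rule LeastI[of "\<lambda>k. m \<le> c * triangular (int k)", OF \<open>m \<le> c * triangular (int (nat m))\<close>])
  have k2: "c * triangular (int k - 1) \<le> m"
  proof (cases k)
    case 0
    then show ?thesis using m by (simp add: triangular_def)
  next
    case (Suc l)
    then have "\<not> m \<le> c * triangular (int l)" using not_less_Least[of l "\<lambda>k. m \<le> c * triangular (int k)"] unfolding k_def by auto
    then show ?thesis using Suc by simp
  qed
  \<comment> \<open>The + 1 is for k = 0, where (k - 1)^2 = 1 although m may be 0.\<close>
  have "(int k - 1)\<^sup>2 \<le> 2 * m + 1"
  proof (cases "k = 0")
    case True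
    then show ?thesis using m by simp
  next
    case False
    have "triangular (int k - 1) \<le> c * triangular (int k - 1)"
      using c triangular_nonneg[of "int k - 1"] mult_right_mono[of 1 c "triangular (int k - 1)"] by simp
    then have "(int k - 1) * int k \<le> 2 * m" using k2 two_triangular[of "int k - 1"] by simp
    moreover have "(int k - 1) * (int k - 1) \<le> (int k - 1) * int k" using False by (intro mult_left_mono) auto
    ultimately show ?thesis by (simp add: power2_eq_square)
  qed
  then show ?thesis using that[of "int k"] k1 k2 by simp
qed

lemma tent_ge_half: "P \<ge> 1 \<Longrightarrow> 0 \<le> x \<Longrightarrow> 2 * x \<le> P \<Longrightarrow> tent P x \<ge> 1 / 2"
  by (simp add: tent_def field_simps)


lemma triangular_diff_le:
  assumes "z \<ge> 0" "s \<ge> 0" "z + s \<ge> w" "w \<ge> 0"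
  shows "triangular w - triangular (z - 1) \<le> (s + 1) * (z + s)"
proof -
  have "w * (w + 1) \<le> (z + s) * (z + s + 1)" using assms by (intro mult_mono) auto
  then have "2 * (triangular w - triangular (z - 1)) \<le> (z + s) * (z + s + 1) - (z - 1) * z"
    unfolding right_diff_distrib two_triangular by simp
  also have "\<dots> = 2 * ((s + 1) * (z + s)) - s * (s + 1)" by (simp add: algebra_simps)
  also have "\<dots> \<le> 2 * ((s + 1) * (z + s))" using assms by simp
  finally show ?thesis by simp
qed

lemma sum_repr_eq_sum_tent:
  assumes H: "finite H"
  shows "(\<Sum>h\<in>H. repr F P (n + h)) = (\<Sum>v\<in>{v \<in> vbox P. F v - n \<in> H}. tent3 P v)"
proof -
  have "(\<Sum>h\<in>H. repr F P (n + h)) = (\<Sum>v\<in>vbox P. \<Sum>h\<in>H. if F v = n + h then tent3 P v else 0)"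
    unfolding repr_def by (rule sum.swap)
  also have "\<dots> = (\<Sum>v\<in>vbox P. if F v - n \<in> H then tent3 P v else 0)"
  proof (rule sum.cong[OF refl])
    fix v
    have "(\<Sum>h\<in>H. if F v = n + h then tent3 P v else 0) = (\<Sum>h\<in>H. if F v - n = h then tent3 P v else 0)"
      by (intro sum.cong) auto
    also have "\<dots> = (if F v - n \<in> H then tent3 P v else 0)" using H by (simp add: sum.delta')
    finally show "(\<Sum>h\<in>H. if F v = n + h then tent3 P v else 0) = (if F v - n \<in> H then tent3 P v else 0)" .
  qed
  also have "\<dots> = (\<Sum>v\<in>{v \<in> vbox P. F v - n \<in> H}. tent3 P v)"
    by (simp add: sum.If_cases Int_def)
  finally show ?thesis .
qed

text \<open>The solutions counted here are \<open>v0 + 2 q (i, j, k)\<close> with \<open>v0\<close> a solution modulo \<open>q\<close>,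
  with \<open>i, j\<close> small, and with \<open>k\<close> in an interval that starts where the form crosses \<open>n\<close>.\<close>

lemma card_near_solutions_ge:
  fixes a b c q n X L B :: int
  assumes pos: "a > 0" "b > 0" "c > 0" and q: "q \<ge> 1" and X: "X \<ge> 0" and L: "L \<ge> 0" and n: "n \<ge> 0"
    and small: "(a + b) * (2 * q * X)\<^sup>2 \<le> n"
    and B: "B \<ge> 1" "2 * n + 1 \<le> B\<^sup>2" "B + 1 + (4 * q + 2 * q * L) \<le> 2 * B"
    and H: "c * ((4 * q + 2 * q * L + 1) * (2 * B)) \<le> H"
  shows "card (sols a b c q n) * (nat X * (nat X * nat L)) \<le>
    card {v. v \<in> {0..2 * q * X} \<times> {0..2 * q * X} \<times> {0..2 * B} \<and> q dvd form a b c v - n \<and> 0 \<le> form a b c v - n \<and> form a b c v - n \<le> H}"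
    (is "_ \<le> card ?V")
proof -
  define m where "m x y = n - a * x\<^sup>2 - b * triangular y" for x y :: int
  have m0: "m x y \<ge> 0" if "0 \<le> x" "x \<le> 2 * q * X" "0 \<le> y" "y \<le> 2 * q * X" for x y
  proof -
    have "x\<^sup>2 \<le> (2 * q * X)\<^sup>2" "y\<^sup>2 \<le> (2 * q * X)\<^sup>2" using that by (auto intro: power_mono)
    then have "a * x\<^sup>2 + b * triangular y \<le> a * (2 * q * X)\<^sup>2 + b * (2 * q * X)\<^sup>2"
      using pos triangular_le_square[of y] that by (intro add_mono mult_left_mono) auto
    then show ?thesis using small by (simp add: m_def algebra_simps)
  qed
  have "\<exists>z. z \<ge> 0 \<and> c * triangular (z - 1) \<le> m x y \<and> m x y \<le> c * triangular z \<and> (z - 1)\<^sup>2 \<le> 2 * m x y + 1"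
    if "m x y \<ge> 0" for x y
    using triangular_crossing[OF pos(3) that] by metis
  then obtain Z where Z: "\<And>x y. m x y \<ge> 0 \<Longrightarrow> Z x y \<ge> 0 \<and> c * triangular (Z x y - 1) \<le> m x y
      \<and> m x y \<le> c * triangular (Z x y) \<and> (Z x y - 1)\<^sup>2 \<le> 2 * m x y + 1" by metis
  \<comment> \<open>Rounding up past the crossing: 2 q k lies between Z and Z + 2 q, so every z0 + 2
    q (k + l) with z0, l \<ge> 0 has reached the value m.\<close>
  define k where "k x y = Z x y div (2 * q) + 1" for x y
  define \<phi> where "\<phi> = (\<lambda>((x0, y0, z0), i, j, l). (x0 + 2 * q * i, y0 + 2 * q * j,
     z0 + 2 * q * (k (x0 + 2 * q * i) (y0 + 2 * q * j) + l)))"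
  define D where "D = sols a b c q n \<times> {0..<X} \<times> {0..<X} \<times> {0..<L}"
  have q0: "q > 0" using q by simp
  have "inj_on \<phi> D"
  proof (rule inj_onI)
    fix s t assume st: "s \<in> D" "t \<in> D" and e: "\<phi> s = \<phi> t"
    obtain x0 y0 z0 i j l where s: "s = ((x0, y0, z0), i, j, l)" by (metis prod.collapse)
    obtain x0' y0' z0' i' j' l' where t: "t = ((x0', y0', z0'), i', j', l')" by (metis prod.collapse)
    have r: "x0 \<in> {0..<2*q}" "y0 \<in> {0..<2*q}" "z0 \<in> {0..<2*q}" "x0' \<in> {0..<2*q}" "y0' \<in> {0..<2*q}" "z0' \<in> {0..<2*q}"
      using st by (auto simp: s t D_def sols_def)
    have uniq: "u = u' \<and> v = v'" if "u + 2 * q * v = u' + 2 * q * v'" "u \<in> {0..<2*q}" "u' \<in> {0..<2*q}" for u u' v v'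
    proof -
      have "u = (u + 2 * q * v) mod (2 * q)" "u' = (u' + 2 * q * v') mod (2 * q)" using that(2,3) q0 by simp_all
      then have "u = u'" using that(1) by simp
      then show ?thesis using that(1) q0 by simp
    qed
    have ex: "x0 + 2 * q * i = x0' + 2 * q * i'" and ey: "y0 + 2 * q * j = y0' + 2 * q * j'"
      and ez: "z0 + 2 * q * (k (x0 + 2 * q * i) (y0 + 2 * q * j) + l) = z0' + 2 * q * (k (x0' + 2 * q * i') (y0' + 2 * q * j') + l')"
      using e unfolding \<phi>_def s t prod.case prod.inject by blast+
    have 1: "x0 = x0' \<and> i = i'" "y0 = y0' \<and> j = j'" using uniq ex ey r by blast+
    have "z0 = z0' \<and> k (x0 + 2 * q * i) (y0 + 2 * q * j) + l = k (x0' + 2 * q * i') (y0' + 2 * q * j') + l'"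
      using uniq ez r by blast
    \<comment> \<open>\<open>k\<close> depends on x and y only, and these already agree, so the last
      equation gives l = l'.\<close>
    then show "s = t" using 1 by (simp add: s t)
  qed
  moreover have "\<phi> ` D \<subseteq> ?V"
  proof (rule image_subsetI)
    fix s assume sD: "s \<in> D"
    obtain x0 y0 z0 i j l where s: "s = ((x0, y0, z0), i, j, l)" by (metis prod.collapse)
    have r: "x0 \<in> {0..<2*q}" "y0 \<in> {0..<2*q}" "z0 \<in> {0..<2*q}" "i \<in> {0..<X}" "j \<in> {0..<X}" "l \<in> {0..<L}"
      and sol: "q dvd form a b c (x0, y0, z0) - n"
      using sD by (auto simp: s D_def sols_def)
    define x y where "x = x0 + 2 * q * i" and "y = y0 + 2 * q * j"
    define z where "z = z0 + 2 * q * (k x y + l)"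
    have step: "0 \<le> u + 2 * q * v \<and> u + 2 * q * v \<le> 2 * q * w" if "u \<in> {0..<2*q}" "v \<in> {0..<w}" for u v w
    proof -
      have "2 * q * (v + 1) \<le> 2 * q * w" using that q0 by (intro mult_left_mono) auto
      then show ?thesis using that q0 by (auto simp: distrib_left)
    qed
    have xy: "0 \<le> x" "x \<le> 2 * q * X" "0 \<le> y" "y \<le> 2 * q * X" using step r unfolding x_def y_def by blast+
    note mxy = m0[OF xy]
    note Zxy = Z[OF mxy]
    have kb: "Z x y \<le> 2 * q * k x y" "2 * q * k x y \<le> Z x y + 2 * q"
    proof -
      have "Z x y = 2 * q * (Z x y div (2 * q)) + Z x y mod (2 * q)" by simp
      moreover have "0 \<le> Z x y mod (2 * q)" "Z x y mod (2 * q) < 2 * q" using q0 by simp_all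
      ultimately show "Z x y \<le> 2 * q * k x y" "2 * q * k x y \<le> Z x y + 2 * q"
        unfolding k_def distrib_left by linarith+
    qed
    have zl: "0 \<le> z0 + 2 * q * l" "z0 + 2 * q * l \<le> 2 * q * L" using step r by blast+
    have zeq: "z = 2 * q * k x y + (z0 + 2 * q * l)" by (simp add: z_def algebra_simps)
    define w where "w = 4 * q + 2 * q * L"
    have z1: "Z x y \<le> z" "z \<le> Z x y + w" using kb zl zeq q0 by (simp_all add: w_def)
    have z0: "0 \<le> z" using z1 Zxy by simp
    have "(Z x y - 1)\<^sup>2 \<le> B\<^sup>2"
    proof -
      have "0 \<le> a * x\<^sup>2" "0 \<le> b * triangular y" using pos triangular_nonneg[of y] by simp_all
      then have "m x y \<le> n" by (simp add: m_def)
      then show ?thesis using Zxy B by linarith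
    qed
    then have ZB: "Z x y \<le> B + 1" using B(1) abs_le_square_iff[of "Z x y - 1" B] by simp
    have zB: "z \<le> 2 * B" "Z x y + w \<le> 2 * B" using z1 ZB B(3) by (simp_all add: w_def)
    have "triangular (Z x y) \<le> triangular z"
    proof -
      have "Z x y * (Z x y + 1) \<le> z * (z + 1)" using z1 Zxy by (intro mult_mono) auto
      then show ?thesis using two_triangular[of z] two_triangular[of "Z x y"] by linarith
    qed
    then have "c * triangular (Z x y) \<le> c * triangular z" using pos by (intro mult_left_mono) auto
    then have lo: "m x y \<le> c * triangular z" using Zxy by linarith
    have "triangular z - triangular (Z x y - 1) \<le> (w + 1) * (Z x y + w)"
      using Zxy z1 z0 q0 L by (intro triangular_diff_le) (auto simp: w_def)
    also have "\<dots> \<le> (w + 1) * (2 * B)" using zB q0 L by (intro mult_left_mono) (auto simp: w_def)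
    finally have "c * (triangular z - triangular (Z x y - 1)) \<le> c * ((w + 1) * (2 * B))"
      using pos by (intro mult_left_mono) auto
    then have hi: "c * triangular z \<le> m x y + H" using Zxy H by (simp add: w_def right_diff_distrib)
    have "q dvd form a b c (x, y, z) - form a b c (x0, y0, z0)"
      unfolding x_def y_def z_def by (rule form_mod)
    then have "q dvd form a b c (x, y, z) - form a b c (x0, y0, z0) + (form a b c (x0, y0, z0) - n)"
      using sol by (rule dvd_add)
    then have "q dvd form a b c (x, y, z) - n" by simp
    moreover have "form a b c (x, y, z) - n = c * triangular z - m x y" by (simp add: form_def m_def)
    moreover have "\<phi> s = (x, y, z)" by (simp add: \<phi>_def s x_def y_def z_def)
    ultimately show "\<phi> s \<in> ?V" using xy z0 zB lo hi by auto
  qed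
  moreover have "finite ?V"
    by (rule finite_subset[of _ "{0..2 * q * X} \<times> {0..2 * q * X} \<times> {0..2 * B}"]) auto
  ultimately have "card D \<le> card ?V" by (rule card_inj_on_le)
  then show ?thesis by (simp add: D_def card_cartesian_product)
qed

section \<open>Solutions modulo odd prime powers\<close>

definition cube :: "int \<Rightarrow> (int \<times> int \<times> int) set" where
  "cube m = {0..<m} \<times> {0..<m} \<times> {0..<m}"

lemma finite_cube [simp]: "finite (cube m)"
  by (simp add: cube_def)

lemma mem_cube: "(x, y, z) \<in> cube m \<longleftrightarrow> x \<in> {0..<m} \<and> y \<in> {0..<m} \<and> z \<in> {0..<m}"
  by (simp add: cube_def)

lemma card_cube: "card (cube m) = nat m ^ 3"
  by (simp add: cube_def card_cartesian_product power3_eq_cube)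

text \<open>For odd moduli the form becomes diagonal: multiplying by 8 and completing squares gives
  the coefficients 8 a, b, c, see \<open>form_diag\<close>.\<close>

definition diag :: "int \<Rightarrow> int \<Rightarrow> int \<Rightarrow> int \<times> int \<times> int \<Rightarrow> int" where
  "diag A B C = (\<lambda>(x, y, z). A * x\<^sup>2 + B * y\<^sup>2 + C * z\<^sup>2)"

definition dsols :: "int \<Rightarrow> int \<Rightarrow> int \<Rightarrow> int \<Rightarrow> int \<Rightarrow> (int \<times> int \<times> int) set" where
  "dsols A B C m t = {v \<in> cube m. m dvd diag A B C v - t}"

text \<open>The gradient of the diagonal form does not vanish modulo \<open>p\<close>; its factor 2
  is omitted, as \<open>p\<close> is odd wherever this is applied.\<close>

definition nonsing :: "int \<Rightarrow> int \<Rightarrow> int \<Rightarrow> int \<Rightarrow> int \<times> int \<times> int \<Rightarrow> bool" where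
  "nonsing p A B C = (\<lambda>(x, y, z). \<not> (p dvd A * x \<and> p dvd B * y \<and> p dvd C * z))"

lemma finite_dsols [simp]: "finite (dsols A B C m t)"
  by (simp add: dsols_def)

lemma eq_if_dvd_diff:
  fixes x y m :: int
  assumes "x \<in> {0..<m}" "y \<in> {0..<m}" "m dvd x - y"
  shows "x = y"
  using assms by (metis atLeastLessThan_iff mod_eq_dvd_iff mod_pos_pos_trivial)

lemma not_dvd_2: "prime (p::int) \<Longrightarrow> p > 2 \<Longrightarrow> \<not> p dvd 2"
  by (auto dest: zdvd_imp_le)

lemma not_dvd_if_in_residues: "r \<in> {0..<p} \<Longrightarrow> r \<noteq> 0 \<Longrightarrow> \<not> (p::int) dvd r"
  by (auto dest: zdvd_imp_le)

lemma card_linear_pivot: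
  fixes p e B1 B2 B3 :: int
  assumes p: "prime p" and B: "\<not> p dvd B3"
  shows "card {(x, y, z) \<in> cube p. p dvd e + B1 * x + B2 * y + B3 * z} = nat p ^ 2"
proof -
  let ?S = "{(x, y, z) \<in> cube p. p dvd e + B1 * x + B2 * y + B3 * z}"
  have p0: "p > 0" using p prime_gt_0_int by blast
  have cop: "coprime B3 p" using prime_imp_coprime[OF p B] by (simp add: coprime_commute)
  have "bij_betw (\<lambda>(x, y, z). (x, y)) ?S ({0..<p} \<times> {0..<p})"
  proof (rule bij_betwI')
    fix v w assume vw: "v \<in> ?S" "w \<in> ?S"
    obtain x y z where v: "v = (x, y, z)" by (cases v)
    obtain x' y' z' where w: "w = (x', y', z')" by (cases w)
    show "((\<lambda>(x, y, z). (x, y)) v = (\<lambda>(x, y, z). (x, y)) w) = (v = w)"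
    proof
      assume "(\<lambda>(x, y, z). (x, y)) v = (\<lambda>(x, y, z). (x, y)) w"
      then have xy: "x = x'" "y = y'" by (simp_all add: v w)
      have "p dvd (e + B1 * x + B2 * y + B3 * z) - (e + B1 * x + B2 * y + B3 * z')"
        using vw xy unfolding v w by (intro dvd_diff) auto
      then have "p dvd B3 * (z - z')" by (simp add: algebra_simps)
      then have "p dvd z - z'" using p B prime_dvd_mult_iff by blast
      then have "z = z'" using vw by (intro eq_if_dvd_diff[of _ p]) (auto simp: v w mem_cube)
      then show "v = w" using xy by (simp add: v w)
    qed simp
  next
    fix v assume "v \<in> ?S"
    then show "(\<lambda>(x, y, z). (x, y)) v \<in> {0..<p} \<times> {0..<p}" by (auto simp: mem_cube)
  next
    fix u assume "u \<in> {0..<p} \<times> {0..<p}"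
    then obtain x y where u: "u = (x, y)" "x \<in> {0..<p}" "y \<in> {0..<p}" by blast
    obtain z where z: "[B3 * z = - (e + B1 * x + B2 * y)] (mod p)"
      using cong_solve_coprime_int[OF cop] cong_scalar_right[of "B3 * _" 1 p "- (e + B1 * x + B2 * y)"]
      by (metis mult.assoc mult_1)
    have "p dvd B3 * z - (- (e + B1 * x + B2 * y))" using z by (simp add: cong_iff_dvd_diff)
    moreover have "p dvd B3 * (z mod p) - B3 * z" 
      by (metis dvd_minus_iff dvd_triv_left minus_diff_eq minus_mod_eq_mult_div mult.left_commute right_diff_distrib)
    ultimately have "p dvd (B3 * (z mod p) - B3 * z) + (B3 * z - (- (e + B1 * x + B2 * y)))" by (simp only: dvd_add)
    then have "p dvd e + B1 * x + B2 * y + B3 * (z mod p)" by (simp add: algebra_simps)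
    then have "(x, y, z mod p) \<in> ?S" using u p0 by (simp add: mem_cube)
    then show "\<exists>v\<in>?S. u = (\<lambda>(x, y, z). (x, y)) v" using u(1) by force
  qed
  then have "card ?S = card ({0..<p} \<times> {0..<p})" by (rule bij_betw_same_card)
  then show ?thesis by (simp add: card_cartesian_product power2_eq_square)
qed

lemma card_linear:
  fixes p e B1 B2 B3 :: int
  assumes p: "prime p" and B: "\<not> (p dvd B1 \<and> p dvd B2 \<and> p dvd B3)"
  shows "card {(x, y, z) \<in> cube p. p dvd e + B1 * x + B2 * y + B3 * z} = nat p ^ 2"
proof -
  consider "\<not> p dvd B1" | "\<not> p dvd B2" | "\<not> p dvd B3" using B by blast
  then show ?thesis
  proof cases
    case 1
    have "card {(x, y, z) \<in> cube p. p dvd e + B1 * x + B2 * y + B3 * z} = card {(x, y, z) \<in> cube p. p dvd e + B3 * x + B2 * y + B1 * z}"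
      by (rule bij_betw_same_card[of "\<lambda>(x, y, z). (z, y, x)"],
          rule bij_betw_byWitness[where f' = "\<lambda>(x, y, z). (z, y, x)"]) (auto simp: mem_cube algebra_simps)
    then show ?thesis using card_linear_pivot[OF p 1] by simp
  next
    case 2
    have "card {(x, y, z) \<in> cube p. p dvd e + B1 * x + B2 * y + B3 * z} = card {(x, y, z) \<in> cube p. p dvd e + B1 * x + B3 * y + B2 * z}"
      by (rule bij_betw_same_card[of "\<lambda>(x, y, z). (x, z, y)"],
          rule bij_betw_byWitness[where f' = "\<lambda>(x, y, z). (x, z, y)"]) (auto simp: mem_cube algebra_simps)
    then show ?thesis using card_linear_pivot[OF p 2] by simp
  qed (rule card_linear_pivot[OF p])
qed

lemma diag_add: "diag A B C (x + u, y + v, z + w)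
    = diag A B C (x, y, z) + diag A B C (u, v, w) + 2 * (A * u * x + B * v * y + C * w * z)"
  by (simp add: diag_def power2_eq_square algebra_simps)

lemma diag_add_mult: "diag A B C (x + m * u, y + m * v, z + m * w)
    = diag A B C (x, y, z) + m * (2 * (A * x * u + B * y * v + C * z * w)) + m * m * diag A B C (u, v, w)"
  by (simp add: diag_def power2_eq_square algebra_simps)

lemma dvd_diag_add_mult: "m dvd diag A B C (x + m * u, y + m * v, z + m * w) - diag A B C (x, y, z)"
  unfolding diag_add_mult by simp

lemma dvd_diag_mod: "m dvd diag A B C (x mod m, y mod m, z mod m) - diag A B C (x, y, z)"
proof -
  have "x mod m = x + m * (- (x div m))" for x by (simp add: minus_mult_div_eq_mod[symmetric])
  then show ?thesis using dvd_diag_add_mult[of m A B C x "- (x div m)" y "- (y div m)" z "- (z div m)"] by metis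
qed

text \<open>Hensel lifting. If v is a solution modulo m = p^k, then passing to v + m w changes the
  value by m times a linear form in w plus a multiple of m^2, and p divides m. So the condition
  modulo m p is a linear equation for w modulo p, whose coefficient vector is nonzero because v is
  nonsingular. It has p^2 solutions, and nonsingularity is inherited.\<close>

lemma card_nonsing_lift:
  fixes p A B C t :: int
  assumes p: "prime p" "p > 2" and k: "k \<ge> 1"
  shows "nat p ^ 2 * card {v \<in> dsols A B C (p ^ k) t. nonsing p A B C v}
    \<le> card {v \<in> dsols A B C (p ^ Suc k) t. nonsing p A B C v}"
proof -
  define m where "m = p ^ k"
  let ?S = "{v \<in> dsols A B C m t. nonsing p A B C v}"
  let ?T = "{v \<in> dsols A B C (m * p) t. nonsing p A B C v}"
  have p0: "p > 0" using p by simp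
  have m0: "m > 0" using p0 by (simp add: m_def)
  have pm: "p dvd m" using k by (simp add: m_def)
  define I where "I = (\<lambda>(x, y, z). {(u, v, w) \<in> cube p. m * p dvd diag A B C (x + m * u, y + m * v, z + m * w) - t})"
  have finI: "finite (I v)" for v
    unfolding I_def by (cases v) (auto intro!: finite_subset[OF _ finite_cube[of p]])
  have cI: "card (I v) = nat p ^ 2" if v: "v \<in> ?S" for v
  proof -
    obtain x y z where vv: "v = (x, y, z)" by (cases v)
    obtain e where e: "diag A B C (x, y, z) - t = m * e" using v by (auto simp: vv dsols_def)
    have "m * p dvd diag A B C (x + m * u, y + m * v, z + m * w) - t \<longleftrightarrow>
      p dvd e + (2 * A * x) * u + (2 * B * y) * v + (2 * C * z) * w" for u v w
    proof -
      have "diag A B C (x + m * u, y + m * v, z + m * w) - t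
        = m * (e + (2 * A * x) * u + (2 * B * y) * v + (2 * C * z) * w + m * diag A B C (u, v, w))"
        using e unfolding diag_add_mult by (simp add: algebra_simps)
      then have "m * p dvd diag A B C (x + m * u, y + m * v, z + m * w) - t \<longleftrightarrow>
         p dvd e + (2 * A * x) * u + (2 * B * y) * v + (2 * C * z) * w + m * diag A B C (u, v, w)"
        using m0 by simp
      also have "\<dots> \<longleftrightarrow> p dvd e + (2 * A * x) * u + (2 * B * y) * v + (2 * C * z) * w"
        using pm by (simp add: dvd_add_left_iff)
      finally show ?thesis .
    qed
    then have "I v = {(u, v, w) \<in> cube p. p dvd e + (2 * A * x) * u + (2 * B * y) * v + (2 * C * z) * w}"
      by (simp add: I_def vv)
    moreover note not_dvd_2[OF p]
    then have "p dvd 2 * A * x \<longleftrightarrow> p dvd A * x" "p dvd 2 * B * y \<longleftrightarrow> p dvd B * y" "p dvd 2 * C * z \<longleftrightarrow> p dvd C * z"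
      using p(1) by (simp_all add: prime_dvd_mult_iff)
    moreover have "nonsing p A B C (x, y, z)" using v by (simp add: vv)
    ultimately show ?thesis using card_linear[OF p(1), of "2 * A * x" "2 * B * y" "2 * C * z" e]
      by (simp add: nonsing_def)
  qed
  define \<phi> where "\<phi> = (\<lambda>((x, y, z), (u, v, w)). (x + m * u, y + m * v, z + m * w))"
  have uniq: "x = x' \<and> u = u'" if "x + m * u = x' + m * u'" "x \<in> {0..<m}" "x' \<in> {0..<m}" for x x' u u'
  proof -
    have "m dvd x - x'"
    proof -
      have "x - x' = m * (u' - u)" using that(1) by (simp add: algebra_simps)
      then show ?thesis by simp
    qed
    then have "x = x'" using that by (intro eq_if_dvd_diff)
    then show ?thesis using that(1) m0 by simp
  qed
  have "inj_on \<phi> (Sigma ?S I)"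
  proof (rule inj_onI)
    fix s s' assume s: "s \<in> Sigma ?S I" "s' \<in> Sigma ?S I" and e: "\<phi> s = \<phi> s'"
    obtain x y z u v w where ss: "s = ((x, y, z), (u, v, w))" by (metis prod.collapse)
    obtain x' y' z' u' v' w' where ss': "s' = ((x', y', z'), (u', v', w'))" by (metis prod.collapse)
    have r: "x \<in> {0..<m}" "y \<in> {0..<m}" "z \<in> {0..<m}" "x' \<in> {0..<m}" "y' \<in> {0..<m}" "z' \<in> {0..<m}"
      using s by (auto simp: ss ss' dsols_def mem_cube)
    have "x + m * u = x' + m * u'" "y + m * v = y' + m * v'" "z + m * w = z' + m * w'"
      using e by (simp_all add: \<phi>_def ss ss')
    then have "x = x' \<and> u = u'" "y = y' \<and> v = v'" "z = z' \<and> w = w'" using uniq r by metis+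
    then show "s = s'" by (simp add: ss ss')
  qed
  moreover have "\<phi> ` Sigma ?S I \<subseteq> ?T"
  proof (rule image_subsetI)
    fix s assume s: "s \<in> Sigma ?S I"
    obtain x y z u v w where ss: "s = ((x, y, z), (u, v, w))" by (metis prod.collapse)
    have r: "x \<in> {0..<m}" "y \<in> {0..<m}" "z \<in> {0..<m}" "u \<in> {0..<p}" "v \<in> {0..<p}" "w \<in> {0..<p}"
      and ns: "nonsing p A B C (x, y, z)" and dv: "m * p dvd diag A B C (x + m * u, y + m * v, z + m * w) - t"
      using s by (auto simp: ss dsols_def I_def mem_cube)
    have rng: "x + m * u \<in> {0..<m * p}" if "x \<in> {0..<m}" "u \<in> {0..<p}" for x u
    proof -
      have "m * (u + 1) \<le> m * p" using that m0 by (intro mult_left_mono) auto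
      then show ?thesis using that m0 by (auto simp: distrib_left)
    qed
    have "p dvd D * (x + m * u) \<longleftrightarrow> p dvd D * x" for D x u
      using pm by (simp add: distrib_left dvd_add_left_iff)
    then have "nonsing p A B C (x + m * u, y + m * v, z + m * w)" using ns by (simp add: nonsing_def)
    then show "\<phi> s \<in> ?T" using rng r dv by (simp add: \<phi>_def ss dsols_def mem_cube)
  qed
  moreover have "finite ?T" by simp
  ultimately have "card (Sigma ?S I) \<le> card ?T" by (rule card_inj_on_le)
  moreover have "card (Sigma ?S I) = (\<Sum>v\<in>?S. card (I v))" using finI by simp
  moreover have "(\<Sum>v\<in>?S. card (I v)) = (\<Sum>v\<in>?S. nat p ^ 2)" by (rule sum.cong[OF refl]) (rule cI)
  ultimately show ?thesis by (simp add: m_def mult.commute)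
qed

lemma card_dsols_prime_power_ge:
  fixes p A B C t :: int
  assumes p: "prime p" "p > 2"
  shows "(nat p ^ 2) ^ k * card {v \<in> dsols A B C p t. nonsing p A B C v} \<le> card (dsols A B C (p ^ Suc k) t)"
proof -
  have "(nat p ^ 2) ^ k * card {v \<in> dsols A B C p t. nonsing p A B C v}
     \<le> card {v \<in> dsols A B C (p ^ Suc k) t. nonsing p A B C v}"
  proof (induction k)
    case (Suc k)
    have "(nat p ^ 2) ^ Suc k * card {v \<in> dsols A B C p t. nonsing p A B C v}
      \<le> nat p ^ 2 * card {v \<in> dsols A B C (p ^ Suc k) t. nonsing p A B C v}"
      using mult_left_mono[OF Suc.IH, of "nat p ^ 2"] by (simp add: mult.assoc)
    also have "\<dots> \<le> card {v \<in> dsols A B C (p ^ Suc (Suc k)) t. nonsing p A B C v}"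
      by (rule card_nonsing_lift[OF p]) simp
    finally show ?case .
  qed simp
  also have "\<dots> \<le> card (dsols A B C (p ^ Suc k) t)" by (rule card_mono) auto
  finally show ?thesis .
qed

text \<open>The sum counts pairs (v, w) with equal values modulo p. For fixed u = v - w the
  condition is linear in w, with p^2 solutions if u is nonzero; this gives at most p^3 p^2 pairs,
  and u = 0 adds at most p^3.\<close>

lemma sum_card_dsols_sq_le:
  fixes p A B C :: int
  assumes p: "prime p" "p > 2" and u: "\<not> p dvd A" "\<not> p dvd B" "\<not> p dvd C"
  shows "(\<Sum>t\<in>{0..<p}. card (dsols A B C p t) ^ 2) \<le> nat p ^ 5 + nat p ^ 3"
proof -
  let ?G = "diag A B C"
  have p0: "p > 0" using p by simp
  define Pr where "Pr = {(v, w) \<in> cube p \<times> cube p. p dvd ?G v - ?G w}"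
  define L where "L = (\<lambda>(u1, u2, u3). {w \<in> cube p. p dvd ?G (w + (u1, u2, u3)) - ?G w})"
  have "(\<Sum>t\<in>{0..<p}. card (dsols A B C p t) ^ 2) = card (Sigma {0..<p} (\<lambda>t. dsols A B C p t \<times> dsols A B C p t))"
    by (subst card_SigmaI) (auto simp: card_cartesian_product power2_eq_square)
  also have "\<dots> \<le> card Pr"
  proof (rule card_inj_on_le[of snd])
    show "inj_on snd (Sigma {0..<p} (\<lambda>t. dsols A B C p t \<times> dsols A B C p t))"
    proof (rule inj_onI)
      fix s s' assume s: "s \<in> Sigma {0..<p} (\<lambda>t. dsols A B C p t \<times> dsols A B C p t)"
        "s' \<in> Sigma {0..<p} (\<lambda>t. dsols A B C p t \<times> dsols A B C p t)" and e: "snd s = snd s'"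
      have "p dvd ?G (fst (snd s)) - fst s" "p dvd ?G (fst (snd s)) - fst s'"
        using s e by (auto simp: dsols_def)
      then have "p dvd (?G (fst (snd s)) - fst s) - (?G (fst (snd s)) - fst s')" by (rule dvd_diff)
      then have "p dvd fst s' - fst s" by simp
      then have "fst s' = fst s" using s by (intro eq_if_dvd_diff[of _ p]) auto
      then show "s = s'" using e by (simp add: prod_eq_iff)
    qed
    show "snd ` Sigma {0..<p} (\<lambda>t. dsols A B C p t \<times> dsols A B C p t) \<subseteq> Pr"
    proof (rule image_subsetI)
      fix s assume s: "s \<in> Sigma {0..<p} (\<lambda>t. dsols A B C p t \<times> dsols A B C p t)"
      obtain t v w where ss: "s = (t, v, w)" by (metis prod.collapse)
      have "p dvd ?G v - t" "p dvd ?G w - t" using s by (auto simp: ss dsols_def)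
      then have "p dvd (?G v - t) - (?G w - t)" by (rule dvd_diff)
      then show "snd s \<in> Pr" using s by (auto simp: ss Pr_def dsols_def)
    qed
    show "finite Pr" unfolding Pr_def by (rule finite_subset[of _ "cube p \<times> cube p"]) auto
  qed
  also have "\<dots> \<le> card (Sigma (cube p) L)"
  proof (rule card_inj_on_le)
    let ?f = "\<lambda>((x, y, z), (x', y', z')). (((x - x') mod p, (y - y') mod p, (z - z') mod p), (x', y', z'))"
    show "inj_on ?f Pr"
    proof (rule inj_onI)
      fix s s' assume s: "s \<in> Pr" "s' \<in> Pr" and e: "?f s = ?f s'"
      obtain x y z x' y' z' where ss: "s = ((x, y, z), (x', y', z'))" by (metis prod.collapse)
      obtain r1 r2 r3 r1' r2' r3' where ss': "s' = ((r1, r2, r3), (r1', r2', r3'))" by (metis prod.collapse)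
      have e2: "x' = r1'" "y' = r2'" "z' = r3'" using e by (simp_all add: ss ss')
      have "(x - x') mod p = (r1 - x') mod p" "(y - y') mod p = (r2 - y') mod p" "(z - z') mod p = (r3 - z') mod p"
        using e unfolding ss ss' e2 prod.case prod.inject by blast+
      then have "p dvd (x - x') - (r1 - x')" "p dvd (y - y') - (r2 - y')" "p dvd (z - z') - (r3 - z')"
        by (simp_all only: mod_eq_dvd_iff)
      then have "p dvd x - r1" "p dvd y - r2" "p dvd z - r3" by simp_all
      moreover have "x \<in> {0..<p}" "y \<in> {0..<p}" "z \<in> {0..<p}" "r1 \<in> {0..<p}" "r2 \<in> {0..<p}" "r3 \<in> {0..<p}"
        using s by (auto simp: ss ss' Pr_def mem_cube)
      ultimately have "x = r1" "y = r2" "z = r3" by (blast intro: eq_if_dvd_diff)+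
      then show "s = s'" using e2 by (simp add: ss ss')
    qed
    show "?f ` Pr \<subseteq> Sigma (cube p) L"
    proof (rule image_subsetI)
      fix s assume s: "s \<in> Pr"
      obtain x y z x' y' z' where ss: "s = ((x, y, z), (x', y', z'))" by (metis prod.collapse)
      have "p dvd ?G (x' + (x - x') mod p, y' + (y - y') mod p, z' + (z - z') mod p) - ?G (x, y, z)"
      proof -
        have "x' + (x - x') mod p = x + p * (- ((x - x') div p))" for x x'
          by (simp add: minus_mult_div_eq_mod[symmetric])
        then show ?thesis using dvd_diag_add_mult by metis
      qed
      moreover have "p dvd ?G (x, y, z) - ?G (x', y', z')" using s by (simp add: ss Pr_def)
      ultimately have "p dvd (?G (x' + (x - x') mod p, y' + (y - y') mod p, z' + (z - z') mod p) - ?G (x, y, z)) + (?G (x, y, z) - ?G (x', y', z'))"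
        by (rule dvd_add)
      then show "?f s \<in> Sigma (cube p) L" using s p0 by (auto simp: ss Pr_def L_def mem_cube)
    qed
    show "finite (Sigma (cube p) L)" by (auto simp: L_def)
  qed
  also have "\<dots> = (\<Sum>u\<in>cube p. card (L u))" by (subst card_SigmaI) (auto simp: L_def)
  also have "\<dots> \<le> (\<Sum>u\<in>cube p. nat p ^ 2 + (if u = (0, 0, 0) then nat p ^ 3 else 0))"
  proof (rule sum_mono)
    fix u assume u3: "u \<in> cube p"
    obtain u1 u2 u3 where uu: "u = (u1, u2, u3)" by (cases u)
    show "card (L u) \<le> nat p ^ 2 + (if u = (0, 0, 0) then nat p ^ 3 else 0)"
    proof (cases "u = (0, 0, 0)")
      case True
      have "card (L u) \<le> card (cube p)" by (rule card_mono) (auto simp: uu L_def)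
      then show ?thesis using True by (simp add: card_cube)
    next
      case False
      note np2 = not_dvd_2[OF p]
      have "\<exists>r\<in>{u1, u2, u3}. \<not> p dvd r"
        using False u3 not_dvd_if_in_residues[of _ p] by (auto simp: uu mem_cube)
      then have nd: "\<not> (p dvd 2 * A * u1 \<and> p dvd 2 * B * u2 \<and> p dvd 2 * C * u3)"
        using p(1) np2 u by (auto simp: prime_dvd_mult_iff)
      have "L u = {(x, y, z) \<in> cube p. p dvd ?G (u1, u2, u3) + (2 * A * u1) * x + (2 * B * u2) * y + (2 * C * u3) * z}"
      proof -
        have "?G (x + u1, y + u2, z + u3) - ?G (x, y, z)
          = ?G (u1, u2, u3) + (2 * A * u1) * x + (2 * B * u2) * y + (2 * C * u3) * z" for x y z
          unfolding diag_add by (simp add: algebra_simps)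
        then show ?thesis by (auto simp: L_def uu)
      qed
      then show ?thesis using card_linear[OF p(1) nd] by simp
    qed
  qed
  also have "\<dots> = nat p ^ 5 + nat p ^ 3"
  proof -
    have "(0, 0, 0) \<in> cube p" using p0 by (simp add: mem_cube)
    then show ?thesis by (simp add: sum.distrib card_cube power_add[symmetric])
  qed
  finally show ?thesis .
qed

lemma sum_card_dsols:
  fixes p A B C :: int
  assumes p: "p > 0"
  shows "(\<Sum>t\<in>{0..<p}. card (dsols A B C p t)) = nat p ^ 3"
proof -
  have "(\<Sum>t\<in>{0..<p}. card (dsols A B C p t)) = card (\<Union>t\<in>{0..<p}. dsols A B C p t)"
  proof (rule card_UN_disjoint[symmetric])
    show "\<forall>t\<in>{0..<p}. \<forall>t'\<in>{0..<p}. t \<noteq> t' \<longrightarrow> dsols A B C p t \<inter> dsols A B C p t' = {}"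
    proof (intro ballI impI)
      fix t t' assume t: "t \<in> {0..<p}" "t' \<in> {0..<p}" "t \<noteq> t'"
      show "dsols A B C p t \<inter> dsols A B C p t' = {}"
      proof (rule ccontr)
        assume "dsols A B C p t \<inter> dsols A B C p t' \<noteq> {}"
        then obtain v where "p dvd diag A B C v - t" "p dvd diag A B C v - t'" by (auto simp: dsols_def)
        then have "p dvd (diag A B C v - t') - (diag A B C v - t)" by (rule dvd_diff[rotated])
        then have "p dvd t - t'" by simp
        then show False using t eq_if_dvd_diff by blast
      qed
    qed
  qed auto
  also have "(\<Union>t\<in>{0..<p}. dsols A B C p t) = cube p"
  proof
    show "cube p \<subseteq> (\<Union>t\<in>{0..<p}. dsols A B C p t)"
    proof
      fix v assume v: "v \<in> cube p"
      have "v \<in> dsols A B C p (diag A B C v mod p)" using v by (simp add: dsols_def)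
      then show "v \<in> (\<Union>t\<in>{0..<p}. dsols A B C p t)" using p by auto
    qed
  qed (auto simp: dsols_def)
  finally show ?thesis by (simp add: card_cube)
qed

text \<open>Write \<open>f = p\<^sup>2 (1 + e)\<close>; the moments bound \<open>e\<close> pointwise and \<open>\<Sum> e\<^sup>2\<close>, and
  \<open>1 / (1 + e) \<le> 1 - e + 4 e\<^sup>2\<close>.\<close>

lemma sum_inverse_le_of_moments:
  fixes f :: "int \<Rightarrow> real" and p :: int
  assumes p: "p \<ge> 3" and s1: "(\<Sum>t\<in>{0..<p}. f t) = p ^ 3 - 1"
    and s2: "(\<Sum>t\<in>{0..<p}. (f t)\<^sup>2) \<le> p ^ 5 + p ^ 3"
  shows "\<And>t. t \<in> {0..<p} \<Longrightarrow> f t > 0" and "p * (\<Sum>t\<in>{0..<p}. 1 / f t) \<le> 1 + 7 / (real_of_int p)\<^sup>2"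
proof -
  define r where "r = real_of_int p"
  have r: "r \<ge> 3" using p by (simp add: r_def)
  define e where "e t = f t / r\<^sup>2 - 1" for t
  have f: "f t = r\<^sup>2 * (1 + e t)" for t using r by (simp add: e_def)
  have cd: "real (card {0..<p}) = r" using p by (simp add: r_def)
  have se: "(\<Sum>t\<in>{0..<p}. e t) = - 1 / r\<^sup>2"
  proof -
    have "(\<Sum>t\<in>{0..<p}. e t) = (\<Sum>t\<in>{0..<p}. f t) / r\<^sup>2 - r"
      using cd by (simp add: e_def sum_subtractf sum_divide_distrib)
    also have "\<dots> = (r ^ 3 - 1) / r\<^sup>2 - r" using s1 by (simp add: r_def)
    also have "\<dots> = - 1 / r\<^sup>2" using r by (simp add: field_simps power2_eq_square power3_eq_cube)
    finally show ?thesis .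
  qed
  have se2: "(\<Sum>t\<in>{0..<p}. (e t)\<^sup>2) \<le> 1 / r + 2 / r\<^sup>2"
  proof -
    have "(e t)\<^sup>2 = (f t)\<^sup>2 / r ^ 4 - 2 * e t - 1" for t
      using r by (simp add: f field_simps power2_eq_square power4_eq_xxxx)
    then have "(\<Sum>t\<in>{0..<p}. (e t)\<^sup>2) = (\<Sum>t\<in>{0..<p}. (f t)\<^sup>2) / r ^ 4 - 2 * (\<Sum>t\<in>{0..<p}. e t) - r"
      using cd by (simp add: sum_subtractf sum_divide_distrib sum_distrib_left)
    also have "\<dots> \<le> (r ^ 5 + r ^ 3) / r ^ 4 - 2 * (- 1 / r\<^sup>2) - r"
      using s2 r unfolding se by (intro diff_mono divide_right_mono) (auto simp: r_def)
    also have "\<dots> = 1 / r + 2 / r\<^sup>2"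
      using r by (simp add: field_simps power2_eq_square power3_eq_cube power4_eq_xxxx eval_nat_numeral)
    finally show ?thesis .
  qed
  \<comment> \<open>Here p \<ge> 3 enters: 1/3 + 2/9 = 5/9 < 9/16. The bound - 3/4 is what the
    inequality for 1 / (1 + e) needs, since (1 + e) (1 - e + 4 e^2) = 1 + e^2 (3 + 4 e).\<close>
  have eb: "e t \<ge> - 3 / 4" if t: "t \<in> {0..<p}" for t
  proof -
    have "(e t)\<^sup>2 \<le> (\<Sum>t\<in>{0..<p}. (e t)\<^sup>2)" using t by (intro member_le_sum) auto
    also have "\<dots> \<le> 1 / r + 2 / r\<^sup>2" by (rule se2)
    also have "\<dots> \<le> 1 / 3 + 2 / 3\<^sup>2" using r by (intro add_mono divide_left_mono power_mono) auto
    also have "\<dots> \<le> (3 / 4)\<^sup>2" by (simp add: power2_eq_square)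
    finally have "\<bar>e t\<bar> \<le> 3 / 4" by (simp add: abs_le_square_iff[symmetric])
    then show ?thesis by simp
  qed
  show "f t > 0" if "t \<in> {0..<p}" for t using eb[OF that] r by (simp add: f)
  have inv: "1 / f t \<le> (1 - e t + 4 * (e t)\<^sup>2) / r\<^sup>2" if t: "t \<in> {0..<p}" for t
  proof -
    have "1 \<le> (1 + e t) * (1 - e t + 4 * (e t)\<^sup>2)"
    proof -
      have "(1 + e t) * (1 - e t + 4 * (e t)\<^sup>2) = 1 + (e t)\<^sup>2 * (3 + 4 * e t)"
        by (simp add: power2_eq_square algebra_simps)
      moreover have "0 \<le> (e t)\<^sup>2 * (3 + 4 * e t)" using eb[OF t] by (intro mult_nonneg_nonneg) auto
      ultimately show ?thesis by simp
    qed
    then have "1 / (1 + e t) \<le> 1 - e t + 4 * (e t)\<^sup>2" using eb[OF t] by (simp add: field_simps)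
    then have "1 / (1 + e t) / r\<^sup>2 \<le> (1 - e t + 4 * (e t)\<^sup>2) / r\<^sup>2" by (intro divide_right_mono) auto
    then show ?thesis by (simp add: f mult.commute)
  qed
  have "(\<Sum>t\<in>{0..<p}. 1 / f t) \<le> (\<Sum>t\<in>{0..<p}. (1 - e t + 4 * (e t)\<^sup>2) / r\<^sup>2)"
    by (intro sum_mono inv)
  also have "\<dots> = (r - (\<Sum>t\<in>{0..<p}. e t) + 4 * (\<Sum>t\<in>{0..<p}. (e t)\<^sup>2)) / r\<^sup>2"
    using cd by (simp add: sum_divide_distrib[symmetric] sum.distrib sum_subtractf sum_distrib_left)
  also have "\<dots> \<le> (r + 1 / r\<^sup>2 + 4 * (1 / r + 2 / r\<^sup>2)) / r\<^sup>2"
    using se se2 by (intro divide_right_mono) auto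
  finally have "r * (\<Sum>t\<in>{0..<p}. 1 / f t) \<le> r * ((r + 1 / r\<^sup>2 + 4 * (1 / r + 2 / r\<^sup>2)) / r\<^sup>2)"
    using r by (intro mult_left_mono) auto
  \<comment> \<open>The constant 7 is 4 + 9 / r at r = 3.\<close>
  also have "\<dots> = 1 + (4 + 9 / r) / r\<^sup>2" using r by (simp add: field_simps power2_eq_square)
  also have "\<dots> \<le> 1 + 7 / r\<^sup>2"
    using r by (intro add_left_mono divide_right_mono) (auto simp: field_simps)
  finally show "p * (\<Sum>t\<in>{0..<p}. 1 / f t) \<le> 1 + 7 / (real_of_int p)\<^sup>2" by (simp add: r_def)
qed

section \<open>Averages of inverse local densities\<close>

lemma dsols_cong:
  assumes "m dvd t - t'"
  shows "dsols A B C m t = dsols A B C m t'"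
proof -
  have "m dvd g - t \<longleftrightarrow> m dvd g - t'" for g
  proof -
    have "g - t' = (g - t) + (t - t')" by simp
    then show ?thesis using assms by (metis dvd_add_left_iff)
  qed
  then show ?thesis by (simp add: dsols_def)
qed

lemma dsols_mod: "dsols A B C m (t mod m) = dsols A B C m t"
  by (rule dsols_cong) (simp add: minus_mult_div_eq_mod[symmetric])

lemma bij_betw_mod_pair:
  fixes m1 m2 :: int
  assumes m: "m1 > 0" "m2 > 0" "coprime m1 m2"
  shows "bij_betw (\<lambda>t. (t mod m1, t mod m2)) {0..<m1 * m2} ({0..<m1} \<times> {0..<m2})"
proof (rule bij_betwI')
  fix s t assume st: "s \<in> {0..<m1 * m2}" "t \<in> {0..<m1 * m2}"
  show "((s mod m1, s mod m2) = (t mod m1, t mod m2)) = (s = t)"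
  proof
    assume "(s mod m1, s mod m2) = (t mod m1, t mod m2)"
    then have "m1 dvd s - t" "m2 dvd s - t" by (simp_all add: mod_eq_dvd_iff)
    then have "m1 * m2 dvd s - t" using m(3) by (rule divides_mult)
    then show "s = t" using st by (intro eq_if_dvd_diff)
  qed simp
next
  fix t assume "t \<in> {0..<m1 * m2}"
  then show "(t mod m1, t mod m2) \<in> {0..<m1} \<times> {0..<m2}" using m by simp
next
  fix r assume "r \<in> {0..<m1} \<times> {0..<m2}"
  then obtain r1 r2 where r: "r = (r1, r2)" "r1 \<in> {0..<m1}" "r2 \<in> {0..<m2}" by blast
  obtain x where x: "[x = r1] (mod m1)" "[x = r2] (mod m2)"
    using binary_chinese_remainder_int[OF m(3)] by blast
  have "x mod m1 = r1 mod m1" "x mod m2 = r2 mod m2"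
    using x by (simp_all add: cong_iff_dvd_diff mod_eq_dvd_iff)
  then have "x mod (m1 * m2) mod m1 = r1" "x mod (m1 * m2) mod m2 = r2"
    using r by (simp_all add: mod_mod_cancel)
  then show "\<exists>t\<in>{0..<m1 * m2}. r = (t mod m1, t mod m2)"
    using m r(1) by (intro bexI[of _ "x mod (m1 * m2)"]) auto
qed

lemma card_dsols_mult:
  fixes m1 m2 :: int
  assumes m: "m1 > 0" "m2 > 0" "coprime m1 m2"
  shows "card (dsols A B C (m1 * m2) t) = card (dsols A B C m1 t) * card (dsols A B C m2 t)"
proof -
  let ?f = "\<lambda>(x, y, z). ((x mod m1, y mod m1, z mod m1), (x mod m2, y mod m2, z mod m2))"
  note bij = bij_betw_mod_pair[OF m]
  have key: "m1 * m2 dvd diag A B C (x, y, z) - t \<longleftrightarrow>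
      m1 dvd diag A B C (x mod m1, y mod m1, z mod m1) - t \<and> m2 dvd diag A B C (x mod m2, y mod m2, z mod m2) - t" for x y z
  proof -
    have "m dvd diag A B C (x mod m, y mod m, z mod m) - t \<longleftrightarrow> m dvd diag A B C (x, y, z) - t" for m
    proof -
      have "diag A B C (x mod m, y mod m, z mod m) - t
        = (diag A B C (x mod m, y mod m, z mod m) - diag A B C (x, y, z)) + (diag A B C (x, y, z) - t)" by simp
      then show ?thesis using dvd_diag_mod[of m A B C x y z] by (metis dvd_add_right_iff)
    qed
    then show ?thesis using m(3) by (meson divides_mult dvd_mult_left dvd_mult_right)
  qed
  have "bij_betw ?f (dsols A B C (m1 * m2) t) (dsols A B C m1 t \<times> dsols A B C m2 t)"
  proof (rule bij_betwI')
    fix v w assume vw: "v \<in> dsols A B C (m1 * m2) t" "w \<in> dsols A B C (m1 * m2) t"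
    obtain x y z where v: "v = (x, y, z)" by (cases v)
    obtain x' y' z' where w: "w = (x', y', z')" by (cases w)
    have r: "x \<in> {0..<m1*m2}" "y \<in> {0..<m1*m2}" "z \<in> {0..<m1*m2}" "x' \<in> {0..<m1*m2}" "y' \<in> {0..<m1*m2}" "z' \<in> {0..<m1*m2}"
      using vw by (auto simp: v w dsols_def mem_cube)
    have u: "s = s'" if "s mod m1 = s' mod m1" "s mod m2 = s' mod m2" "s \<in> {0..<m1*m2}" "s' \<in> {0..<m1*m2}" for s s'
      using bij_betw_imp_inj_on[OF bij] that by (auto dest: inj_onD)
    show "(?f v = ?f w) = (v = w)" using u r unfolding v w by auto
  next
    fix v assume "v \<in> dsols A B C (m1 * m2) t"
    then show "?f v \<in> dsols A B C m1 t \<times> dsols A B C m2 t"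
      using m key by (cases v) (auto simp: dsols_def mem_cube)
  next
    fix r assume "r \<in> dsols A B C m1 t \<times> dsols A B C m2 t"
    then obtain x1 y1 z1 x2 y2 z2 where r: "r = ((x1, y1, z1), (x2, y2, z2))"
      and r1: "(x1, y1, z1) \<in> dsols A B C m1 t" and r2: "(x2, y2, z2) \<in> dsols A B C m2 t"
      by (metis mem_Sigma_iff prod.collapse)
    have ex: "\<exists>s\<in>{0..<m1*m2}. s mod m1 = s1 \<and> s mod m2 = s2" if "s1 \<in> {0..<m1}" "s2 \<in> {0..<m2}" for s1 s2
    proof -
      have "(s1, s2) \<in> (\<lambda>t. (t mod m1, t mod m2)) ` {0..<m1 * m2}"
        using bij_betw_imp_surj_on[OF bij] that by blast
      then show ?thesis by auto
    qed
    have rr: "x1 \<in> {0..<m1}" "x2 \<in> {0..<m2}" "y1 \<in> {0..<m1}" "y2 \<in> {0..<m2}" "z1 \<in> {0..<m1}" "z2 \<in> {0..<m2}"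
      using r1 r2 by (auto simp: dsols_def mem_cube)
    obtain x where x: "x \<in> {0..<m1*m2}" "x mod m1 = x1" "x mod m2 = x2" using ex rr by blast
    obtain y where y: "y \<in> {0..<m1*m2}" "y mod m1 = y1" "y mod m2 = y2" using ex rr by blast
    obtain z where z: "z \<in> {0..<m1*m2}" "z mod m1 = z1" "z mod m2 = z2" using ex rr by blast
    have "(x, y, z) \<in> dsols A B C (m1 * m2) t"
      using r1 r2 x y z key[of x y z] by (simp add: dsols_def mem_cube)
    then show "\<exists>v\<in>dsols A B C (m1 * m2) t. r = ?f v"
      using x y z by (intro bexI[of _ "(x, y, z)"]) (simp_all add: r)
  qed
  then have "card (dsols A B C (m1 * m2) t) = card (dsols A B C m1 t \<times> dsols A B C m2 t)"
    by (rule bij_betw_same_card)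
  then show ?thesis by (simp add: card_cartesian_product)
qed

text \<open>The local density of t is card / m^2, so this is the mean over t modulo m of its
  inverse. By division by zero a class without solutions contributes 0; therefore each upper bound
  on \<open>avg_inv\<close> below is accompanied by the assertion that every class has a
  solution.\<close>

definition avg_inv :: "int \<Rightarrow> int \<Rightarrow> int \<Rightarrow> int \<Rightarrow> real" where
  "avg_inv A B C m = (\<Sum>t\<in>{0..<m}. m / card (dsols A B C m t))"

lemma avg_inv_nonneg: "m > 0 \<Longrightarrow> avg_inv A B C m \<ge> 0"
  unfolding avg_inv_def by (intro sum_nonneg) auto

lemma avg_inv_mult:
  fixes m1 m2 :: int
  assumes m: "m1 > 0" "m2 > 0" "coprime m1 m2"
  shows "avg_inv A B C (m1 * m2) = avg_inv A B C m1 * avg_inv A B C m2"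
proof -
  let ?g = "\<lambda>m t. real_of_int m / card (dsols A B C m t)"
  have "avg_inv A B C (m1 * m2) = (\<Sum>t\<in>{0..<m1*m2}. ?g m1 (t mod m1) * ?g m2 (t mod m2))"
    unfolding avg_inv_def by (intro sum.cong refl) (simp add: card_dsols_mult[OF m] dsols_mod)
  also have "\<dots> = (\<Sum>(s1, s2)\<in>{0..<m1} \<times> {0..<m2}. ?g m1 s1 * ?g m2 s2)"
    using sum.reindex_bij_betw[OF bij_betw_mod_pair[OF m], of "\<lambda>(s1, s2). ?g m1 s1 * ?g m2 s2"] by simp
  also have "\<dots> = avg_inv A B C m1 * avg_inv A B C m2"
    unfolding avg_inv_def sum_product by (simp add: sum.cartesian_product)
  finally show ?thesis .
qed

lemma sum_mod_period:
  fixes m k :: int and g :: "int \<Rightarrow> real"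
  assumes m: "m > 0" and k: "k \<ge> 0"
  shows "(\<Sum>t\<in>{0..<m * k}. g (t mod m)) = k * (\<Sum>t\<in>{0..<m}. g t)"
  using k
proof (induction k rule: int_ge_induct)
  case (step k)
  have mk: "m * (k + 1) = m * k + m" "0 \<le> m * k" using m step by (simp_all add: distrib_left)
  have "{0..<m * (k + 1)} = {0..<m * k} \<union> (\<lambda>t. t + m * k) ` {0..<m}"
    using mk m by (auto simp: image_add_int_atLeastLessThan image_add_atLeastLessThan')
  moreover have "{0..<m * k} \<inter> (\<lambda>t. t + m * k) ` {0..<m} = {}" by auto
  ultimately have "(\<Sum>t\<in>{0..<m * (k + 1)}. g (t mod m))
    = (\<Sum>t\<in>{0..<m * k}. g (t mod m)) + (\<Sum>t\<in>(\<lambda>t. t + m * k) ` {0..<m}. g (t mod m))"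
    by (simp add: sum.union_disjoint)
  also have "(\<Sum>t\<in>(\<lambda>t. t + m * k) ` {0..<m}. g (t mod m)) = (\<Sum>t\<in>{0..<m}. g t)"
    by (subst sum.reindex) (auto simp: inj_on_def intro!: sum.cong)
  finally show ?case using step by (simp add: algebra_simps)
qed simp

text \<open>Each nonsingular solution modulo p accounts for p^(2 k) solutions modulo p^(k + 1), and
  each class modulo p splits into p^k classes. The powers of p cancel, which leaves a bound
  independent of k.\<close>

lemma avg_inv_prime_power_le:
  fixes p A B C :: int
  assumes p: "prime p" "p > 2"
    and ns: "\<And>t. t \<in> {0..<p} \<Longrightarrow> card {v \<in> dsols A B C p t. nonsing p A B C v} > 0"
  shows "avg_inv A B C (p ^ Suc k) \<le> p * (\<Sum>t\<in>{0..<p}. 1 / card {v \<in> dsols A B C p t. nonsing p A B C v})"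
    and "card (dsols A B C (p ^ Suc k) t) > 0"
proof -
  have p0: "p > 0" using p by simp
  define f where "f t = real (card {v \<in> dsols A B C p t. nonsing p A B C v})" for t
  have fmod: "f (t mod p) = f t" for t by (simp add: f_def dsols_mod)
  have f0: "f t > 0" for t
  proof -
    have "f (t mod p) > 0" using ns[of "t mod p"] p0 by (simp add: f_def)
    then show ?thesis by (simp add: fmod)
  qed
  define r where "r = real_of_int p"
  have r0: "r > 0" using p0 by (simp add: r_def)
  have low: "(r ^ 2) ^ k * f t \<le> card (dsols A B C (p ^ Suc k) t)" for t
  proof -
    have "real ((nat p ^ 2) ^ k * card {v \<in> dsols A B C p t. nonsing p A B C v}) \<le> real (card (dsols A B C (p ^ Suc k) t))"
      using card_dsols_prime_power_ge[OF p] by (simp only: of_nat_le_iff)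
    then show ?thesis using p0 by (simp add: f_def r_def)
  qed
  have "0 < (r ^ 2) ^ k * f t" using f0 r0 by simp
  then have "0 < real (card (dsols A B C (p ^ Suc k) t))" using low[of t] by linarith
  then show "card (dsols A B C (p ^ Suc k) t) > 0" by simp
  have "avg_inv A B C (p ^ Suc k) \<le> (\<Sum>t\<in>{0..<p ^ Suc k}. r ^ Suc k / ((r ^ 2) ^ k * f (t mod p)))"
    unfolding avg_inv_def
  proof (rule sum_mono)
    fix t
    have "0 < (r ^ 2) ^ k * f t" using f0 r0 by simp
    then have "r ^ Suc k / card (dsols A B C (p ^ Suc k) t) \<le> r ^ Suc k / ((r ^ 2) ^ k * f t)"
      using low[of t] r0 by (intro frac_le) auto
    then show "real_of_int (p ^ Suc k) / card (dsols A B C (p ^ Suc k) t) \<le> r ^ Suc k / ((r ^ 2) ^ k * f (t mod p))"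
      by (simp add: fmod r_def)
  qed
  also have "\<dots> = (\<Sum>t\<in>{0..<p * p ^ k}. (\<lambda>t. r ^ Suc k / ((r ^ 2) ^ k * f t)) (t mod p))" by simp
  also have "\<dots> = real_of_int (p ^ k) * (\<Sum>t\<in>{0..<p}. r ^ Suc k / ((r ^ 2) ^ k * f t))"
    using p0 by (intro sum_mod_period) auto
  also have "\<dots> = (\<Sum>t\<in>{0..<p}. r * (1 / f t))"
    unfolding sum_distrib_left
  proof (rule sum.cong[OF refl])
    fix t
    have "(r\<^sup>2) ^ k = r ^ k * r ^ k" by (simp add: power2_eq_square power_mult_distrib)
    then show "real_of_int (p ^ k) * (r ^ Suc k / ((r ^ 2) ^ k * f t)) = r * (1 / f t)"
      using r0 f0[of t] by (simp add: r_def)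
  qed
  also have "\<dots> = p * (\<Sum>t\<in>{0..<p}. 1 / f t)" by (simp only: sum_distrib_left r_def)
  finally show "avg_inv A B C (p ^ Suc k) \<le> p * (\<Sum>t\<in>{0..<p}. 1 / card {v \<in> dsols A B C p t. nonsing p A B C v})"
    by (simp add: f_def)
qed

text \<open>All three coefficients are units modulo p, so the only singular vector is 0, a solution
  only for t = 0. The nonsingular counts thus have sum p^3 - 1 and sum of squares at most p^5 + p^3,
  and the moment estimate applies.\<close>

lemma avg_inv_unramified_prime:
  fixes p A B C :: int
  assumes p: "prime p" "p > 2" and u: "\<not> p dvd A" "\<not> p dvd B" "\<not> p dvd C"
  shows "avg_inv A B C (p ^ Suc k) \<le> 1 + 7 / (real_of_int p)\<^sup>2"
    and "card (dsols A B C (p ^ Suc k) t) > 0"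
proof -
  define f where "f t = real (card {v \<in> dsols A B C p t. nonsing p A B C v})" for t
  have p0: "p > 0" using p by simp
  have ns: "nonsing p A B C v \<longleftrightarrow> v \<noteq> (0, 0, 0)" if "v \<in> cube p" for v
  proof -
    obtain x y z where v: "v = (x, y, z)" by (cases v)
    have "p dvd r \<longleftrightarrow> r = 0" if "r \<in> {x, y, z}" for r
      using not_dvd_if_in_residues[of r p] that \<open>v \<in> cube p\<close> by (auto simp: v mem_cube)
    then show ?thesis using p(1) u by (simp add: v nonsing_def prime_dvd_mult_iff)
  qed
  have f: "f t = real (card (dsols A B C p t)) - (if t = 0 then 1 else 0)" if t: "t \<in> {0..<p}" for t
  proof -
    have eq: "{v \<in> dsols A B C p t. nonsing p A B C v} = dsols A B C p t - {(0, 0, 0)}"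
      using ns by (auto simp: dsols_def)
    have mem: "(0, 0, 0) \<in> dsols A B C p t \<longleftrightarrow> t = 0"
      using not_dvd_if_in_residues[OF t] p0 by (auto simp: dsols_def diag_def mem_cube)
    show ?thesis
    proof (cases "t = 0")
      case True
      then have "(0, 0, 0) \<in> dsols A B C p t" using mem by simp
      then have "card (dsols A B C p t) = Suc (card (dsols A B C p t - {(0, 0, 0)}))"
        by (intro card.remove) auto
      then show ?thesis unfolding f_def eq using True by simp
    next
      case False
      then have "dsols A B C p t - {(0, 0, 0)} = dsols A B C p t" using mem by auto
      then show ?thesis using False by (simp add: f_def eq)
    qed
  qed
  have "(\<Sum>t\<in>{0..<p}. f t) = (\<Sum>t\<in>{0..<p}. real (card (dsols A B C p t)) - (if t = 0 then 1 else 0))"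
    by (intro sum.cong refl f)
  also have "\<dots> = real (\<Sum>t\<in>{0..<p}. card (dsols A B C p t)) - 1"
    using p0 by (simp add: sum_subtractf)
  also have "\<dots> = p ^ 3 - 1" unfolding sum_card_dsols[OF p0] using p0 by simp
  finally have s1: "(\<Sum>t\<in>{0..<p}. f t) = p ^ 3 - 1" by simp
  have "(\<Sum>t\<in>{0..<p}. (f t)\<^sup>2) \<le> (\<Sum>t\<in>{0..<p}. real (card (dsols A B C p t) ^ 2))"
  proof (rule sum_mono)
    fix t assume t: "t \<in> {0..<p}"
    have "f t \<le> real (card (dsols A B C p t))" using f[OF t] by simp
    then show "(f t)\<^sup>2 \<le> real (card (dsols A B C p t) ^ 2)"
      by (simp add: f_def power_mono)
  qed
  also have "\<dots> = real (\<Sum>t\<in>{0..<p}. card (dsols A B C p t) ^ 2)" by simp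
  also have "\<dots> \<le> real (nat p ^ 5 + nat p ^ 3)"
    using sum_card_dsols_sq_le[OF p u] by (simp only: of_nat_le_iff)
  also have "\<dots> = p ^ 5 + p ^ 3" using p0 by simp
  finally have s2: "(\<Sum>t\<in>{0..<p}. (f t)\<^sup>2) \<le> p ^ 5 + p ^ 3" .
  have p3: "p \<ge> 3" using p(2) by simp
  note mom = sum_inverse_le_of_moments[OF p3 s1 s2]
  have nsp: "card {v \<in> dsols A B C p t. nonsing p A B C v} > 0" if "t \<in> {0..<p}" for t
    using mom(1)[OF that] by (simp add: f_def)
  show "avg_inv A B C (p ^ Suc k) \<le> 1 + 7 / (real_of_int p)\<^sup>2"
    using avg_inv_prime_power_le(1)[OF p nsp, of k] mom(2) unfolding f_def by linarith
  show "card (dsols A B C (p ^ Suc k) t) > 0" by (rule avg_inv_prime_power_le(2)[OF p nsp])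
qed

text \<open>One nonsingular solution per class bounds each inverse count by 1, hence the average by
  p^2. So crude a bound is harmless, since it is applied only to the finitely many primes dividing
  the coefficients.\<close>

lemma avg_inv_ramified_prime:
  fixes p A B C :: int
  assumes p: "prime p" "p > 2"
    and ex: "\<And>t. \<exists>x y z. p dvd diag A B C (x, y, z) - t \<and> nonsing p A B C (x, y, z)"
  shows "avg_inv A B C (p ^ Suc k) \<le> (real_of_int p)\<^sup>2"
    and "card (dsols A B C (p ^ Suc k) t) > 0"
proof -
  have p0: "p > 0" using p by simp
  have nsp: "card {v \<in> dsols A B C p t. nonsing p A B C v} > 0" for t
  proof -
    obtain x y z where v: "p dvd diag A B C (x, y, z) - t" "nonsing p A B C (x, y, z)" using ex by blast
    have "diag A B C (x mod p, y mod p, z mod p) - t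
        = (diag A B C (x mod p, y mod p, z mod p) - diag A B C (x, y, z)) + (diag A B C (x, y, z) - t)" by simp
    then have "p dvd diag A B C (x mod p, y mod p, z mod p) - t"
      using dvd_diag_mod[of p A B C x y z] v(1) by (metis dvd_add)
    moreover have "p dvd D * (r mod p) \<longleftrightarrow> p dvd D * r" for D r
      by (metis dvd_eq_mod_eq_0 mod_mult_right_eq)
    then have "nonsing p A B C (x mod p, y mod p, z mod p)" using v(2) by (simp add: nonsing_def)
    ultimately have "(x mod p, y mod p, z mod p) \<in> {v \<in> dsols A B C p t. nonsing p A B C v}"
      using p0 by (simp add: dsols_def mem_cube)
    then show ?thesis by (auto simp: card_gt_0_iff)
  qed
  have "(\<Sum>t\<in>{0..<p}. 1 / real (card {v \<in> dsols A B C p t. nonsing p A B C v})) \<le> (\<Sum>t\<in>{0..<p}. 1)"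
    using nsp by (intro sum_mono) (simp add: Suc_le_eq)
  also have "\<dots> = p" using p0 by simp
  finally have "p * (\<Sum>t\<in>{0..<p}. 1 / real (card {v \<in> dsols A B C p t. nonsing p A B C v})) \<le> p * real_of_int p"
    using p0 by (intro mult_left_mono) auto
  then show "avg_inv A B C (p ^ Suc k) \<le> (real_of_int p)\<^sup>2"
    using avg_inv_prime_power_le(1)[OF p nsp, of k] unfolding power2_eq_square by linarith
  show "card (dsols A B C (p ^ Suc k) t) > 0" by (rule avg_inv_prime_power_le(2)[OF p nsp])
qed

lemma avg_inv_prod_le:
  fixes A B C :: int and S :: "int set"
  assumes S: "finite S" "\<And>p. p \<in> S \<Longrightarrow> prime p \<and> e p \<ge> 1 \<and> avg_inv A B C (p ^ e p) \<le> w p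
      \<and> (\<forall>t. card (dsols A B C (p ^ e p) t) > 0)"
  shows "avg_inv A B C (\<Prod>p\<in>S. p ^ e p) \<le> (\<Prod>p\<in>S. w p) \<and> (\<forall>t. card (dsols A B C (\<Prod>p\<in>S. p ^ e p) t) > 0)"
  using S
proof (induction S rule: finite_induct)
  case empty
  have "dsols A B C 1 t = {(0, 0, 0)}" for t
    by (auto simp: dsols_def cube_def)
  moreover have "{0..<1::int} = {0}" by auto
  ultimately show ?case by (simp add: avg_inv_def)
next
  case (insert p S)
  have cop: "coprime (p ^ e p) (\<Prod>p\<in>S. p ^ e p)"
  proof (rule prod_coprime_right)
    fix s assume "s \<in> S"
    then have "coprime p s" using insert by (intro primes_coprime) auto
    then show "coprime (p ^ e p) (s ^ e s)" by simp
  qed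
  have pos: "p ^ e p > 0" "(\<Prod>p\<in>S. p ^ e p) > 0"
    using insert.prems by (auto intro!: prod_pos simp: prime_gt_0_int)
  have IH: "avg_inv A B C (\<Prod>p\<in>S. p ^ e p) \<le> (\<Prod>p\<in>S. w p)" "card (dsols A B C (\<Prod>p\<in>S. p ^ e p) t) > 0" for t
    using insert.IH insert.prems by auto
  have P: "avg_inv A B C (p ^ e p) \<le> w p" "card (dsols A B C (p ^ e p) t) > 0" for t using insert.prems by auto
  have w0: "0 \<le> w p" using P(1) avg_inv_nonneg[OF pos(1), of A B C] by linarith
  have "avg_inv A B C (p ^ e p * (\<Prod>p\<in>S. p ^ e p)) \<le> w p * (\<Prod>p\<in>S. w p)"
    unfolding avg_inv_mult[OF pos cop] using P IH w0 avg_inv_nonneg[OF pos(2)]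
    by (intro mult_mono) auto
  moreover have "card (dsols A B C (p ^ e p * (\<Prod>p\<in>S. p ^ e p)) t) > 0" for t
    unfolding card_dsols_mult[OF pos cop] using P IH by simp
  ultimately show ?case using insert.hyps by simp
qed

text \<open>By 1 + x \<le> exp x; the exponent 14 is 7 times the bound 2 for the sum of 1 / k^2 over
  positive integers k.\<close>

lemma prod_one_plus_inverse_squares_le:
  fixes S :: "int set"
  assumes S: "finite S" "\<And>p. p \<in> S \<Longrightarrow> p \<ge> 1"
  shows "(\<Prod>p\<in>S. 1 + 7 / (real_of_int p)\<^sup>2) \<le> exp 14"
proof -
  have "(\<Prod>p\<in>S. 1 + 7 / (real_of_int p)\<^sup>2) \<le> (\<Prod>p\<in>S. exp (7 / (real_of_int p)\<^sup>2))"
    by (intro prod_mono) (auto intro: add_nonneg_nonneg)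
  also have "\<dots> = exp (7 * (\<Sum>p\<in>S. 1 / (real_of_int p)\<^sup>2))"
    by (simp add: exp_sum[OF S(1)] sum_distrib_left)
  also have "\<dots> \<le> exp 14"
  proof -
    obtain n where n: "S \<subseteq> {1..n}" 
    proof (cases "S = {}")
      case False
      have "S \<subseteq> {1..Max S}" using S by auto
      then show ?thesis by (rule that)
    qed (use that in auto)
    have "(\<Sum>p\<in>S. 1 / (real_of_int p)\<^sup>2) \<le> (\<Sum>p\<in>{0+1..n}. 1 / (real_of_int p)\<^sup>2)"
      using n by (intro sum_mono2) auto
    also have "\<dots> \<le> 2 / real_of_int (0 + 1)" using sum_inverse_squares_tail_le[of 0 n] by simp
    finally show ?thesis by simp
  qed
  finally show ?thesis .
qed

theorem avg_inv_bounded: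
  fixes A B C :: int
  assumes nz: "A * B * C \<noteq> 0"
    and bad: "\<And>p t. prime p \<Longrightarrow> p > 2 \<Longrightarrow> p dvd A * B * C \<Longrightarrow>
      \<exists>x y z. p dvd diag A B C (x, y, z) - t \<and> nonsing p A B C (x, y, z)"
  obtains W where "\<And>m. odd m \<Longrightarrow> m > 0 \<Longrightarrow> avg_inv A B C m \<le> W \<and> (\<forall>t. card (dsols A B C m t) > 0)"
proof
  let ?M = "A * B * C"
  define w where "w p = (if p dvd ?M then (real_of_int p)\<^sup>2 else 1 + 7 / (real_of_int p)\<^sup>2)" for p
  fix m :: int assume m: "odd m" "m > 0"
  let ?S = "prime_factors m"
  have S: "prime p \<and> multiplicity p m \<ge> 1 \<and> avg_inv A B C (p ^ multiplicity p m) \<le> w p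
      \<and> (\<forall>t. card (dsols A B C (p ^ multiplicity p m) t) > 0)" if "p \<in> ?S" for p
  proof -
    have p: "prime p" "p dvd m" using that by auto
    have "p \<noteq> 2" using p m by auto
    then have p2: "p > 2" using prime_ge_2_int[OF p(1)] by simp
    have "multiplicity p m \<ge> 1" 
      using p m multiplicity_eq_zero_iff[of m p] not_prime_unit[of p] by (cases "multiplicity p m") auto
    then obtain k where k: "multiplicity p m = Suc k" by (cases "multiplicity p m") auto
    show ?thesis
    proof (cases "p dvd ?M")
      case True
      note b = avg_inv_ramified_prime[OF p(1) p2 bad[OF p(1) p2 True], of k]
      then show ?thesis using True p(1) by (simp add: k w_def)
    next
      case False
      then have "\<not> p dvd A" "\<not> p dvd B" "\<not> p dvd C" by auto
      note b = avg_inv_unramified_prime[OF p(1) p2 this, of k]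
      then show ?thesis using False p(1) by (simp add: k w_def)
    qed
  qed
  \<comment> \<open>The bound has to be independent of \<open>m\<close>: the ramified primes of
    \<open>m\<close> are among the prime factors of A B C, where p^2 \<ge> 1, so their product may
    be extended over all of these; the remaining primes give at most exp 14.\<close>
  have "(\<Prod>p\<in>?S. w p) = (\<Prod>p\<in>?S \<inter> {p. p dvd ?M}. (real_of_int p)\<^sup>2) * (\<Prod>p\<in>?S \<inter> - {p. p dvd ?M}. 1 + 7 / (real_of_int p)\<^sup>2)"
    unfolding w_def by (subst prod.If_cases) auto
  also have "\<dots> \<le> (\<Prod>p\<in>prime_factors ?M. (real_of_int p)\<^sup>2) * exp 14"
  proof (rule mult_mono)
    have ge1: "(real_of_int p)\<^sup>2 \<ge> 1" if "p \<in> prime_factors ?M" for p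
    proof -
      have "prime p" using that by auto
      then have "p \<ge> 1" using prime_ge_2_int[of p] by linarith
      then show ?thesis by simp
    qed
    have "?S \<inter> {p. p dvd ?M} \<subseteq> prime_factors ?M" using nz by (auto simp: prime_factors_dvd)
    then show "(\<Prod>p\<in>?S \<inter> {p. p dvd ?M}. (real_of_int p)\<^sup>2) \<le> (\<Prod>p\<in>prime_factors ?M. (real_of_int p)\<^sup>2)"
      using ge1 by (intro prod_mono2) auto
    show "(\<Prod>p\<in>?S \<inter> - {p. p dvd ?M}. 1 + 7 / (real_of_int p)\<^sup>2) \<le> exp 14"
    proof (rule prod_one_plus_inverse_squares_le)
      fix p assume "p \<in> ?S \<inter> - {p. p dvd ?M}"
      then have "prime p" by auto
      then show "p \<ge> 1" using prime_ge_2_int[of p] by linarith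
    qed auto
    show "0 \<le> (\<Prod>p\<in>?S \<inter> - {p. p dvd ?M}. 1 + 7 / (real_of_int p)\<^sup>2)"
      by (intro prod_nonneg) auto
    show "0 \<le> (\<Prod>p\<in>prime_factors ?M. (real_of_int p)\<^sup>2)" by (intro prod_nonneg) auto
  qed
  finally have wb: "(\<Prod>p\<in>?S. w p) \<le> (\<Prod>p\<in>prime_factors ?M. (real_of_int p)\<^sup>2) * exp 14" .
  have "(\<Prod>p\<in>?S. p ^ multiplicity p m) = m"
    using prod_prime_factors[of m] m by simp
  then show "avg_inv A B C m \<le> (\<Prod>p\<in>prime_factors ?M. (real_of_int p)\<^sup>2) * exp 14 \<and> (\<forall>t. card (dsols A B C m t) > 0)"
    using avg_inv_prod_le[of ?S "\<lambda>p. multiplicity p m" A B C w] S wb by fastforce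
qed

section \<open>The prime 2\<close>

text \<open>Adding N = 2^(e + 1) to y changes T_y by 2^e (N + 1) + y N, an odd multiple of 2^e; as b
  is odd, this corrects the next binary digit of b T_y.\<close>

lemma triangular_onto_mod_power2:
  fixes b m :: int
  assumes b: "odd b"
  shows "\<exists>y. 2 ^ e dvd b * triangular y - m"
proof (induction e)
  case (Suc e)
  then obtain y where y: "2 ^ e dvd b * triangular y - m" by blast
  then obtain k where k: "b * triangular y - m = 2 ^ e * k" by blast
  show ?case
  proof (cases "even k")
    case True
    then obtain l where "k = 2 * l" by blast
    then have "b * triangular y - m = 2 ^ Suc e * l" using k by simp
    then show ?thesis by (metis dvd_triv_left)
  next
    case False
    define N where "N = (2::int) ^ Suc e"
    have "2 * triangular N = 2 * (2 ^ e * (N + 1))" unfolding two_triangular by (simp add: N_def)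
    then have T: "triangular N = 2 ^ e * (N + 1)" by simp
    have "b * triangular (y + N) - m = 2 ^ e * (k + b * (N + 1) + 2 * (b * y))"
      unfolding triangular_add T using k by (simp add: N_def algebra_simps)
    moreover have "even (k + b * (N + 1) + 2 * (b * y))" using False b by (simp add: N_def)
    then obtain l where "k + b * (N + 1) + 2 * (b * y) = 2 * l" by blast
    ultimately have "b * triangular (y + N) - m = 2 ^ Suc e * l" by simp
    then show ?thesis by (metis dvd_triv_left)
  qed
qed simp

text \<open>The set \<open>sols\<close> for the modulus 2^e, with coordinates modulo 2^(e +
  1).\<close>

definition sols2 :: "int \<Rightarrow> int \<Rightarrow> int \<Rightarrow> nat \<Rightarrow> int \<Rightarrow> (int \<times> int \<times> int) set" where
  "sols2 a b c e n = {v \<in> cube (2 ^ Suc e). 2 ^ e dvd form a b c v - n}"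

text \<open>Solve for y with x and z fixed. For odd b every right-hand side is reached; for b twice
  an odd number every even one, after cancelling 2. So the condition on \<open>G\<close> is one of
  parity only.\<close>

lemma card_sols2_ge_if:
  assumes b: "\<not> 4 dvd b"
    and G: "finite G" "\<And>x z. (x, z) \<in> G \<Longrightarrow> x \<in> {0..<2 ^ Suc e} \<and> z \<in> {0..<2 ^ Suc e} \<and>
      (odd b \<or> e = 0 \<or> even (n - a * x\<^sup>2 - c * triangular z))"
  shows "card G \<le> card (sols2 a b c e n)"
proof -
  have ex: "\<exists>y. (x, y, z) \<in> sols2 a b c e n" if xz: "(x, z) \<in> G" for x z
  proof -
    define m where "m = n - a * x\<^sup>2 - c * triangular z"
    have "\<exists>y. 2 ^ e dvd b * triangular y - m"
    proof (cases "odd b")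
      case True
      then show ?thesis by (rule triangular_onto_mod_power2)
    next
      case False
      then obtain b1 where b1: "b = 2 * b1" by blast
      have ob: "odd b1" using b b1 by auto
      show ?thesis
      proof (cases e)
        case (Suc d)
        have "even m" using G(2)[OF xz] False Suc by (auto simp: m_def)
        then obtain m1 where m1: "m = 2 * m1" by blast
        obtain y where "2 ^ d dvd b1 * triangular y - m1" using triangular_onto_mod_power2[OF ob] by blast
        then have "2 * 2 ^ d dvd 2 * (b1 * triangular y - m1)" by (rule mult_dvd_mono[OF dvd_refl])
        then have "2 ^ e dvd b * triangular y - m" by (simp only: Suc b1 m1 power_Suc right_diff_distrib mult.assoc)
        then show ?thesis by blast
      qed auto
    qed
    then obtain y where y: "2 ^ e dvd b * triangular y - m" by blast
    define y' where "y' = y mod 2 ^ Suc e"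
    have "y = y' + 2 * 2 ^ e * (y div 2 ^ Suc e)" unfolding y'_def power_Suc by simp
    then have "2 ^ e dvd triangular y - triangular y'" by (metis triangular_mod)
    then have "2 ^ e dvd (b * triangular y - m) - b * (triangular y - triangular y')"
      using y by (blast intro: dvd_diff dvd_mult)
    then have "2 ^ e dvd form a b c (x, y', z) - n" by (simp add: form_def m_def algebra_simps)
    moreover have "y' \<in> {0..<2 ^ Suc e}" by (simp add: y'_def)
    ultimately show ?thesis using G(2)[OF xz] by (auto simp: sols2_def mem_cube)
  qed
  then obtain Y where Y: "\<And>x z. (x, z) \<in> G \<Longrightarrow> (x, Y x z, z) \<in> sols2 a b c e n" by metis
  show ?thesis
  proof (rule card_inj_on_le)
    show "inj_on (\<lambda>(x, z). (x, Y x z, z)) G" by (auto simp: inj_on_def)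
    show "(\<lambda>(x, z). (x, Y x z, z)) ` G \<subseteq> sols2 a b c e n" using Y by auto
    show "finite (sols2 a b c e n)" by (simp add: sols2_def)
  qed
qed

text \<open>If b is even, then a or c is odd, and the parity needed to solve for y can be arranged
  through x or through z. This fixes one binary digit of x or two of z, and a count of order q^2 for
  q = 2^e remains in all cases.\<close>

lemma card_sols2_ge:
  assumes b: "\<not> 4 dvd b" and g: "odd a \<or> odd b \<or> odd c"
  shows "4 ^ e \<le> card (sols2 a b c e n)"
proof -
  let ?I = "{0..<2 ^ e} :: int set" and ?J = "{0..<2 ^ Suc e} :: int set"
  consider "odd b \<or> e = 0" | "odd a" | d where "odd c" "e = Suc d" using g by (cases e) auto
  then show ?thesis
  proof cases
    case 1
    have "card (?I \<times> ?I) \<le> card (sols2 a b c e n)"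
      using 1 by (intro card_sols2_ge_if b) (auto intro: less_le_trans)
    then show ?thesis by (simp add: card_cartesian_product nat_power_eq power_mult_distrib[symmetric])
  next
    case 2
    define f where "f = (\<lambda>(i::int, z). (2 * i + (n - c * triangular z) mod 2, z))"
    have "card (f ` (?I \<times> ?J)) \<le> card (sols2 a b c e n)"
    proof (rule card_sols2_ge_if[OF b])
      fix x z assume "(x, z) \<in> f ` (?I \<times> ?J)"
      then obtain i where i: "i \<in> ?I" "z \<in> ?J" "x = 2 * i + (n - c * triangular z) mod 2" by (auto simp: f_def)
      have r: "0 \<le> (n - c * triangular z) mod 2" "(n - c * triangular z) mod 2 \<le> 1" by simp_all
      have "x \<in> ?J" using i r by auto
      moreover have "even (n - a * x\<^sup>2 - c * triangular z)"
      proof -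
        define k where "k = n - c * triangular z"
        have "even x \<longleftrightarrow> even k" by (simp add: i(3) k_def)
        then have "even (k - a * x\<^sup>2)" using 2 by simp
        moreover have "n - a * x\<^sup>2 - c * triangular z = k - a * x\<^sup>2" by (simp add: k_def)
        ultimately show ?thesis by (simp only:)
      qed
      ultimately show "x \<in> ?J \<and> z \<in> ?J \<and> (odd b \<or> e = 0 \<or> even (n - a * x\<^sup>2 - c * triangular z))"
        using i by blast
    qed simp
    moreover have "inj_on f (?I \<times> ?J)" by (auto simp: inj_on_def f_def)
    ultimately have "card (?I \<times> ?J) \<le> card (sols2 a b c e n)" by (simp add: card_image)
    moreover have "card (?I \<times> ?J) = 2 * 4 ^ e"
      by (simp add: card_cartesian_product nat_power_eq nat_mult_distrib power_mult_distrib[symmetric])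
    ultimately show ?thesis by simp
  next
    case 3
    let ?K = "{0..<2 ^ d} :: int set"
    \<comment> \<open>For z congruent to 0 or 1 modulo 4 the triangular number has the parity of z,
      so these two classes realise both parities. With i < 2^d one stays below 4 * 2^d = 2^(e +
      1).\<close>
    define f where "f = (\<lambda>(x::int, i::int). (x, 4 * i + (n - a * x\<^sup>2) mod 2))"
    have "card (f ` (?J \<times> ?K)) \<le> card (sols2 a b c e n)"
    proof (rule card_sols2_ge_if[OF b])
      fix x z assume "(x, z) \<in> f ` (?J \<times> ?K)"
      then obtain i where i: "i \<in> ?K" "x \<in> ?J" "z = 4 * i + (n - a * x\<^sup>2) mod 2" by (auto simp: f_def)
      define r where "r = (n - a * x\<^sup>2) mod 2"
      have r: "r = 0 \<or> r = 1" by (auto simp: r_def)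
      have z: "z = 4 * i + r" using i by (simp add: r_def)
      have "z \<in> ?J" using i(1) r unfolding z 3 by auto
      moreover have "even (n - a * x\<^sup>2 - c * triangular z)"
      proof -
        have "2 * triangular z = 2 * (2 * (4 * i * i + i + 2 * i * r) + r)"
          unfolding two_triangular z using r by (auto simp: algebra_simps)
        then have "triangular z = 2 * (4 * i * i + i + 2 * i * r) + r" by simp
        then have "even (triangular z) \<longleftrightarrow> even r" by simp
        moreover have "even r \<longleftrightarrow> even (n - a * x\<^sup>2)" by (simp add: r_def)
        ultimately show ?thesis using 3(1) by simp
      qed
      ultimately show "x \<in> ?J \<and> z \<in> ?J \<and> (odd b \<or> e = 0 \<or> even (n - a * x\<^sup>2 - c * triangular z))"
        using i by blast
    qed simp
    moreover have "inj_on f (?J \<times> ?K)" by (auto simp: inj_on_def f_def)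
    ultimately have "card (?J \<times> ?K) \<le> card (sols2 a b c e n)" by (simp add: card_image)
    moreover have "card (?J \<times> ?K) = 4 ^ e"
      by (simp add: card_cartesian_product nat_power_eq nat_mult_distrib 3 power_mult_distrib[symmetric])
    ultimately show ?thesis by simp
  qed
qed

text \<open>From 8 T_y + 1 = (2 y + 1)^2.\<close>

lemma form_diag: "8 * (form a b c (x, y, z) - n) = diag (8 * a) b c (x, 2 * y + 1, 2 * z + 1) - (8 * n + b + c)"
proof -
  have "8 * (form a b c (x, y, z) - n) = 8 * (a * x\<^sup>2) + 4 * b * (2 * triangular y) + 4 * c * (2 * triangular z) - 8 * n"
    by (simp add: form_def algebra_simps)
  then show ?thesis unfolding two_triangular by (simp add: diag_def power2_eq_square algebra_simps)
qed

text \<open>A solution modulo 2^e and one of the diagonal form modulo m are glued by the Chinese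
  remainder theorem: the period 2 q is 2^(e + 1) m, and modulo m the new variables 2 y + 1 and 2 z +
  1 reach every residue, because 2 is invertible.\<close>

lemma card_sols_ge:
  fixes a b c m n :: int
  assumes m: "m > 0" "odd m"
  shows "card (sols2 a b c e n) * card (dsols (8 * a) b c m (8 * n + b + c)) \<le> card (sols a b c (2 ^ e * m) n)"
proof -
  define N where "N = (2::int) ^ Suc e"
  let ?q = "2 ^ e * m"
  have N: "N > 0" "2 * ?q = N * m" by (simp_all add: N_def)
  have cop: "coprime N m" using m by (simp add: N_def)
  let ?D = "sols2 a b c e n \<times> dsols (8 * a) b c m (8 * n + b + c)"
  let ?R = "\<lambda>((x2, y2, z2), (x1, y1, z1)) (x, y, z).
    N dvd x - x2 \<and> N dvd y - y2 \<and> N dvd z - z2 \<and> m dvd x - x1 \<and> m dvd (2 * y + 1) - y1 \<and> m dvd (2 * z + 1) - z1"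
  have crt: "\<exists>x\<in>{0..<2 * ?q}. N dvd x - r \<and> m dvd x - s" for r s
  proof -
    obtain x where x: "[x = r] (mod N)" "[x = s] (mod m)" using binary_chinese_remainder_int[OF cop] by blast
    have "N dvd (x mod (N * m) - x) + (x - r)" "m dvd (x mod (N * m) - x) + (x - s)"
      using x by (intro dvd_add; simp add: cong_iff_dvd_diff minus_mult_div_eq_mod[symmetric])+
    then have "N dvd x mod (N * m) - r" "m dvd x mod (N * m) - s" by simp_all
    moreover have "x mod (N * m) \<in> {0..<2 * ?q}" unfolding N(2) using N(1) m by simp
    ultimately show ?thesis by blast
  qed
  have half: "\<exists>h. m dvd (2 * h + 1) - s" for s
  proof -
    obtain k where k: "m = 2 * k + 1" using m(2) oddE by blast
    \<comment> \<open>k + 1 is the inverse of 2 modulo 2 k + 1.\<close>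
    have "(2 * ((s - 1) * (k + 1)) + 1) - s = m * (s - 1)" by (simp add: k algebra_simps)
    then show ?thesis by (metis dvd_triv_left)
  qed
  have crt2: "\<exists>y\<in>{0..<2 * ?q}. N dvd y - r \<and> m dvd (2 * y + 1) - s" for r s
  proof -
    obtain h where h: "m dvd (2 * h + 1) - s" using half by blast
    obtain y where y: "y \<in> {0..<2 * ?q}" "N dvd y - r" "m dvd y - h" using crt by blast
    have "m dvd 2 * (y - h) + ((2 * h + 1) - s)" using y h by (intro dvd_add dvd_mult)
    then have "m dvd (2 * y + 1) - s" by (simp add: algebra_simps)
    then show ?thesis using y by blast
  qed
  have "\<forall>d. \<exists>v. v \<in> cube (2 * ?q) \<and> ?R d v"
  proof
    fix d :: "(int \<times> int \<times> int) \<times> (int \<times> int \<times> int)"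
    obtain x2 y2 z2 x1 y1 z1 where d: "d = ((x2, y2, z2), (x1, y1, z1))" by (metis prod.collapse)
    obtain x where "x \<in> {0..<2 * ?q}" "N dvd x - x2" "m dvd x - x1" using crt by blast
    moreover obtain y where "y \<in> {0..<2 * ?q}" "N dvd y - y2" "m dvd (2 * y + 1) - y1" using crt2 by blast
    moreover obtain z where "z \<in> {0..<2 * ?q}" "N dvd z - z2" "m dvd (2 * z + 1) - z1" using crt2 by blast
    ultimately show "\<exists>v. v \<in> cube (2 * ?q) \<and> ?R d v"
      by (intro exI[of _ "(x, y, z)"]) (simp add: d mem_cube)
  qed
  from choice[OF this] obtain f where f: "\<And>d. f d \<in> cube (2 * ?q) \<and> ?R d (f d)" by blast
  have "inj_on f ?D"
  proof (rule inj_onI)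
    fix d d' assume dd: "d \<in> ?D" "d' \<in> ?D" and e: "f d = f d'"
    obtain x2 y2 z2 x1 y1 z1 where d: "d = ((x2, y2, z2), (x1, y1, z1))" by (metis prod.collapse)
    obtain x2' y2' z2' x1' y1' z1' where d': "d' = ((x2', y2', z2'), (x1', y1', z1'))" by (metis prod.collapse)
    obtain x y z where v: "f d = (x, y, z)" by (cases "f d")
    have R: "?R d (x, y, z)" "?R d' (x, y, z)" using f[of d] f[of d'] e v by simp_all
    have r: "x2 \<in> {0..<N}" "y2 \<in> {0..<N}" "z2 \<in> {0..<N}" "x2' \<in> {0..<N}" "y2' \<in> {0..<N}" "z2' \<in> {0..<N}"
      "x1 \<in> {0..<m}" "y1 \<in> {0..<m}" "z1 \<in> {0..<m}" "x1' \<in> {0..<m}" "y1' \<in> {0..<m}" "z1' \<in> {0..<m}"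
      using dd unfolding d d' by (auto simp: sols2_def dsols_def mem_cube N_def)
    have u: "s = s'" if "k dvd t - s" "k dvd t - s'" "s \<in> {0..<k}" "s' \<in> {0..<k}" for k t s s' :: int
    proof -
      have "k dvd (t - s') - (t - s)" by (rule dvd_diff[OF that(2,1)])
      then have "k dvd s - s'" by simp
      then show ?thesis using that by (intro eq_if_dvd_diff)
    qed
    have "x2 = x2'" "y2 = y2'" "z2 = z2'" "x1 = x1'" "y1 = y1'" "z1 = z1'"
      using R unfolding d d' prod.case by (blast intro: u r)+
    then show "d = d'" by (simp add: d d')
  qed
  moreover have "f ` ?D \<subseteq> sols a b c ?q n"
  proof (rule image_subsetI)
    fix d assume dd: "d \<in> ?D"
    obtain x2 y2 z2 x1 y1 z1 where d: "d = ((x2, y2, z2), (x1, y1, z1))" by (metis prod.collapse)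
    obtain x y z where v: "f d = (x, y, z)" by (cases "f d")
    have R: "N dvd x - x2" "N dvd y - y2" "N dvd z - z2" "m dvd x - x1" "m dvd (2 * y + 1) - y1" "m dvd (2 * z + 1) - z1"
    proof -
      have "?R d (x, y, z)" using f[of d] v by simp
      then show "N dvd x - x2" "N dvd y - y2" "N dvd z - z2" "m dvd x - x1" "m dvd (2 * y + 1) - y1" "m dvd (2 * z + 1) - z1"
        unfolding d prod.case by blast+
    qed
    obtain i j k where ijk: "x - x2 = N * i" "y - y2 = N * j" "z - z2 = N * k" using R by (meson dvdE)
    then have "x = x2 + 2 * 2 ^ e * i" "y = y2 + 2 * 2 ^ e * j" "z = z2 + 2 * 2 ^ e * k" by (simp_all add: N_def algebra_simps)
    then have "2 ^ e dvd form a b c (x, y, z) - form a b c (x2, y2, z2)" by (metis form_mod)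
    moreover have "2 ^ e dvd form a b c (x2, y2, z2) - n" using dd by (simp add: d sols2_def)
    ultimately have "2 ^ e dvd (form a b c (x, y, z) - form a b c (x2, y2, z2)) + (form a b c (x2, y2, z2) - n)"
      by (rule dvd_add)
    then have 1: "2 ^ e dvd form a b c (x, y, z) - n" by simp
    let ?t = "8 * n + b + c"
    obtain i' j' k' where ijk': "x - x1 = m * i'" "(2 * y + 1) - y1 = m * j'" "(2 * z + 1) - z1 = m * k'" using R by (meson dvdE)
    then have "x = x1 + m * i'" "2 * y + 1 = y1 + m * j'" "2 * z + 1 = z1 + m * k'" by (simp_all add: algebra_simps)
    then have "m dvd diag (8 * a) b c (x, 2 * y + 1, 2 * z + 1) - diag (8 * a) b c (x1, y1, z1)"
      by (metis dvd_diag_add_mult)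
    moreover have "m dvd diag (8 * a) b c (x1, y1, z1) - ?t" using dd by (simp add: d dsols_def)
    ultimately have "m dvd (diag (8 * a) b c (x, 2 * y + 1, 2 * z + 1) - diag (8 * a) b c (x1, y1, z1)) + (diag (8 * a) b c (x1, y1, z1) - ?t)"
      by (rule dvd_add)
    also have "(diag (8 * a) b c (x, 2 * y + 1, 2 * z + 1) - diag (8 * a) b c (x1, y1, z1)) + (diag (8 * a) b c (x1, y1, z1) - ?t)
      = 8 * (form a b c (x, y, z) - n)" unfolding form_diag by simp
    finally have "m dvd 8 * (form a b c (x, y, z) - n)" .
    moreover have "coprime m 8"
    proof -
      have "coprime m (2 ^ 3)" using m by (simp only: coprime_power_right_iff) simp
      then show ?thesis by simp
    qed
    ultimately have 2: "m dvd form a b c (x, y, z) - n" using coprime_dvd_mult_right_iff by blast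
    have "coprime (2 ^ e) m" using m by simp
    then have "?q dvd form a b c (x, y, z) - n" using 1 2 by (simp add: divides_mult)
    then show "f d \<in> sols a b c ?q n" using f[of d] unfolding v sols_def cube_def by blast
  qed
  ultimately have "card ?D \<le> card (sols a b c ?q n)" by (intro card_inj_on_le) auto
  then show ?thesis by (simp add: card_cartesian_product)
qed

lemma bij_betw_affine_mod:
  fixes m u s :: int
  assumes m: "m > 0" "coprime u m"
  shows "bij_betw (\<lambda>n. (u * n + s) mod m) {0..<m} {0..<m}"
proof -
  have "inj_on (\<lambda>n. (u * n + s) mod m) {0..<m}"
  proof (rule inj_onI)
    fix x y assume xy: "x \<in> {0..<m}" "y \<in> {0..<m}" "(u * x + s) mod m = (u * y + s) mod m"
    then have "m dvd (u * x + s) - (u * y + s)" by (simp only: mod_eq_dvd_iff)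
    then have "m dvd u * (x - y)" by (simp add: algebra_simps)
    then have "m dvd x - y" using m(2) by (simp add: coprime_commute coprime_dvd_mult_right_iff)
    then show "x = y" using xy by (intro eq_if_dvd_diff)
  qed
  moreover have "(\<lambda>n. (u * n + s) mod m) ` {0..<m} \<subseteq> {0..<m}" using m by auto
  ultimately show ?thesis by (simp add: bij_betw_def endo_inj_surj)
qed

text \<open>For q = 2^e m with m odd, the lower bound 4^e for the 2-adic count cancels the powers of
  2, and n -> 8 n + b + c permutes the residues modulo m. What is left is q times
  \<open>avg_inv\<close> modulo m, so \<open>W\<close> serves for every q.\<close>

lemma sum_inverse_card_sols_le:
  fixes a b c q :: int
  assumes W: "\<And>m. odd m \<Longrightarrow> m > 0 \<Longrightarrow> avg_inv (8 * a) b c m \<le> W \<and> (\<forall>t. card (dsols (8 * a) b c m t) > 0)"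
    and b: "\<not> 4 dvd b" and g: "odd a \<or> odd b \<or> odd c" and q: "q \<ge> 1"
  shows "card (sols a b c q n) > 0"
    and "(\<Sum>n\<in>{0..<q}. (real_of_int q)\<^sup>2 / card (sols a b c q n)) \<le> W * q"
proof -
  obtain m where "q = 2 ^ multiplicity 2 q * m" "\<not> 2 dvd m"
    by (rule multiplicity_decompose'[of q 2]) (use q in auto)
  then obtain e where qm: "q = 2 ^ e * m" "odd m" by blast
  have m: "m > 0" using q qm zero_less_mult_pos[of "2 ^ e" m] by simp
  define D where "D t = real (card (dsols (8 * a) b c m t))" for t
  have D0: "D t > 0" for t using W[OF qm(2) m] by (simp add: D_def)
  have low: "4 ^ e * D (8 * n + b + c) \<le> card (sols a b c q n)" for n
  proof -
    have "4 ^ e * card (dsols (8 * a) b c m (8 * n + b + c)) \<le> card (sols a b c q n)"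
      unfolding qm(1) by (rule order_trans[OF mult_right_mono[OF card_sols2_ge[OF b g]] card_sols_ge[OF m qm(2)]]) simp
    then have "real (4 ^ e * card (dsols (8 * a) b c m (8 * n + b + c))) \<le> real (card (sols a b c q n))"
      by (simp only: of_nat_le_iff)
    then show ?thesis by (simp add: D_def)
  qed
  have "0 < 4 ^ e * D (8 * n + b + c)" using D0 by simp
  then have "0 < real (card (sols a b c q n))" using low[of n] by linarith
  then show "card (sols a b c q n) > 0" by simp
  have cop: "coprime 8 m"
  proof -
    have "coprime (2 ^ 3) m" using qm(2) by (simp only: coprime_power_left_iff) simp
    then show ?thesis by simp
  qed
  have Dmod: "D (t mod m) = D t" for t by (simp add: D_def dsols_mod)
  have per: "D ((8 * (n mod m) + (b + c)) mod m) = D (8 * n + b + c)" for n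
  proof -
    have "(8 * (n mod m) + (b + c)) mod m = (8 * n + (b + c)) mod m"
      by (metis mod_add_left_eq mod_mult_right_eq)
    then show ?thesis by (simp add: Dmod add.assoc)
  qed
  define F where "F n = (real_of_int m)\<^sup>2 / D ((8 * n + (b + c)) mod m)" for n
  have "(\<Sum>n\<in>{0..<q}. (real_of_int q)\<^sup>2 / card (sols a b c q n)) \<le> (\<Sum>n\<in>{0..<m * 2 ^ e}. F (n mod m))"
    unfolding qm(1) mult.commute[of "2 ^ e"]
  proof (rule sum_mono)
    fix n
    have "(real_of_int (m * 2 ^ e))\<^sup>2 / card (sols a b c (m * 2 ^ e) n) \<le> (real_of_int (m * 2 ^ e))\<^sup>2 / (4 ^ e * D (8 * n + b + c))"
      using low[of n] D0[of "8 * n + b + c"] unfolding qm(1) mult.commute[of "2 ^ e"] by (intro frac_le) auto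
    also have "\<dots> = (real_of_int m)\<^sup>2 / D (8 * n + b + c)"
    proof -
      have "((2::real) ^ e)\<^sup>2 = 4 ^ e" by (simp add: power2_eq_square power_mult_distrib[symmetric])
      then have "(real_of_int (m * 2 ^ e))\<^sup>2 = 4 ^ e * (real_of_int m)\<^sup>2" by (simp add: power_mult_distrib)
      then show ?thesis by (simp only: mult_divide_mult_cancel_left_if) simp
    qed
    also have "\<dots> = F (n mod m)" by (simp add: F_def per)
    finally show "(real_of_int (m * 2 ^ e))\<^sup>2 / card (sols a b c (m * 2 ^ e) n) \<le> F (n mod m)" .
  qed
  also have "\<dots> = real_of_int (2 ^ e) * (\<Sum>n\<in>{0..<m}. F n)" using m by (intro sum_mod_period) auto
  also have "(\<Sum>n\<in>{0..<m}. F n) = (\<Sum>t\<in>{0..<m}. (real_of_int m)\<^sup>2 / D t)"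
    unfolding F_def by (rule sum.reindex_bij_betw[OF bij_betw_affine_mod[OF m cop]])
  also have "\<dots> = m * avg_inv (8 * a) b c m"
    by (simp add: avg_inv_def D_def sum_distrib_left power2_eq_square)
  also have "real_of_int (2 ^ e) * (m * avg_inv (8 * a) b c m) \<le> real_of_int (2 ^ e) * (m * W)"
    using W[OF qm(2) m] m by (intro mult_left_mono) auto
  also have "\<dots> = W * q" by (simp add: qm(1))
  finally show "(\<Sum>n\<in>{0..<q}. (real_of_int q)\<^sup>2 / card (sols a b c q n)) \<le> W * q" .
qed

section \<open>Density of the exceptional set\<close>

lemma sols_cong:
  assumes "q dvd n - n'"
  shows "sols a b c q n = sols a b c q n'"
proof -
  have "q dvd g - n \<longleftrightarrow> q dvd g - n'" for g
  proof -
    have "g - n' = (g - n) + (n - n')" by simp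
    then show ?thesis using assms by (metis dvd_add_left_iff)
  qed
  then show ?thesis by (simp add: sols_def)
qed

text \<open>Each solution modulo q yields X^2 L points: about \<rho> P / (2 q) choices for each of
  the first two coordinates and \<eta> P / (16 c q) for the third. All coordinates are between 0 and
  P / 2, so each point has weight at least 1 / 8. The lower bound on n leaves room for a x^2 + b T_y
  below n, and 64 n \<le> P^2 keeps the crossing point z near or below P / 4. For P as large as
  assumed, rounding costs \<open>X\<close> and \<open>L\<close> at most a factor 2 each, whence 4096
  = 4 * 4 * 32 * 8.\<close>

lemma sum_repr_window_ge:
  fixes a b c q n P J :: int and \<rho> \<eta> :: real
  assumes pos: "a > 0" "b > 0" "c > 0" and q: "q \<ge> 1"
    and \<eta>: "0 < \<eta>" "\<eta> \<le> 1 / 64" and \<rho>: "0 < \<rho>" "\<rho> \<le> 1 / 2"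
    and P: "P \<ge> 20" "\<rho> * P \<ge> 4 * q" "\<eta> * P \<ge> 32 * c * q + 2 * c * (4 * q + 1)" "P \<ge> 10 * (4 * q + 1)"
    and n: "(a + b) * \<rho>\<^sup>2 * (real_of_int P)\<^sup>2 \<le> n" "64 * n \<le> P\<^sup>2"
    and J: "J = \<lfloor>\<eta> * (real_of_int P)\<^sup>2 / q\<rfloor>"
  shows "card (sols a b c q n) * (\<rho>\<^sup>2 * \<eta> * (real_of_int P) ^ 3 / (4096 * real_of_int c * (real_of_int q) ^ 3))
    \<le> (\<Sum>h\<in>(\<lambda>j. q * j) ` {0..J}. repr (form a b c) P (n + h))"
proof -
  define p where "p = real_of_int P"
  define r where "r = real_of_int q"
  have p: "p \<ge> 20" using P by (simp add: p_def)
  have r: "r \<ge> 1" using q by (simp add: r_def)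
  have c: "real_of_int c > 0" "real_of_int c \<ge> 1" using pos by simp_all
  define X where "X = \<lfloor>\<rho> * p / (2 * r)\<rfloor>"
  \<comment> \<open>Running z over a length 2 q L, about \<eta> P / (8 c), with z at most P / 2
    changes c T_z by about \<eta> P^2 / 16 at most, well inside the window.\<close>
  define L where "L = \<lfloor>\<eta> * p / (16 * c * r)\<rfloor>"
  define B where "B = P div 4"
  have Xle: "2 * r * X \<le> \<rho> * p"
  proof -
    have "X \<le> \<rho> * p / (2 * r)" unfolding X_def by (rule of_int_floor_le)
    then show ?thesis using r by (simp add: field_simps)
  qed
  have Xge: "X \<ge> \<rho> * p / (4 * r)"
  proof -
    have "X \<ge> \<rho> * p / (2 * r) - 1" unfolding X_def by linarith
    moreover have "\<rho> * p / (4 * r) \<ge> 1" using P(2) r by (simp add: p_def r_def)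
    moreover have "\<rho> * p / (2 * r) = 2 * (\<rho> * p / (4 * r))" by simp
    ultimately show ?thesis by linarith
  qed
  have \<eta>p: "\<eta> * p \<ge> 32 * c * r" "\<eta> * p \<ge> 2 * c * (4 * r + 1)"
  proof -
    have "0 \<le> 2 * c * (4 * r + 1)" "0 \<le> 32 * c * r" using c r by simp_all
    moreover have "\<eta> * p \<ge> 32 * c * r + 2 * c * (4 * r + 1)" using P(3) by (simp add: p_def r_def)
    ultimately show "\<eta> * p \<ge> 32 * c * r" "\<eta> * p \<ge> 2 * c * (4 * r + 1)" by linarith+
  qed
  have Lle: "16 * c * r * L \<le> \<eta> * p"
  proof -
    have "L \<le> \<eta> * p / (16 * c * r)" unfolding L_def by (rule of_int_floor_le)
    moreover have "16 * c * r > 0" using c r by simp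
    ultimately show ?thesis by (simp add: pos_le_divide_eq mult.commute)
  qed
  have Lge: "L \<ge> \<eta> * p / (32 * c * r)"
  proof -
    have "L \<ge> \<eta> * p / (16 * c * r) - 1" unfolding L_def by linarith
    moreover have "\<eta> * p / (32 * c * r) \<ge> 1" using \<eta>p(1) c r by simp
    moreover have "\<eta> * p / (16 * c * r) = 2 * (\<eta> * p / (32 * c * r))" by simp
    ultimately show ?thesis by linarith
  qed
  have X0: "X \<ge> 0"
  proof -
    have "0 \<le> \<rho> * p / (4 * r)" using \<rho> p r by simp
    then show ?thesis using Xge by linarith
  qed
  have L0: "L \<ge> 0"
  proof -
    have "0 \<le> \<eta> * p / (32 * c * r)" using \<eta> p r c by simp
    then show ?thesis using Lge by linarith
  qed
  have B4: "4 * B \<le> P" "P \<le> 4 * B + 3" unfolding B_def by linarith+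
  have B5: "P \<le> 5 * B" using B4 P(1) by linarith
  have n0: "n \<ge> 0"
  proof -
    have "0 \<le> (a + b) * \<rho>\<^sup>2 * (real_of_int P)\<^sup>2" using pos by simp
    then show ?thesis using n(1) by linarith
  qed
  have w: "real_of_int (4 * q + 2 * q * L) \<le> 4 * r + \<eta> * p / (8 * c)"
  proof -
    have "2 * r * L \<le> \<eta> * p / (8 * c)" using Lle c by (simp add: field_simps)
    then show ?thesis by (simp add: r_def)
  qed
  have "card (sols a b c q n) * (nat X * (nat X * nat L)) \<le>
    card {v. v \<in> {0..2 * q * X} \<times> {0..2 * q * X} \<times> {0..2 * B} \<and> q dvd form a b c v - n
      \<and> 0 \<le> form a b c v - n \<and> form a b c v - n \<le> q * J}" (is "_ \<le> card ?V")
  proof (rule card_near_solutions_ge[OF pos q X0 L0 n0])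
    show "(a + b) * (2 * q * X)\<^sup>2 \<le> n"
    proof -
      have "real_of_int ((a + b) * (2 * q * X)\<^sup>2) = (a + b) * (2 * r * X)\<^sup>2" by (simp add: r_def)
      also have "\<dots> \<le> (a + b) * (\<rho> * p)\<^sup>2"
        using pos Xle X0 r by (intro mult_left_mono power_mono) auto
      also have "\<dots> \<le> n" using n(1) by (simp add: p_def power_mult_distrib mult.assoc)
      finally show ?thesis by (simp only: of_int_le_iff)
    qed
    show "B \<ge> 1" using B5 P(1) by linarith
    show "2 * n + 1 \<le> B\<^sup>2"
    proof -
      have "P\<^sup>2 \<le> (5 * B)\<^sup>2" using B5 P(1) by (intro power_mono) auto
      then have "P\<^sup>2 \<le> 25 * B\<^sup>2" by (simp add: power_mult_distrib)
      moreover have "4\<^sup>2 \<le> B\<^sup>2" using B5 P(1) by (intro power_mono) auto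
      ultimately show ?thesis using n(2) by simp
    qed
    have "\<eta> * p / (8 * c) \<le> (1 / 64) * p / (8 * 1)"
      using \<eta> p c by (intro frac_le mult_right_mono mult_left_mono) auto
    then have "real_of_int (4 * q + 2 * q * L) \<le> 4 * r + p / 512" using w by simp
    moreover have "1 + (4 * r + p / 512) \<le> real_of_int B"
    proof -
      have "p \<ge> 10 * (4 * r + 1)" using P(4) by (simp add: p_def r_def)
      moreover have "p \<le> 5 * real_of_int B" using B5 by (simp add: p_def)
      moreover have "4 * r + 1 \<le> p / 10" using calculation(1) by simp
      ultimately show ?thesis using p by linarith
    qed
    ultimately have "1 + real_of_int (4 * q + 2 * q * L) \<le> B" by linarith
    then show "B + 1 + (4 * q + 2 * q * L) \<le> 2 * B" by linarith
    show "c * ((4 * q + 2 * q * L + 1) * (2 * B)) \<le> q * J"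
    proof -
      have "real_of_int (c * ((4 * q + 2 * q * L + 1) * (2 * B))) = c * ((real_of_int (4 * q + 2 * q * L) + 1) * (2 * real_of_int B))"
        by simp
      also have "\<dots> \<le> c * ((4 * r + \<eta> * p / (8 * c) + 1) * (p / 2))"
      proof -
        have "2 * real_of_int B \<le> p / 2" using B4(1) unfolding p_def by linarith
        moreover have "0 \<le> real_of_int (4 * q + 2 * q * L)" using q L0 by simp
        moreover have "0 \<le> 2 * real_of_int B" using B5 P(1) by simp
        ultimately show ?thesis using w c by (intro mult_left_mono mult_mono add_right_mono) auto
      qed
      also have "\<dots> = (2 * c * (4 * r + 1)) * p / 4 + \<eta> * p * p / 16" using c by (simp add: field_simps)
      also have "\<dots> \<le> (\<eta> * p) * p / 4 + \<eta> * p * p / 16"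
        using \<eta>p(2) p by (intro add_right_mono divide_right_mono mult_right_mono) auto
      also have "\<dots> \<le> \<eta> * p\<^sup>2 - r"
      proof -
        have "r * 32 \<le> \<eta> * p * p"
        proof -
          have "1 * 1 \<le> c * p" using c p by (intro mult_mono) auto
          then have "(32 * r) * 1 \<le> (32 * r) * (c * p)" using r by (intro mult_left_mono) auto
          then have "r * 32 \<le> 32 * c * r * p" by (simp add: mult_ac)
          also have "\<dots> \<le> \<eta> * p * p" using \<eta>p(1) p by (intro mult_right_mono) auto
          finally show ?thesis by simp
        qed
        moreover have "0 \<le> \<eta> * p * p" using \<eta> p by simp
        ultimately show ?thesis using r by (simp add: power2_eq_square)
      qed
      also have "\<dots> \<le> real_of_int (q * J)"
      proof -
        have "J \<ge> \<eta> * p\<^sup>2 / r - 1" unfolding J p_def r_def by linarith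
        then have "r * (\<eta> * p\<^sup>2 / r - 1) \<le> r * J" using r by (intro mult_left_mono) auto
        then show ?thesis using r by (simp add: r_def right_diff_distrib)
      qed
      finally show ?thesis by (simp only: of_int_le_iff)
    qed
  qed
  then have "real (card (sols a b c q n) * (nat X * (nat X * nat L))) \<le> real (card ?V)" by (simp only: of_nat_le_iff)
  then have cV: "card (sols a b c q n) * (real_of_int X * (real_of_int X * real_of_int L)) \<le> card ?V"
    using X0 L0 by simp
  have sum_eq: "(\<Sum>h\<in>(\<lambda>j. q * j) ` {0..J}. repr (form a b c) P (n + h))
    = (\<Sum>v\<in>{v \<in> vbox P. form a b c v - n \<in> (\<lambda>j. q * j) ` {0..J}}. tent3 P v)"
    by (rule sum_repr_eq_sum_tent) simp
  have VP: "v \<in> vbox P \<and> form a b c v - n \<in> (\<lambda>j. q * j) ` {0..J} \<and> tent3 P v \<ge> 1 / 8" if v: "v \<in> ?V" for v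
  proof -
    obtain x y z where vv: "v = (x, y, z)" by (cases v)
    have XP: "2 * (2 * q * X) \<le> P"
    proof -
      have "\<rho> * p \<le> (1 / 2) * p" using \<rho> p by (intro mult_right_mono) auto
      then have "2 * (2 * r * X) \<le> p" using Xle by linarith
      then have "real_of_int (2 * (2 * q * X)) \<le> real_of_int P" by (simp add: r_def p_def)
      then show ?thesis by (simp only: of_int_le_iff)
    qed
    have xyz: "0 \<le> x" "2 * x \<le> P" "0 \<le> y" "2 * y \<le> P" "0 \<le> z" "2 * z \<le> P"
      using v XP B4(1) by (auto simp: vv)
    have P1: "P \<ge> 1" using P(1) by simp
    have "(1 / 2) * (1 / 2) * (1 / 2) \<le> tent P x * tent P y * tent P z"
      using xyz tent_bounds[OF P1] by (intro mult_mono tent_ge_half P1 mult_nonneg_nonneg) auto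
    then have "tent3 P v \<ge> 1 / 8" by (simp add: vv tent3_def)
    moreover obtain j where j: "form a b c v - n = q * j" using v by blast
    have "0 \<le> q * j" "q * j \<le> q * J" using v j by auto
    then have "j \<in> {0..J}" using q by (simp add: zero_le_mult_iff)
    then have "form a b c v - n \<in> (\<lambda>j. q * j) ` {0..J}" using j by blast
    ultimately show ?thesis using xyz by (simp add: vv)
  qed
  have "real (card ?V) * (1 / 8) \<le> (\<Sum>v\<in>?V. tent3 P v)"
    using sum_bounded_below[of ?V "1 / 8" "tent3 P"] VP by auto
  also have "\<dots> \<le> (\<Sum>v\<in>{v \<in> vbox P. form a b c v - n \<in> (\<lambda>j. q * j) ` {0..J}}. tent3 P v)"
    using VP tent3_bounds[of P] P(1) by (intro sum_mono2) auto
  finally have main: "card (sols a b c q n) * (real_of_int X * (real_of_int X * real_of_int L)) * (1 / 8)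
      \<le> (\<Sum>h\<in>(\<lambda>j. q * j) ` {0..J}. repr (form a b c) P (n + h))"
    unfolding sum_eq using cV by linarith
  have "(\<rho> * p / (4 * r)) * ((\<rho> * p / (4 * r)) * (\<eta> * p / (32 * c * r))) * (1 / 8)
      \<le> real_of_int X * (real_of_int X * real_of_int L) * (1 / 8)"
    using Xge Lge X0 L0 \<rho> \<eta> p r c by (intro mult_right_mono mult_mono mult_nonneg_nonneg) auto
  moreover have "(\<rho> * p / (4 * r)) * ((\<rho> * p / (4 * r)) * (\<eta> * p / (32 * c * r))) * (1 / 8)
      = \<rho>\<^sup>2 * \<eta> * (real_of_int P) ^ 3 / (4096 * real_of_int c * (real_of_int q) ^ 3)"
    by (simp add: p_def r_def power2_eq_square power3_eq_cube mult_ac)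
  ultimately have "\<rho>\<^sup>2 * \<eta> * (real_of_int P) ^ 3 / (4096 * real_of_int c * (real_of_int q) ^ 3)
      \<le> real_of_int X * (real_of_int X * real_of_int L) * (1 / 8)" by (simp only:)
  then have "card (sols a b c q n) * (\<rho>\<^sup>2 * \<eta> * (real_of_int P) ^ 3 / (4096 * real_of_int c * (real_of_int q) ^ 3))
     \<le> card (sols a b c q n) * (real_of_int X * (real_of_int X * real_of_int L) * (1 / 8))"
    by (intro mult_left_mono) auto
  then show ?thesis using main by (simp only: mult.assoc)
qed

text \<open>Markov's inequality for q^2 / card, whose mean over a period is at most W; the interval
  from 0 to N is covered by \<open>int N div q + 1\<close> periods.\<close>

lemma card_few_solutions_le:
  fixes a b c q :: int and N :: nat and \<delta> W :: real
  assumes q: "q \<ge> 1" and \<delta>: "\<delta> > 0"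
    and W: "\<And>n. card (sols a b c q n) > 0"
      "(\<Sum>n\<in>{0..<q}. (real_of_int q)\<^sup>2 / card (sols a b c q n)) \<le> W * q"
  shows "card {n \<in> {0..int N}. card (sols a b c q n) < \<delta> * (real_of_int q)\<^sup>2} \<le> \<delta> * W * (N + q)"
proof -
  define k where "k = int N div q + 1"
  have k0: "k \<ge> 0" using q by (simp add: k_def pos_imp_zdiv_nonneg_iff)
  have qk: "int N < q * k" "q * k \<le> int N + q"
  proof -
    have "int N = q * (int N div q) + int N mod q" by simp
    moreover have "0 \<le> int N mod q" "int N mod q < q" using q by simp_all
    ultimately show "int N < q * k" "q * k \<le> int N + q" unfolding k_def distrib_left by linarith+
  qed
  let ?B = "{n \<in> {0..int N}. card (sols a b c q n) < \<delta> * (real_of_int q)\<^sup>2}"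
  let ?g = "\<lambda>n. (real_of_int q)\<^sup>2 / card (sols a b c q n)"
  have W0: "0 \<le> W"
  proof -
    have "0 \<le> (\<Sum>n\<in>{0..<q}. ?g n)" by (intro sum_nonneg) auto
    then have "0 \<le> W * q" using W(2) by linarith
    then show ?thesis using q by (simp add: zero_le_mult_iff)
  qed
  have "real (card ?B) = (\<Sum>n\<in>?B. 1)" by simp
  also have "\<dots> \<le> (\<Sum>n\<in>?B. \<delta> * ?g n)"
  proof (rule sum_mono)
    fix n assume n: "n \<in> ?B"
    have "real (card (sols a b c q n)) > 0" using W(1) by simp
    then show "1 \<le> \<delta> * ?g n" using n by (simp add: field_simps)
  qed
  also have "\<dots> \<le> (\<Sum>n\<in>{0..<q * k}. \<delta> * ?g n)"
    using qk \<delta> by (intro sum_mono2) auto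
  also have "\<dots> = \<delta> * (\<Sum>n\<in>{0..<q * k}. ?g (n mod q))"
  proof -
    have "sols a b c q (n mod q) = sols a b c q n" for n
      by (rule sols_cong) (simp add: minus_mult_div_eq_mod[symmetric])
    then show ?thesis by (simp add: sum_distrib_left)
  qed
  also have "(\<Sum>n\<in>{0..<q * k}. ?g (n mod q)) = k * (\<Sum>n\<in>{0..<q}. ?g n)"
    using q k0 by (intro sum_mod_period) auto
  also have "\<delta> * (k * (\<Sum>n\<in>{0..<q}. ?g n)) \<le> \<delta> * (k * (W * q))"
    using W(2) \<delta> k0 by (intro mult_left_mono) auto
  also have "\<dots> = \<delta> * W * real_of_int (q * k)" by simp
  also have "\<dots> \<le> \<delta> * W * real_of_int (int N + q)"
    using \<delta> W0 qk(2) by (intro mult_left_mono) (auto simp only: of_int_le_iff mult_nonneg_nonneg less_imp_le)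
  finally show ?thesis by simp
qed

text \<open>Cauchy-Schwarz over the shifts exchanges the square of the window sum for a sum of
  squares, to which the second-moment bound applies shift by shift.\<close>

lemma card_unrepresented_le:
  fixes F :: "int \<times> int \<times> int \<Rightarrow> int" and E H :: "int set" and s \<epsilon> :: real
  assumes E: "finite E" "\<And>n. n \<in> E \<Longrightarrow> repr F P n = 0"
    and H: "finite H" "\<And>h. h \<in> H \<Longrightarrow> cor F P 0 - cor F P h \<le> \<epsilon>"
    and s: "s > 0" "\<And>n. n \<in> E \<Longrightarrow> s \<le> (\<Sum>h\<in>H. repr F P (n + h))"
  shows "card E * s\<^sup>2 \<le> (real (card H))\<^sup>2 * (2 * \<epsilon>)"
proof -
  have "card E * s\<^sup>2 = (\<Sum>n\<in>E. s\<^sup>2)" by simp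
  also have "\<dots> \<le> (\<Sum>n\<in>E. (\<Sum>h\<in>H. repr F P (n + h))\<^sup>2)"
    using s by (intro sum_mono power_mono) auto
  also have "\<dots> \<le> (\<Sum>n\<in>E. real (card H) * (\<Sum>h\<in>H. (repr F P (n + h))\<^sup>2))"
  proof (rule sum_mono)
    fix n
    show "(\<Sum>h\<in>H. repr F P (n + h))\<^sup>2 \<le> real (card H) * (\<Sum>h\<in>H. (repr F P (n + h))\<^sup>2)"
      using Cauchy_Schwarz_ineq_sum[of "\<lambda>_. 1" "\<lambda>h. repr F P (n + h)" H] by simp
  qed
  also have "\<dots> = real (card H) * (\<Sum>h\<in>H. \<Sum>n\<in>E. (repr F P (n + h))\<^sup>2)"
    by (subst sum.swap) (simp add: sum_distrib_left)
  also have "\<dots> \<le> real (card H) * (\<Sum>h\<in>H. 2 * \<epsilon>)"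
  proof (intro mult_left_mono sum_mono)
    fix h assume h: "h \<in> H"
    have "(\<Sum>n\<in>E. (repr F P (n + h))\<^sup>2) \<le> 2 * (cor F P 0 - cor F P h)" by (rule sum_repr_shift_le[OF E])
    also have "\<dots> \<le> 2 * \<epsilon>" using H(2)[OF h] by (rule mult_left_mono) simp
    finally show "(\<Sum>n\<in>E. (repr F P (n + h))\<^sup>2) \<le> 2 * \<epsilon>" .
  qed simp
  also have "\<dots> = (real (card H))\<^sup>2 * (2 * \<epsilon>)" by (simp add: power2_eq_square)
  finally show ?thesis .
qed

text \<open>The unrepresented n \<le> N are split into those at most about \<nu> N
  (\<open>A\<close>), those with few solutions modulo q (\<open>B\<close>), and the rest
  (\<open>E\<close>). Each part costs \<nu> N, and a fourth \<nu> N pays for rounding. \<epsilon>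
  has to be fixed before q and the window are known.\<close>

lemma card_exceptional_le:
  fixes a b c :: int and \<nu> W :: real
  assumes pos: "a > 0" "b > 0" "c > 0" and \<nu>: "0 < \<nu>" "\<nu> \<le> 1"
    and W: "\<And>q n. q \<ge> 1 \<Longrightarrow> card (sols a b c q n) > 0"
      "\<And>q. q \<ge> 1 \<Longrightarrow> (\<Sum>n\<in>{0..<q}. (real_of_int q)\<^sup>2 / card (sols a b c q n)) \<le> W * q"
  shows "\<exists>N0. \<forall>N\<ge>N0. card {n::nat. n \<le> N \<and> (\<forall>v. form a b c v \<noteq> int n)} \<le> 4 * \<nu> * N"
proof -
  have W0: "W \<ge> 0"
  proof -
    have "0 \<le> (\<Sum>n\<in>{0..<1}. (real_of_int 1)\<^sup>2 / card (sols a b c 1 n))" by (intro sum_nonneg) auto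
    then show ?thesis using W(2)[of 1] by simp
  qed
  \<comment> \<open>Markov's bound for \<open>B\<close> is then \<delta> W (N + q) \<le> (\<nu> / 2)
    (2 N); the + 1 guards against W = 0.\<close>
  define \<delta> where "\<delta> = \<nu> / (2 * (W + 1))"
  have \<delta>: "\<delta> > 0" using \<nu> W0 by (simp add: \<delta>_def)
  \<comment> \<open>Since P^2 \<le> 81 N below, this gives (a + b) \<rho>^2 P^2 \<le> \<nu> N, so
    every n \<ge> \<nu> N meets the lower bound in the window estimate.\<close>
  define \<rho> where "\<rho> = \<nu> / (9 * (a + b))"
  have ab: "real_of_int (a + b) \<ge> 2" using pos by simp
  have \<rho>: "\<rho> > 0" "\<rho> \<le> 1 / 2" "81 * (a + b) * \<rho>\<^sup>2 \<le> \<nu>"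
  proof -
    show "\<rho> > 0" using \<nu> ab unfolding \<rho>_def by (intro divide_pos_pos) auto
    have "\<rho> \<le> 1 / (9 * 2)" unfolding \<rho>_def using \<nu> ab by (intro frac_le) auto
    then show "\<rho> \<le> 1 / 2" by simp
    define t where "t = real_of_int (a + b)"
    have "81 * t * (\<nu> / (9 * t))\<^sup>2 = \<nu> * \<nu> / t" using ab by (simp add: t_def[symmetric] power2_eq_square field_simps)
    then have "81 * (a + b) * \<rho>\<^sup>2 = \<nu> * \<nu> / (a + b)" by (simp add: \<rho>_def t_def)
    also have "\<dots> \<le> \<nu> * 1 / 1" using \<nu> ab by (intro frac_le mult_left_mono) auto
    finally show "81 * (a + b) * \<rho>\<^sup>2 \<le> \<nu>" by simp
  qed
  \<comment> \<open>With 2 \<eta> P^2 / q for the number of shifts, its square times 2 \<epsilon>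
    P^4, divided by s^2, equals \<epsilon> C P^2 / 81; q and \<eta> cancel, so \<open>C\<close> is
    available before they are.\<close>
  define C where "C = 8 * 4096\<^sup>2 * 81 * (real_of_int c)\<^sup>2 / (\<delta>\<^sup>2 * \<rho> ^ 4)"
  have C0: "C > 0" using pos \<delta> \<rho> by (simp add: C_def)
  define \<epsilon> where "\<epsilon> = \<nu> / C"
  have \<epsilon>: "\<epsilon> > 0" using \<nu> C0 by (simp add: \<epsilon>_def)
  interpret Q: quad_form "form a b c" "2 * a" b c by (rule quad_form_triangular[OF pos])
  obtain q P0 :: int and \<eta>0 :: real where q: "q \<ge> 1" and \<eta>0: "\<eta>0 > 0" and P0: "P0 \<ge> 1"
    and core: "\<And>P h. P \<ge> P0 \<Longrightarrow> q dvd h \<Longrightarrow> 0 \<le> h \<Longrightarrow> h \<le> \<eta>0 * (real_of_int P)\<^sup>2 \<Longrightarrow>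
      cor (form a b c) P 0 - cor (form a b c) P h \<le> \<epsilon> * (real_of_int P) ^ 4"
    using Q.correlation_continuity[OF \<epsilon>] by metis
  define \<eta> where "\<eta> = min \<eta>0 (1 / 64)"
  have \<eta>: "0 < \<eta>" "\<eta> \<le> 1 / 64" "\<eta> \<le> \<eta>0" using \<eta>0 by (auto simp: \<eta>_def)
  define M where "M = Max {real_of_int P0, 20, 4 * q / \<rho>, (32 * c * q + 2 * c * (4 * q + 1)) / \<eta>, 10 * (4 * q + 1)}"
  have M: "real_of_int P0 \<le> M" "20 \<le> M" "4 * q / \<rho> \<le> M" "(32 * c * q + 2 * c * (4 * q + 1)) / \<eta> \<le> M" "10 * (4 * q + 1) \<le> M"
    unfolding M_def by (intro Max_ge; simp)+
  define N0 where "N0 = nat \<lceil>M\<^sup>2 + (q + 2) / \<nu>\<rceil>"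
  show ?thesis
  proof (intro exI[of _ N0] allI impI)
    fix N :: nat assume N: "N \<ge> N0"
    have NM: "real N \<ge> M\<^sup>2 + (q + 2) / \<nu>" using N unfolding N0_def by linarith
    have qn: "0 \<le> (q + 2) / \<nu>" using q \<nu> by simp
    have NM2: "real N \<ge> M\<^sup>2" using NM qn by linarith
    have Nq: "q + 2 \<le> \<nu> * N"
    proof -
      have "(q + 2) / \<nu> \<le> N" using NM by (smt (verit) zero_le_power2)
      then show ?thesis using \<nu> by (simp add: field_simps)
    qed
    \<comment> \<open>The factor 8 gives 64 N \<le> P^2, as the window estimate demands; rounding up
      keeps P^2 \<le> 81 N.\<close>
    define P where "P = \<lceil>8 * sqrt N\<rceil>"
    define p where "p = real_of_int P"
    have sN: "sqrt N \<ge> M" using NM2 by (rule real_le_rsqrt)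
    have sN20: "sqrt N \<ge> 20" using sN M(2) by linarith
    have p1: "8 * sqrt N \<le> p" unfolding p_def P_def by (rule le_of_int_ceiling)
    have p2: "p \<le> 9 * sqrt N"
    proof -
      have "p \<le> 8 * sqrt N + 1" unfolding p_def P_def by linarith
      then show ?thesis using sN20 by linarith
    qed
    have pM: "M \<le> p" using p1 sN sN20 by linarith
    have psq1: "64 * N \<le> p\<^sup>2"
    proof -
      have "(8 * sqrt N)\<^sup>2 \<le> p\<^sup>2" using p1 sN20 by (intro power_mono) auto
      then show ?thesis by (simp add: power_mult_distrib)
    qed
    have psq2: "p\<^sup>2 \<le> 81 * N"
    proof -
      have "p\<^sup>2 \<le> (9 * sqrt N)\<^sup>2" using p1 p2 sN20 by (intro power_mono) auto
      then show ?thesis by (simp add: power_mult_distrib)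
    qed
    have p20: "p \<ge> 20" using pM M(2) by linarith
    define J where "J = \<lfloor>\<eta> * (real_of_int P)\<^sup>2 / q\<rfloor>"
    define H where "H = (\<lambda>j. q * j) ` {0..J}"
    define E where "E = {n \<in> {0..int N}. \<nu> * N \<le> n \<and> card (sols a b c q n) \<ge> \<delta> * (real_of_int q)\<^sup>2 \<and> (\<forall>v. form a b c v \<noteq> n)}"
    have finE: "finite E" by (rule finite_subset[of _ "{0..int N}"]) (auto simp: E_def)
    have Pc: "P \<ge> P0" "P \<ge> 20" "\<rho> * P \<ge> 4 * q" "\<eta> * P \<ge> 32 * c * q + 2 * c * (4 * q + 1)" "P \<ge> 10 * (4 * q + 1)"
    proof -
      show "P \<ge> P0" "P \<ge> 20" "P \<ge> 10 * (4 * q + 1)" using pM M(1,2,5) unfolding p_def by linarith+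
      have "4 * q / \<rho> \<le> P" using pM M(3) unfolding p_def by linarith
      then show "\<rho> * P \<ge> 4 * q" using \<rho>(1) by (simp add: field_simps)
      have "(32 * c * q + 2 * c * (4 * q + 1)) / \<eta> \<le> P" using pM M(4) unfolding p_def by linarith
      then show "\<eta> * P \<ge> 32 * c * q + 2 * c * (4 * q + 1)" using \<eta>(1) by (simp add: pos_divide_le_eq mult.commute)
    qed
    define s where "s = \<delta> * (real_of_int q)\<^sup>2 * (\<rho>\<^sup>2 * \<eta> * p ^ 3 / (4096 * real_of_int c * (real_of_int q) ^ 3))"
    have s0: "s > 0" using \<delta> \<rho> \<eta> p20 pos q by (simp add: s_def)
    have E_le: "card E * s\<^sup>2 \<le> (real (card H))\<^sup>2 * (2 * (\<epsilon> * p ^ 4))"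
    proof (rule card_unrepresented_le[OF finE])
      fix n assume n: "n \<in> E"
      show "repr (form a b c) P n = 0" using n by (intro repr_eq_0) (auto simp: E_def)
      have "s \<le> card (sols a b c q n) * (\<rho>\<^sup>2 * \<eta> * p ^ 3 / (4096 * real_of_int c * (real_of_int q) ^ 3))"
        unfolding s_def using n \<rho> \<eta> p20 pos q by (intro mult_right_mono) (auto simp: E_def)
      also have "\<dots> \<le> (\<Sum>h\<in>H. repr (form a b c) P (n + h))"
        unfolding H_def p_def
      proof (rule sum_repr_window_ge[OF pos q \<eta>(1,2) \<rho>(1,2) Pc(2-5) _ _ J_def])
        have "(a + b) * \<rho>\<^sup>2 * p\<^sup>2 \<le> (a + b) * \<rho>\<^sup>2 * (81 * N)"
          using psq2 ab by (intro mult_left_mono) auto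
        also have "\<dots> = (81 * (a + b) * \<rho>\<^sup>2) * N" by simp
        also have "\<dots> \<le> \<nu> * N" using \<rho>(3) by (intro mult_right_mono) auto
        also have "\<dots> \<le> n" using n by (simp add: E_def)
        finally show "(a + b) * \<rho>\<^sup>2 * (real_of_int P)\<^sup>2 \<le> n" by (simp add: p_def)
        have "real_of_int (64 * n) \<le> 64 * N" using n by (simp add: E_def)
        also have "\<dots> \<le> real_of_int (P\<^sup>2)" using psq1 by (simp add: p_def)
        finally show "64 * n \<le> P\<^sup>2" by (simp only: of_int_le_iff)
      qed
      finally show "s \<le> (\<Sum>h\<in>H. repr (form a b c) P (n + h))" .
    next
      show "finite H" by (simp add: H_def)
      show "s > 0" by (rule s0)
      fix h assume "h \<in> H"
      then obtain j where j: "h = q * j" "0 \<le> j" "j \<le> J"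
        unfolding H_def by (meson atLeastAtMost_iff imageE)
      have "real_of_int j \<le> \<eta> * p\<^sup>2 / q" using j(3) unfolding J_def p_def by linarith
      then have "real_of_int q * j \<le> q * (\<eta> * p\<^sup>2 / q)" using q by (intro mult_left_mono) auto
      also have "\<dots> = \<eta> * p\<^sup>2" using q by simp
      also have "\<dots> \<le> \<eta>0 * p\<^sup>2" using \<eta> by (intro mult_right_mono) auto
      finally have "h \<le> \<eta>0 * (real_of_int P)\<^sup>2" by (simp add: j p_def)
      then show "cor (form a b c) P 0 - cor (form a b c) P h \<le> \<epsilon> * p ^ 4"
        unfolding p_def using j q by (intro core Pc) auto
    qed
    have cH: "real (card H) \<le> 2 * \<eta> * p\<^sup>2 / q"
    proof -
      have "card H \<le> card {0..J}" unfolding H_def by (rule card_image_le) simp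
      then have "real (card H) \<le> real (nat (J + 1))" by simp
      moreover have "real (nat (J + 1)) \<le> \<eta> * p\<^sup>2 / q + 1"
      proof -
        have "0 \<le> \<eta> * p\<^sup>2 / q" using \<eta> q by simp
        then have "J \<ge> 0" unfolding J_def p_def by simp
        then have "real (nat (J + 1)) = real_of_int J + 1" by simp
        then show ?thesis unfolding J_def p_def by linarith
      qed
      \<comment> \<open>This absorbs the additional element of {0..J} into the factor 2.\<close>
      moreover have "1 \<le> \<eta> * p\<^sup>2 / q"
      proof -
        have "real_of_int q \<le> \<eta> * p"
        proof -
          have "q \<le> 32 * c * q + 2 * c * (4 * q + 1)"
          proof -
            have "1 * q \<le> (32 * c) * q" using pos q by (intro mult_right_mono) auto
            moreover have "0 \<le> 2 * c * (4 * q + 1)" using pos q by simp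
            ultimately show ?thesis by linarith
          qed
          then have "real_of_int q \<le> real_of_int (32 * c * q + 2 * c * (4 * q + 1))" by (simp only: of_int_le_iff)
          then show ?thesis using Pc(4) unfolding p_def by linarith
        qed
        also have "\<dots> \<le> \<eta> * p * p"
        proof -
          have "0 \<le> \<eta> * p" using \<eta> p20 by simp
          then show ?thesis using mult_left_mono[of 1 p "\<eta> * p"] p20 by simp
        qed
        finally show ?thesis using q by (simp add: power2_eq_square mult.assoc)
      qed
      ultimately show ?thesis by linarith
    qed
    have "card E * s\<^sup>2 \<le> (2 * \<eta> * p\<^sup>2 / q)\<^sup>2 * (2 * (\<epsilon> * p ^ 4))"
    proof -
      have "(real (card H))\<^sup>2 * (2 * (\<epsilon> * p ^ 4)) \<le> (2 * \<eta> * p\<^sup>2 / q)\<^sup>2 * (2 * (\<epsilon> * p ^ 4))"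
        using cH \<epsilon> by (intro mult_right_mono power_mono) auto
      then show ?thesis using E_le by linarith
    qed
    also have "\<dots> = (\<epsilon> * C * (p\<^sup>2 / 81)) * s\<^sup>2"
      using q pos \<delta> \<rho>(1) \<eta>(1) p20 unfolding s_def C_def by (simp add: field_simps power2_eq_square eval_nat_numeral)
    finally have "card E \<le> \<epsilon> * C * (p\<^sup>2 / 81)" using s0 by simp
    also have "\<dots> \<le> \<nu> * N" using psq2 C0 \<nu> by (simp add: \<epsilon>_def)
    finally have cE: "card E \<le> \<nu> * N" .
    define B where "B = {n \<in> {0..int N}. card (sols a b c q n) < \<delta> * (real_of_int q)\<^sup>2}"
    have finB: "finite B" by (rule finite_subset[of _ "{0..int N}"]) (auto simp: B_def)
    have cB: "card B \<le> \<nu> * N"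
    proof -
      have "card B \<le> \<delta> * W * (N + q)"
        unfolding B_def by (rule card_few_solutions_le[OF q \<delta> W(1)[OF q] W(2)[OF q]])
      also have "\<dots> \<le> (\<nu> / 2) * (N + q)"
      proof (rule mult_right_mono)
        have "\<delta> * W \<le> \<delta> * (W + 1)" using \<delta> by simp
        also have "\<dots> = \<nu> / 2"
        proof -
          have "W + 1 \<noteq> 0" using W0 by simp
          then show ?thesis by (simp add: \<delta>_def field_simps)
        qed
        finally show "\<delta> * W \<le> \<nu> / 2" .
      qed (use q in auto)
      also have "\<dots> \<le> (\<nu> / 2) * (N + N)"
      proof -
        have "real_of_int q \<le> \<nu> * N" using Nq by simp
        also have "\<dots> \<le> (1::real) * N" using \<nu> by (intro mult_right_mono) auto
        finally show ?thesis using \<nu> by (intro mult_left_mono) auto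
      qed
      finally show ?thesis by simp
    qed
    define A where "A = {0..\<lfloor>\<nu> * N\<rfloor>}"
    have cA: "card A \<le> \<nu> * N + 1"
    proof -
      have "0 \<le> \<nu> * N" using \<nu> by simp
      then have "real (card A) = real_of_int \<lfloor>\<nu> * N\<rfloor> + 1" by (simp add: A_def)
      then show ?thesis by linarith
    qed
    let ?X = "{n::nat. n \<le> N \<and> (\<forall>v. form a b c v \<noteq> int n)}"
    have "int ` ?X \<subseteq> A \<union> B \<union> E"
    proof
      fix m assume "m \<in> int ` ?X"
      then obtain n where n: "m = int n" "n \<le> N" "\<forall>v. form a b c v \<noteq> int n" by blast
      then have "m \<in> {0..int N}" by simp
      then show "m \<in> A \<union> B \<union> E"
        using n unfolding A_def B_def E_def by (cases "\<nu> * N \<le> m") (auto simp: le_floor_iff not_le not_less)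
    qed
    then have "card (int ` ?X) \<le> card (A \<union> B \<union> E)"
      using finE finB by (intro card_mono) (auto simp: A_def)
    also have "\<dots> \<le> card A + card B + card E"
      by (meson card_Un_le add_right_mono order_trans)
    finally have "real (card ?X) \<le> real (card A + card B + card E)"
      by (simp add: card_image)
    also have "\<dots> \<le> 3 * \<nu> * N + 1" using cA cB cE by simp
    also have "\<dots> \<le> 4 * \<nu> * N"
    proof -
      have "1 \<le> q + 2" using q by simp
      then have "1 \<le> \<nu> * N" using Nq by linarith
      then show ?thesis by linarith
    qed
    finally show "card ?X \<le> 4 * \<nu> * N" .
  qed
qed

section \<open>Isotropic binary forms and residues modulo the odd part\<close>

lemma dvd_mult_minus_exists:
  fixes p u s :: int
  assumes "prime p" "\<not> p dvd u"
  shows "\<exists>x. p dvd u * x - s"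
proof -
  have "coprime u p" using prime_imp_coprime[OF assms] by (simp add: coprime_commute)
  then obtain w where "[u * w = 1] (mod p)" using cong_solve_coprime_int by blast
  then have "p dvd (u * w - 1) * s" by (simp add: cong_iff_dvd_diff)
  then have "p dvd u * (w * s) - s" by (simp add: algebra_simps)
  then show ?thesis by blast
qed

text \<open>With \<open>r\<^sup>2 = - B C\<close> one has \<open>B (B y\<^sup>2 + C z\<^sup>2) = (B y - r z) (B y + r z)\<close>; make the factors \<open>1\<close> and \<open>B t\<close>.\<close>

lemma isotropic_binary_represents:
  fixes p B C r t :: int
  assumes p: "prime p" "p > 2" and BC: "\<not> p dvd B" "\<not> p dvd C" and r: "p dvd r\<^sup>2 + B * C"
  shows "\<exists>y z. p dvd B * y\<^sup>2 + C * z\<^sup>2 - t \<and> \<not> (p dvd y \<and> p dvd z)"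
proof -
  note p2 = not_dvd_2[OF p]
  have rn: "\<not> p dvd r"
  proof
    assume "p dvd r"
    then have "p dvd r\<^sup>2" by (simp add: power2_eq_square)
    then have "p dvd B * C" using r by (simp add: dvd_add_right_iff)
    then show False using BC p(1) by (simp add: prime_dvd_mult_iff)
  qed
  have "\<not> p dvd 2 * B" "\<not> p dvd 2 * r" using p(1) p2 BC rn by (simp_all add: prime_dvd_mult_iff)
  then obtain y z where y: "p dvd 2 * B * y - (1 + B * t)" and z: "p dvd 2 * r * z - (B * t - 1)"
    using dvd_mult_minus_exists[OF p(1)] by metis
  have "p dvd (2 * B * y - (1 + B * t)) * (2 * B * y + (1 + B * t))
      - (2 * r * z - (B * t - 1)) * (2 * r * z + (B * t - 1)) + 4 * z\<^sup>2 * (r\<^sup>2 + B * C)"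
    by (rule dvd_add[OF dvd_diff[OF dvd_mult2[OF y] dvd_mult2[OF z]] dvd_mult[OF r]])
  also have "\<dots> = (4 * B) * (B * y\<^sup>2 + C * z\<^sup>2 - t)"
    by (simp add: power2_eq_square algebra_simps)
  finally have "p dvd (4 * B) * (B * y\<^sup>2 + C * z\<^sup>2 - t)" .
  moreover have "\<not> p dvd 4 * B"
  proof -
    have "\<not> p dvd 2 * (2 * B)" using prime_dvd_mult_iff[OF p(1)] p2 BC by blast
    then show ?thesis by simp
  qed
  ultimately have "p dvd B * y\<^sup>2 + C * z\<^sup>2 - t" using p(1) prime_dvd_mult_iff by blast
  moreover have "\<not> (p dvd y \<and> p dvd z)"
  proof
    assume "p dvd y \<and> p dvd z"
    then have "p dvd 2 * B * y - (2 * B * y - (1 + B * t))" "p dvd 2 * r * z - (2 * r * z - (B * t - 1))"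
      using y z by (blast intro: dvd_diff dvd_mult)+
    then have "p dvd 1 + B * t" "p dvd B * t - 1" by simp_all
    then have "p dvd (1 + B * t) - (B * t - 1)" by (rule dvd_diff)
    then show False using p2 by simp
  qed
  ultimately show ?thesis by blast
qed

lemma odd_part_decomp: "n \<noteq> 0 \<Longrightarrow> n = 2 ^ multiplicity 2 n * odd_part n"
  unfolding odd_part_def by (simp add: multiplicity_dvd)

lemma odd_odd_part: "n \<noteq> 0 \<Longrightarrow> odd (odd_part n)"
proof -
  assume n: "n \<noteq> 0"
  have "\<not> 2 dvd n div 2 ^ multiplicity 2 n" using n by (intro multiplicity_decompose) auto
  then show ?thesis by (simp add: odd_part_def)
qed

lemma odd_part_pos: "n > 0 \<Longrightarrow> odd_part n > 0"
  using odd_part_decomp[of n] zero_less_mult_pos[of "2 ^ multiplicity 2 n" "odd_part n"] by simp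

lemma prime_dvd_odd_part:
  fixes p n :: int
  assumes "prime p" "p > 2" "n \<noteq> 0"
  shows "p dvd odd_part n \<longleftrightarrow> p dvd n"
proof -
  have "\<not> p dvd 2 ^ multiplicity 2 n" using not_dvd_2[OF assms(1,2)] assms(1) prime_dvd_power by blast
  then show ?thesis using odd_part_decomp[OF assms(3)] assms(1) prime_dvd_mult_iff by metis
qed

lemma quad_residue_coprimeD:
  fixes p m u :: int
  assumes "u \<R> m" "prime p" "p dvd m"
  shows "\<not> p dvd u" "\<exists>r. p dvd r\<^sup>2 - u"
proof -
  show "\<not> p dvd u"
    using assms coprime_common_divisor[of u m p] not_prime_unit unfolding quad_residue_coprime_def by blast
  obtain r where "[r\<^sup>2 = u] (mod m)" using assms(1) unfolding quad_residue_coprime_def QuadRes_def by blast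
  then have "m dvd r\<^sup>2 - u" by (simp add: cong_iff_dvd_diff)
  then show "\<exists>r. p dvd r\<^sup>2 - u" using assms(3) dvd_trans by blast
qed

text \<open>At an odd prime p dividing one coefficient, the residue condition makes the binary form
  in the other two variables isotropic with unit coefficients. With the first variable set to 0 it
  represents every class nonsingularly, which is the input for bounding inverse densities at
  ramified primes. Condition (2) appears here as \<open>\<not> 4 dvd b\<close>; the other case
  follows by exchanging b and c.\<close>

theorem universal_if_local_conditions:
  fixes a b c :: int
  assumes pos: "a > 0" "b > 0" "c > 0" and g: "Gcd {a, b, c} = 1"
    and R: "(- (b * c)) \<R> odd_part a" "(- (2 * a * c)) \<R> odd_part b" "(- (2 * a * b)) \<R> odd_part c"
    and b4: "\<not> 4 dvd b"
  shows "asymptotically_universal (\<lambda>x y z. a * x\<^sup>2 + b * triangular y + c * triangular z)"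
proof -
  have bad: "\<exists>x y z. p dvd diag (8 * a) b c (x, y, z) - t \<and> nonsing p (8 * a) b c (x, y, z)"
    if p: "prime p" "p > 2" and d: "p dvd (8 * a) * b * c" for p t
  proof -
    note p2 = not_dvd_2[OF p]
    have p8: "\<not> p dvd 8"
    proof
      assume "p dvd 8"
      then have "p dvd 2 ^ 3" by simp
      then show False using p2 p(1) prime_dvd_power by blast
    qed
    have "p dvd a \<or> p dvd b \<or> p dvd c" using d p(1) p8 by (auto simp: prime_dvd_mult_iff)
    then show ?thesis
    proof (elim disjE)
      assume "p dvd a"
      then have "p dvd odd_part a" using p pos by (simp add: prime_dvd_odd_part)
      note q = quad_residue_coprimeD[OF R(1) p(1) this]
      then obtain r where r: "p dvd r\<^sup>2 - (- (b * c))" by blast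
      have bc: "\<not> p dvd b" "\<not> p dvd c" using q(1) by auto
      obtain y z where "p dvd b * y\<^sup>2 + c * z\<^sup>2 - t" "\<not> (p dvd y \<and> p dvd z)"
        using isotropic_binary_represents[OF p bc, of r t] r by auto
      then have "p dvd diag (8 * a) b c (0, y, z) - t \<and> nonsing p (8 * a) b c (0, y, z)"
        using bc p(1) by (auto simp: diag_def nonsing_def prime_dvd_mult_iff)
      then show ?thesis by blast
    next
      assume "p dvd b"
      then have "p dvd odd_part b" using p pos by (simp add: prime_dvd_odd_part)
      note q = quad_residue_coprimeD[OF R(2) p(1) this]
      then obtain r where r: "p dvd r\<^sup>2 - (- (2 * a * c))" by blast
      \<comment> \<open>The diagonal coefficient is 8 a and not 2 a: if r is a square root of - 2 a
        c, then 2 r is one of - 8 a c.\<close>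
      have "p dvd 4 * (r\<^sup>2 - (- (2 * a * c)))" using r by (rule dvd_mult)
      then have r': "p dvd (2 * r)\<^sup>2 + (8 * a) * c" by (simp add: power2_eq_square algebra_simps)
      have ac: "\<not> p dvd 8 * a" "\<not> p dvd c" using q(1) p8 p(1) by (auto simp: prime_dvd_mult_iff)
      obtain x z where "p dvd (8 * a) * x\<^sup>2 + c * z\<^sup>2 - t" "\<not> (p dvd x \<and> p dvd z)"
        using isotropic_binary_represents[OF p ac r'] by blast
      then have "p dvd diag (8 * a) b c (x, 0, z) - t \<and> nonsing p (8 * a) b c (x, 0, z)"
        using ac p(1) by (auto simp: diag_def nonsing_def prime_dvd_mult_iff)
      then show ?thesis by blast
    next
      assume "p dvd c"
      then have "p dvd odd_part c" using p pos by (simp add: prime_dvd_odd_part)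
      note q = quad_residue_coprimeD[OF R(3) p(1) this]
      then obtain r where r: "p dvd r\<^sup>2 - (- (2 * a * b))" by blast
      have "p dvd 4 * (r\<^sup>2 - (- (2 * a * b)))" using r by (rule dvd_mult)
      then have r': "p dvd (2 * r)\<^sup>2 + (8 * a) * b" by (simp add: power2_eq_square algebra_simps)
      have ab: "\<not> p dvd 8 * a" "\<not> p dvd b" using q(1) p8 p(1) by (auto simp: prime_dvd_mult_iff)
      obtain x y where "p dvd (8 * a) * x\<^sup>2 + b * y\<^sup>2 - t" "\<not> (p dvd x \<and> p dvd y)"
        using isotropic_binary_represents[OF p ab r'] by blast
      then have "p dvd diag (8 * a) b c (x, y, 0) - t \<and> nonsing p (8 * a) b c (x, y, 0)"
        using ab p(1) by (auto simp: diag_def nonsing_def prime_dvd_mult_iff)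
      then show ?thesis by blast
    qed
  qed
  have odd: "odd a \<or> odd b \<or> odd c"
  proof (rule ccontr)
    assume "\<not> (odd a \<or> odd b \<or> odd c)"
    then have "2 dvd Gcd {a, b, c}" by (intro Gcd_greatest) auto
    then have "2 dvd (1::int)" unfolding g .
    then show False by simp
  qed
  have nz: "8 * a * b * c \<noteq> 0" using pos by simp
  obtain W where W: "\<And>m. odd m \<Longrightarrow> m > 0 \<Longrightarrow> avg_inv (8 * a) b c m \<le> W \<and> (\<forall>t. card (dsols (8 * a) b c m t) > 0)"
    using avg_inv_bounded[OF nz bad] by blast
  note Ws = sum_inverse_card_sols_le[OF W b4 odd]
  let ?f = "\<lambda>x y z. a * x\<^sup>2 + b * triangular y + c * triangular z"
  have "(\<lambda>N. real (card {n \<in> exceptional_set ?f. 1 \<le> n \<and> n \<le> N}) / real N) \<longlonglongrightarrow> 0"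
  proof (rule LIMSEQ_I)
    fix r :: real assume r: "r > 0"
    define \<nu> where "\<nu> = min 1 (r / 5)"
    have \<nu>: "0 < \<nu>" "\<nu> \<le> 1" "4 * \<nu> < r" using r by (auto simp: \<nu>_def)
    obtain N0 where N0: "\<And>N. N \<ge> N0 \<Longrightarrow> card {n::nat. n \<le> N \<and> (\<forall>v. form a b c v \<noteq> int n)} \<le> 4 * \<nu> * N"
      using card_exceptional_le[OF pos \<nu>(1,2) Ws] by blast
    show "\<exists>no. \<forall>N\<ge>no. norm (real (card {n \<in> exceptional_set ?f. 1 \<le> n \<and> n \<le> N}) / real N - 0) < r"
    proof (intro exI[of _ "max 1 N0"] allI impI)
      fix N assume N: "N \<ge> max 1 N0"
      have "card {n \<in> exceptional_set ?f. 1 \<le> n \<and> n \<le> N} \<le> card {n::nat. n \<le> N \<and> (\<forall>v. form a b c v \<noteq> int n)}"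
        by (intro card_mono finite_subset[of "{n::nat. n \<le> N \<and> (\<forall>v. form a b c v \<noteq> int n)}" "{..N}"])
          (auto simp: exceptional_set_def form_def)
      then have "real (card {n \<in> exceptional_set ?f. 1 \<le> n \<and> n \<le> N}) \<le> 4 * \<nu> * N" using N0[of N] N by simp
      also have "\<dots> < r * N" using \<nu>(3) N by simp
      finally have "real (card {n \<in> exceptional_set ?f. 1 \<le> n \<and> n \<le> N}) / real N < r" using N by (simp add: divide_less_eq)
      then show "norm (real (card {n \<in> exceptional_set ?f. 1 \<le> n \<and> n \<le> N}) / real N - 0) < r" by simp
    qed
  qed
  then show ?thesis unfolding asymptotically_universal_def has_asymptotic_density_def .
qed

section \<open>Residue classes that are missed\<close>

lemma not_universal_if_class_missed:
  fixes f :: "int \<Rightarrow> int \<Rightarrow> int \<Rightarrow> int" and m s :: int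
  assumes m: "m > 0" and miss: "\<And>x y z. \<not> m dvd f x y z - s"
  shows "\<not> asymptotically_universal f"
proof
  assume "asymptotically_universal f"
  then have lim: "(\<lambda>N. real (card {n \<in> exceptional_set f. 1 \<le> n \<and> n \<le> N}) / real N) \<longlonglongrightarrow> 0"
    unfolding asymptotically_universal_def has_asymptotic_density_def .
  define M where "M = nat m"
  \<comment> \<open>Shifted by one, so that t + 1 lies between 1 and m: each block of m positive
    integers, counted from 1, then contains a number of the missed class, and k blocks end at M
    k.\<close>
  define t where "t = nat ((s - 1) mod m)"
  have M: "M > 0" "int M = m" using m by (simp_all add: M_def)
  have t: "int t = (s - 1) mod m" "t < M" using m by (simp_all add: t_def M_def nat_less_iff)
  have exc: "t + 1 + M * i \<in> exceptional_set f" for i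
  proof -
    have "m dvd int (t + 1 + M * i) - s"
    proof -
      have "int (t + 1 + M * i) - s = m * int i - ((s - 1) - (s - 1) mod m)" by (simp add: t(1) M(2))
      moreover have "m dvd (s - 1) - (s - 1) mod m" by (simp add: minus_mod_eq_mult_div)
      ultimately show ?thesis by (simp only: dvd_diff dvd_triv_left)
    qed
    then have "f x y z \<noteq> int (t + 1 + M * i)" for x y z using miss[of x y z] by metis
    then show ?thesis by (simp add: exceptional_set_def)
  qed
  have low: "k \<le> card {n \<in> exceptional_set f. 1 \<le> n \<and> n \<le> M * k}" for k
  proof -
    have "card {..<k} \<le> card {n \<in> exceptional_set f. 1 \<le> n \<and> n \<le> M * k}"
    proof (rule card_inj_on_le[of "\<lambda>i. t + 1 + M * i"])
      show "inj_on (\<lambda>i. t + 1 + M * i) {..<k}" using M by (auto simp: inj_on_def)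
      show "(\<lambda>i. t + 1 + M * i) ` {..<k} \<subseteq> {n \<in> exceptional_set f. 1 \<le> n \<and> n \<le> M * k}"
      proof (rule image_subsetI)
        fix i assume "i \<in> {..<k}"
        then have "M * (i + 1) \<le> M * k" by (intro mult_left_mono) auto
        then show "t + 1 + M * i \<in> {n \<in> exceptional_set f. 1 \<le> n \<and> n \<le> M * k}" using exc t(2) by simp
      qed
      show "finite {n \<in> exceptional_set f. 1 \<le> n \<and> n \<le> M * k}"
        by (rule finite_subset[of _ "{..M * k}"]) auto
    qed
    then show ?thesis by simp
  qed
  have "1 / real M > 0" using M by simp
  then obtain no where no: "\<And>N. N \<ge> no \<Longrightarrow> norm (real (card {n \<in> exceptional_set f. 1 \<le> n \<and> n \<le> N}) / real N - 0) < 1 / real M"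
    using LIMSEQ_D[OF lim] by blast
  define k where "k = Suc no"
  have "1 * k \<le> M * k" using M by (intro mult_right_mono) auto
  then have "M * k \<ge> no" by (simp add: k_def)
  then have "real (card {n \<in> exceptional_set f. 1 \<le> n \<and> n \<le> M * k}) / real (M * k) < 1 / real M" using no[of "M * k"] by simp
  then have "real (card {n \<in> exceptional_set f. 1 \<le> n \<and> n \<le> M * k}) < real k"
  proof -
    have "M * k > 0" using M(1) by (simp add: k_def)
    then have Mk: "real (M * k) > 0" by (simp only: of_nat_0_less_iff)
    then have "real (card {n \<in> exceptional_set f. 1 \<le> n \<and> n \<le> M * k}) < 1 / real M * real (M * k)"
      using \<open>_ / real (M * k) < 1 / real M\<close> by (simp only: pos_divide_less_eq)
    also have "\<dots> = real k" using M by simp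
    finally show ?thesis .
  qed
  then show False using low[of k] by simp
qed

text \<open>1 and p - 1 have the same square modulo p, so x -> A x^2 is not injective on the
  residues, hence not onto.\<close>

lemma square_multiple_missed:
  fixes p A :: int
  assumes p: "prime p" "p > 2"
  shows "\<exists>u. \<forall>x. \<not> p dvd A * x\<^sup>2 - u"
proof -
  let ?g = "\<lambda>x. (A * x\<^sup>2) mod p"
  have "\<not> inj_on ?g {0..<p}"
  proof
    assume inj: "inj_on ?g {0..<p}"
    have "?g 1 = ?g (p - 1)"
    proof -
      have "A * (p - 1)\<^sup>2 = A + p * (A * (p - 2))" by (simp add: power2_eq_square algebra_simps)
      then show ?thesis by simp
    qed
    then have "1 = p - 1" by (rule inj_onD[OF inj]) (use p(2) in auto)
    then show False using p(2) by simp
  qed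
  then have "?g ` {0..<p} \<noteq> {0..<p}" using eq_card_imp_inj_on[of "{0..<p}" ?g] by fastforce
  moreover have "?g ` {0..<p} \<subseteq> {0..<p}" using p by auto
  ultimately obtain u where u: "u \<in> {0..<p}" "u \<notin> ?g ` {0..<p}" by blast
  have "\<not> p dvd A * x\<^sup>2 - u" for x
  proof
    assume "p dvd A * x\<^sup>2 - u"
    then have "(A * x\<^sup>2) mod p = u mod p" by (simp add: mod_eq_dvd_iff)
    moreover have "(A * (x mod p)\<^sup>2) mod p = (A * x\<^sup>2) mod p" by (metis mod_mult_right_eq power_mod)
    ultimately have "?g (x mod p) = u" using u(1) by simp
    moreover have "x mod p \<in> {0..<p}" using p(2) by simp
    ultimately show False using u(2) by blast
  qed
  then show ?thesis by blast
qed

text \<open>If the binary part is anisotropic modulo \<open>p\<close>, then a value divisible by \<open>p\<close> is, modulo \<open>p\<^sup>2\<close>,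
  \<open>p\<close> times a multiple of a square.\<close>

lemma diagonal_class_missed:
  fixes p A1 A2 A3 :: int
  assumes p: "prime p" "p > 2" and A1: "p dvd A1"
    and aniso: "p dvd A2 \<or> p dvd A3 \<or> (\<forall>r. \<not> p dvd r\<^sup>2 + A2 * A3)"
  shows "\<exists>t. \<forall>x y z. \<not> p\<^sup>2 dvd A1 * x\<^sup>2 + A2 * y\<^sup>2 + A3 * z\<^sup>2 - t"
proof -
  have pp: "p dvd p\<^sup>2" by (simp add: power2_eq_square)
  \<comment> \<open>If a second coefficient is divisible by p, the form reduces to a single square
    term modulo p, and a class is missed already there.\<close>
  have one: "\<exists>t. \<forall>x y z. \<not> p\<^sup>2 dvd A1 * x\<^sup>2 + B * y\<^sup>2 + C * z\<^sup>2 - t" if B: "p dvd B" for B C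
  proof -
    obtain t where t: "\<And>z. \<not> p dvd C * z\<^sup>2 - t" using square_multiple_missed[OF p] by blast
    have "\<not> p\<^sup>2 dvd A1 * x\<^sup>2 + B * y\<^sup>2 + C * z\<^sup>2 - t" for x y z
    proof
      assume "p\<^sup>2 dvd A1 * x\<^sup>2 + B * y\<^sup>2 + C * z\<^sup>2 - t"
      then have "p dvd A1 * x\<^sup>2 + B * y\<^sup>2 + C * z\<^sup>2 - t" using pp by (rule dvd_trans[rotated])
      moreover have "p dvd A1 * x\<^sup>2 + B * y\<^sup>2" using A1 B by simp
      ultimately have "p dvd (A1 * x\<^sup>2 + B * y\<^sup>2 + C * z\<^sup>2 - t) - (A1 * x\<^sup>2 + B * y\<^sup>2)" by (rule dvd_diff)
      then show False using t[of z] by simp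
    qed
    then show ?thesis by blast
  qed
  consider "p dvd A2" | "p dvd A3" | "\<not> p dvd A2" "\<not> p dvd A3" "\<forall>r. \<not> p dvd r\<^sup>2 + A2 * A3" using aniso by blast
  then show ?thesis
  proof cases
    case 1
    then show ?thesis by (rule one)
  next
    case 2
    obtain t where t: "\<And>x y z. \<not> p\<^sup>2 dvd A1 * x\<^sup>2 + A3 * y\<^sup>2 + A2 * z\<^sup>2 - t" using one[OF 2, of A2] by blast
    have "A1 * x\<^sup>2 + A2 * y\<^sup>2 + A3 * z\<^sup>2 - t = A1 * x\<^sup>2 + A3 * z\<^sup>2 + A2 * y\<^sup>2 - t" for x y z by simp
    then show ?thesis using t by metis
  next
    case 3
    obtain A where A: "A1 = p * A" using A1 by blast
    obtain u where u: "\<And>x. \<not> p dvd A * x\<^sup>2 - u" using square_multiple_missed[OF p] by blast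
    have "\<not> p\<^sup>2 dvd A1 * x\<^sup>2 + A2 * y\<^sup>2 + A3 * z\<^sup>2 - p * u" for x y z
    proof
      assume d: "p\<^sup>2 dvd A1 * x\<^sup>2 + A2 * y\<^sup>2 + A3 * z\<^sup>2 - p * u"
      then have "p dvd A1 * x\<^sup>2 + A2 * y\<^sup>2 + A3 * z\<^sup>2 - p * u" using pp by (rule dvd_trans[rotated])
      then have "p dvd (A1 * x\<^sup>2 + A2 * y\<^sup>2 + A3 * z\<^sup>2 - p * u) - p * (A * x\<^sup>2 - u)" by (rule dvd_diff) simp
      then have yz: "p dvd A2 * y\<^sup>2 + A3 * z\<^sup>2" by (simp add: A algebra_simps)
      have z: "p dvd z"
      proof (rule ccontr)
        assume "\<not> p dvd z"
        then obtain w where w: "p dvd z * w - 1" using dvd_mult_minus_exists[OF p(1)] by blast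
        \<comment> \<open>With w inverse to z, the square of A2 y w is - A2 A3 modulo p, contrary to
          anisotropy.\<close>
        have "p dvd (A2 * w\<^sup>2) * (A2 * y\<^sup>2 + A3 * z\<^sup>2) - (A2 * A3 * (z * w + 1)) * (z * w - 1)"
          by (rule dvd_diff[OF dvd_mult[OF yz] dvd_mult[OF w]])
        also have "\<dots> = (A2 * y * w)\<^sup>2 + A2 * A3" by (simp add: power2_eq_square algebra_simps)
        finally show False using 3(3) by blast
      qed
      then have "p dvd A3 * z\<^sup>2" by (simp add: power2_eq_square)
      then have "p dvd A2 * y\<^sup>2" using yz by (simp add: dvd_add_left_iff)
      then have y: "p dvd y" using 3(1) p(1) by (auto simp: prime_dvd_mult_iff dest: prime_dvd_power)
      obtain y' z' where "y = p * y'" "z = p * z'" using y z by blast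
      then have "A1 * x\<^sup>2 + A2 * y\<^sup>2 + A3 * z\<^sup>2 - p * u = p * (A * x\<^sup>2 - u) + p\<^sup>2 * (A2 * y'\<^sup>2 + A3 * z'\<^sup>2)"
        by (simp add: A power2_eq_square algebra_simps)
      then have "p\<^sup>2 dvd p * (A * x\<^sup>2 - u) + p\<^sup>2 * (A2 * y'\<^sup>2 + A3 * z'\<^sup>2)" using d by simp
      then have "p * p dvd p * (A * x\<^sup>2 - u)" by (simp add: dvd_add_left_iff power2_eq_square)
      then have "p dvd A * x\<^sup>2 - u" using p(2) by simp
      then show False using u by blast
    qed
    then show ?thesis by blast
  qed
qed

text \<open>The three choices of (A1, A2, A3) put the coefficient divisible by p in front. A class t
  that the diagonal form misses modulo p^2 is missed in particular at the odd arguments 2 y + 1 and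
  2 z + 1; solving 8 s + b + c = t modulo p^2 turns it into a class s missed by the given
  form.\<close>

lemma universal_imp_local:
  fixes a b c p :: int
  assumes U: "asymptotically_universal (\<lambda>x y z. a * x\<^sup>2 + b * triangular y + c * triangular z)"
    and p: "prime p" "p > 2" and A: "(A1, A2, A3) \<in> {(8 * a, b, c), (b, 8 * a, c), (c, 8 * a, b)}"
    and d: "p dvd A1"
  shows "\<not> p dvd A2 \<and> \<not> p dvd A3 \<and> (\<exists>r. p dvd r\<^sup>2 + A2 * A3)"
proof (rule ccontr)
  assume "\<not> (\<not> p dvd A2 \<and> \<not> p dvd A3 \<and> (\<exists>r. p dvd r\<^sup>2 + A2 * A3))"
  then have "p dvd A2 \<or> p dvd A3 \<or> (\<forall>r. \<not> p dvd r\<^sup>2 + A2 * A3)" by blast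
  from diagonal_class_missed[OF p d this]
  obtain t where "\<And>x y z. \<not> p\<^sup>2 dvd A1 * x\<^sup>2 + A2 * y\<^sup>2 + A3 * z\<^sup>2 - t" by blast
  moreover have "\<exists>x' y' z'. diag (8 * a) b c (x, y, z) = A1 * x'\<^sup>2 + A2 * y'\<^sup>2 + A3 * z'\<^sup>2" for x y z
    using A by (auto simp: diag_def) (metis add.commute add.left_commute)+
  ultimately have t: "\<not> p\<^sup>2 dvd diag (8 * a) b c (x, y, z) - t" for x y z by metis
  have "coprime (8::int) (p\<^sup>2)"
  proof -
    have "coprime 2 p" using not_dvd_2[OF p] p(1) prime_imp_coprime[of p 2] by (simp add: coprime_commute)
    then have "coprime (2 ^ 3) (p\<^sup>2)" by (simp only: coprime_power_left_iff coprime_power_right_iff) simp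
    then show ?thesis by simp
  qed
  then obtain w where "[8 * w = 1] (mod p\<^sup>2)" using cong_solve_coprime_int by blast
  then have w: "p\<^sup>2 dvd (8 * w - 1) * (t - b - c)" by (simp add: cong_iff_dvd_diff)
  define s where "s = w * (t - b - c)"
  have miss: "\<not> p\<^sup>2 dvd (a * x\<^sup>2 + b * triangular y + c * triangular z) - s" for x y z
  proof
    assume "p\<^sup>2 dvd (a * x\<^sup>2 + b * triangular y + c * triangular z) - s"
    then have "p\<^sup>2 dvd 8 * (form a b c (x, y, z) - s)" unfolding form_def prod.case by (rule dvd_mult)
    then have "p\<^sup>2 dvd (diag (8 * a) b c (x, 2 * y + 1, 2 * z + 1) - (8 * s + b + c)) + (8 * w - 1) * (t - b - c)"
      unfolding form_diag using w by (rule dvd_add)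
    moreover have "(diag (8 * a) b c (x, 2 * y + 1, 2 * z + 1) - (8 * s + b + c)) + (8 * w - 1) * (t - b - c)
      = diag (8 * a) b c (x, 2 * y + 1, 2 * z + 1) - t" by (simp add: s_def algebra_simps)
    ultimately show False using t by simp
  qed
  have "p\<^sup>2 > 0" using p(2) by simp
  from not_universal_if_class_missed[OF this miss] U show False by contradiction
qed

text \<open>Remove one prime factor p at a time. If p still divides the cofactor m', a root modulo
  m' is corrected by a Hensel step, possible as p divides neither 2 nor the root; otherwise roots
  modulo p and modulo m' are combined by the Chinese remainder theorem.\<close>

lemma square_root_mod_odd:
  fixes m u :: int
  assumes "odd m" "m > 0" "\<And>p. prime p \<Longrightarrow> p dvd m \<Longrightarrow> \<not> p dvd u \<and> (\<exists>r. p dvd r\<^sup>2 - u)"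
  shows "\<exists>r. m dvd r\<^sup>2 - u"
  using assms
proof (induction "nat m" arbitrary: m rule: less_induct)
  case less
  show ?case
  proof (cases "m = 1")
    case False
    then obtain p where p: "prime p" "p dvd m" using less.prems(2) prime_factor_int[of m] by auto
    then obtain m' where m': "m = p * m'" by blast
    have p0: "p > 1" using p(1) prime_gt_1_int by blast
    have m'0: "m' > 0" using less.prems(2) p0 by (simp add: m' zero_less_mult_iff)
    have "m' < m" using p0 m'0 by (simp add: m')
    then have "\<exists>r. m' dvd r\<^sup>2 - u"
      using less.prems m'0 by (intro less.hyps) (auto simp: m')
    then obtain r where r: "m' dvd r\<^sup>2 - u" by blast
    have pu: "\<not> p dvd u" using less.prems(3) p by blast
    show ?thesis
    proof (cases "p dvd m'")
      case True
      obtain e where e: "r\<^sup>2 - u = m' * e" using r by blast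
      have pr: "\<not> p dvd r"
      proof
        assume "p dvd r"
        then have "p dvd r\<^sup>2" by (simp add: power2_eq_square)
        moreover have "p dvd r\<^sup>2 - u" using True e by simp
        ultimately have "p dvd r\<^sup>2 - (r\<^sup>2 - u)" by (rule dvd_diff)
        then show False using pu by simp
      qed
      have "odd p" using less.prems(1) by (simp add: m')
      then have "\<not> p dvd 2" using p(1) by (metis dvd_refl primes_dvd_imp_eq two_is_prime_nat prime_int_numeral_eq)
      then have "\<not> p dvd 2 * r" using pr p(1) by (simp add: prime_dvd_mult_iff)
      then obtain s where s: "p dvd 2 * r * s - (- e)" using dvd_mult_minus_exists[OF p(1)] by blast
      have "(r + m' * s)\<^sup>2 - u = m' * (2 * r * s - (- e)) + m' * m' * s\<^sup>2"
        using e by (simp add: power2_eq_square algebra_simps)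
      moreover have "p * m' dvd m' * (2 * r * s - (- e))" using s by (metis mult.commute mult_dvd_mono dvd_refl)
      moreover have "p * m' dvd m' * m' * s\<^sup>2" using True by (simp add: mult_dvd_mono)
      ultimately have "m dvd (r + m' * s)\<^sup>2 - u" unfolding m' by (simp only: dvd_add)
      then show ?thesis by blast
    next
      case False
      then have cop: "coprime p m'" by (rule prime_imp_coprime[OF p(1)])
      obtain r1 where r1: "p dvd r1\<^sup>2 - u" using less.prems(3) p by blast
      obtain x where x: "[x = r1] (mod p)" "[x = r] (mod m')" using binary_chinese_remainder_int[OF cop] by blast
      have "k dvd x\<^sup>2 - u" if "k dvd s\<^sup>2 - u" "[x = s] (mod k)" for k s
      proof -
        have "k dvd (x - s) * (x + s) + (s\<^sup>2 - u)" using that by (intro dvd_add dvd_mult2) (simp_all add: cong_iff_dvd_diff)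
        then show ?thesis by (simp add: power2_eq_square algebra_simps)
      qed
      then have "p dvd x\<^sup>2 - u" "m' dvd x\<^sup>2 - u" using r1 r x by blast+
      then show ?thesis using cop unfolding m' by (meson divides_mult)
    qed
  qed auto
qed

lemma quad_residue_coprimeI:
  fixes n u :: int
  assumes n: "n > 0" and loc: "\<And>p. prime p \<Longrightarrow> p > 2 \<Longrightarrow> p dvd n \<Longrightarrow> \<not> p dvd u \<and> (\<exists>r. p dvd r\<^sup>2 - u)"
  shows "u \<R> odd_part n"
proof -
  have odd: "odd (odd_part n)" using odd_odd_part n by simp
  have loc': "\<not> p dvd u \<and> (\<exists>r. p dvd r\<^sup>2 - u)" if p: "prime p" "p dvd odd_part n" for p
  proof -
    have "p \<noteq> 2" using p(2) odd by auto
    then have p2: "p > 2" using prime_ge_2_int[OF p(1)] by simp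
    then show ?thesis using loc[OF p(1) p2] p prime_dvd_odd_part n by simp
  qed
  obtain r where "odd_part n dvd r\<^sup>2 - u" using square_root_mod_odd[OF odd odd_part_pos[OF n] loc'] by blast
  then have "QuadRes (odd_part n) u" unfolding QuadRes_def by (auto simp: cong_iff_dvd_diff)
  moreover have "coprime u (odd_part n)"
  proof (rule ccontr)
    assume "\<not> coprime u (odd_part n)"
    then have "\<not> is_unit (gcd u (odd_part n))" by (simp add: coprime_iff_gcd_eq_1)
    moreover have "gcd u (odd_part n) \<noteq> 0" using odd by auto
    ultimately obtain p where "prime p" "p dvd gcd u (odd_part n)" using prime_divisor_exists by blast
    then show False using loc' by auto
  qed
  ultimately show ?thesis by (simp add: quad_residue_coprime_def)
qed

theorem theorem1p2:
  fixes a b c :: int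
  assumes "a > 0" and "b > 0" and "c > 0"
    and "Gcd {a, b, c} = 1"
  shows "asymptotically_universal (\<lambda>x y z. a * x\<^sup>2 + b * triangular y + c * triangular z) \<longleftrightarrow>
    ((- (b * c)) \<R> odd_part a \<and> (- (2 * a * c)) \<R> odd_part b \<and> (- (2 * a * b)) \<R> odd_part c) \<and>
    (\<not> 4 dvd b \<or> \<not> 4 dvd c)"
  (is "?U \<longleftrightarrow> ?R \<and> ?D")
proof
  assume U: ?U
  have p8: "p dvd 8 * t \<longleftrightarrow> p dvd t" if p: "prime p" "p > 2" for p t :: int
  proof -
    have "\<not> p dvd 2 ^ 3" using not_dvd_2[OF p] p(1) prime_dvd_power by blast
    then show ?thesis using p(1) by (simp add: prime_dvd_mult_iff)
  qed
  \<comment> \<open>s = r / 2 modulo p passes from a root of - 8 t, as the coefficient 8 a supplies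
    it, to a root of - 2 t.\<close>
  have half: "\<exists>s. p dvd s\<^sup>2 - (- (2 * t))" if p: "prime p" "p > 2" and r: "p dvd r\<^sup>2 + 8 * t" for p r t :: int
  proof -
    obtain s where s: "p dvd 2 * s - r" using dvd_mult_minus_exists[OF p(1) not_dvd_2[OF p]] by blast
    have "p dvd (2 * s - r) * (2 * s + r) + (r\<^sup>2 + 8 * t)" by (rule dvd_add[OF dvd_mult2[OF s] r])
    also have "\<dots> = 2 * (2 * (s\<^sup>2 - (- (2 * t))))" by (simp add: power2_eq_square algebra_simps)
    finally have "p dvd s\<^sup>2 - (- (2 * t))" using not_dvd_2[OF p] p(1) prime_dvd_mult_iff by blast
    then show ?thesis by blast
  qed
  have "(- (b * c)) \<R> odd_part a"
  proof (rule quad_residue_coprimeI[OF assms(1)])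
    fix p :: int assume p: "prime p" "p > 2" "p dvd a"
    have "\<not> p dvd b \<and> \<not> p dvd c \<and> (\<exists>r. p dvd r\<^sup>2 + b * c)"
      using p by (intro universal_imp_local[OF U p(1,2), of "8 * a"]) auto
    then show "\<not> p dvd - (b * c) \<and> (\<exists>r. p dvd r\<^sup>2 - (- (b * c)))" using p(1) by (simp add: prime_dvd_mult_iff)
  qed
  moreover have "(- (2 * a * c)) \<R> odd_part b"
  proof (rule quad_residue_coprimeI[OF assms(2)])
    fix p :: int assume p: "prime p" "p > 2" "p dvd b"
    have *: "\<not> p dvd 8 * a \<and> \<not> p dvd c \<and> (\<exists>r. p dvd r\<^sup>2 + (8 * a) * c)"
      using p by (intro universal_imp_local[OF U p(1,2), of b]) auto
    then obtain r where "p dvd r\<^sup>2 + 8 * (a * c)" by (auto simp: mult.assoc)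
    from half[OF p(1,2) this] show "\<not> p dvd - (2 * a * c) \<and> (\<exists>r. p dvd r\<^sup>2 - (- (2 * a * c)))"
      using * p(1,2) p8 not_dvd_2 by (simp add: prime_dvd_mult_iff mult.assoc)
  qed
  moreover have "(- (2 * a * b)) \<R> odd_part c"
  proof (rule quad_residue_coprimeI[OF assms(3)])
    fix p :: int assume p: "prime p" "p > 2" "p dvd c"
    have *: "\<not> p dvd 8 * a \<and> \<not> p dvd b \<and> (\<exists>r. p dvd r\<^sup>2 + (8 * a) * b)"
      using p by (intro universal_imp_local[OF U p(1,2), of c]) auto
    then obtain r where "p dvd r\<^sup>2 + 8 * (a * b)" by (auto simp: mult.assoc)
    from half[OF p(1,2) this] show "\<not> p dvd - (2 * a * b) \<and> (\<exists>r. p dvd r\<^sup>2 - (- (2 * a * b)))"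
      using * p(1,2) p8 not_dvd_2 by (simp add: prime_dvd_mult_iff mult.assoc)
  qed
  moreover have ?D
  proof (rule ccontr)
    assume "\<not> ?D"
    then have bc: "4 dvd b" "4 dvd c" by auto
    \<comment> \<open>Squares are 0 or 1 modulo 4, so a x^2 is 0 or a modulo 4; s is chosen to
      differ from both.\<close>
    define s :: int where "s = (if a mod 4 = 2 then 1 else 2)"
    have miss: "\<not> 4 dvd (a * x\<^sup>2 + b * triangular y + c * triangular z) - s" for x y z
    proof
      assume "4 dvd (a * x\<^sup>2 + b * triangular y + c * triangular z) - s"
      moreover have "4 dvd b * triangular y + c * triangular z" using bc by simp
      ultimately have "4 dvd (a * x\<^sup>2 + b * triangular y + c * triangular z) - s - (b * triangular y + c * triangular z)"
        by (rule dvd_diff)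
      then have "4 dvd a * x\<^sup>2 - s" by (simp add: algebra_simps)
      then have "(a * x\<^sup>2) mod 4 = s mod 4" by (simp add: mod_eq_dvd_iff)
      moreover have "(a * x\<^sup>2) mod 4 = 0 \<or> (a * x\<^sup>2) mod 4 = a mod 4"
      proof (cases "even x")
        case True
        then obtain k where "x = 2 * k" by blast
        then have "a * x\<^sup>2 = 4 * (a * k\<^sup>2)" by (simp add: power2_eq_square)
        then have "4 dvd a * x\<^sup>2" by (metis dvd_triv_left)
        then have "(a * x\<^sup>2) mod 4 = 0" by (simp only: dvd_eq_mod_eq_0)
        then show ?thesis ..
      next
        case False
        then obtain k where "x = 2 * k + 1" using oddE by blast
        then have "a * x\<^sup>2 = a + 4 * (a * (k\<^sup>2 + k))" by (simp add: power2_eq_square algebra_simps)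
        then show ?thesis by simp
      qed
      ultimately show False by (auto simp: s_def split: if_splits)
    qed
    from not_universal_if_class_missed[OF zero_less_numeral miss] U show False by contradiction
  qed
  ultimately show "?R \<and> ?D" by blast
next
  assume RD: "?R \<and> ?D"
  show ?U
  proof (cases "4 dvd b")
    case False
    then show ?thesis using RD universal_if_local_conditions[OF assms] by blast
  next
    case True
    then have c4: "\<not> 4 dvd c" using RD by blast
    have "Gcd {a, c, b} = 1" using assms(4) by (simp add: insert_commute)
    moreover have "(- (c * b)) \<R> odd_part a" using RD by (simp add: mult.commute)
    ultimately have "asymptotically_universal (\<lambda>x y z. a * x\<^sup>2 + c * triangular y + b * triangular z)"
      using universal_if_local_conditions[OF assms(1,3,2)] RD c4 by blast
    moreover have "exceptional_set (\<lambda>x y z. a * x\<^sup>2 + c * triangular y + b * triangular z)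
      = exceptional_set (\<lambda>x y z. a * x\<^sup>2 + b * triangular y + c * triangular z)"
    proof -
      have "exceptional_set f = exceptional_set (\<lambda>x y z. f x z y)" for f
        unfolding exceptional_set_def by blast
      from this[of "\<lambda>x y z. a * x\<^sup>2 + c * triangular y + b * triangular z"]
      show ?thesis by (simp add: add_ac)
    qed
    ultimately show ?thesis by (simp add: asymptotically_universal_def)
  qed
qed

end
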